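(* Let $F\colon\mathcal K\to\mathcal L$ be an exact functor of triangulated categories with a left adjoint $V\colon\mathcal L\to\mathcal K$ and a right adjoint $U\colon\mathcal L\to\mathcal K$. Suppose that there exists an equivalence $W\colon\mathcal L\to\mathcal L$ such that $V\circ W\simeq U$. Then the $F$-injectives and the $F$-projectives in $\mathcal K$ coincide and are given by $$\operatorname{add}(\operatorname{Im}(U))=\operatorname{add}(\operatorname{Im}(V)).$$ In other words, the class $\mathcal E_F$ of $F$-split triangles is Frobenius. In particular, there is an induced triangulated structure on the relative stable category $\underline{\mathcal K}_F:=\underline{\mathcal K}_{\mathcal E_F}$.
   Context: Standing assumption: $\mathcal K$ is essentially small, with suspension $\Sigma$. Subcategories are full and replete. $\operatorname{Im}$ is the essential image; $\operatorname{add}(\mathcal A)$ is the closure of $\mathcal A$ under finite direct sums and direct summands. A distinguished triangle $X\xrightarrow{f}Y\xrightarrow{g}Z\xrightarrow{h}\Sigma X$ in $\mathcal K$ is $F$-split if $F(h)=0$; then $f$ is called an $F$-monomorphism, $g$ an $F$-epimorphism. $\mathcal E_F$ is the class of all $F$-split triangles. An object $P$ is $F$-projective if $0\to\mathcal K(P,X)\to\mathcal K(P,Y)\to\mathcal K(P,Z)\to0$ is exact for every $F$-split triangle, and $I$ is $F$-injective if $0\to\mathcal K(Z,I)\to\mathcal K(Y,I)\to\mathcal K(X,I)\to0$ is exact for every $F$-split triangle. General definitions. Let $\mathcal E$ be a family of distinguished triangles $X\xrightarrow{f}Y\xrightarrow{g}Z\xrightarrow{h}\Sigma X$ in $\mathcal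 K$; for a triangle in $\mathcal E$ one calls $f$ an $\mathcal E$-monomorphism, $g$ an $\mathcal E$-epimorphism and $h$ an $\mathcal E$-phantom. $\mathcal E$ is a proper class of triangles if it is closed under isomorphisms, suspension (triple rotation), finite sums and retracts; contains all triangles $X\xrightarrow{\mathrm{id}}X\to0\to\Sigma X$ and $0\to Y\xrightarrow{\mathrm{id}}Y\to0$; $\mathcal E$-monomorphisms are closed under homotopy pushouts and $\mathcal E$-epimorphisms under homotopy pullbacks; and $\mathcal E$ is saturated: if the homotopy pullback of $g$ along an $\mathcal E$-epimorphism is an $\mathcal E$-epimorphism, then $g$ is an $\mathcal E$-epimorphism. ($\mathcal E_F$ is a proper class.) $\operatorname{proj}(\mathcal E)$ denotes the class of $\mathcal E$-projectives, i.e. the objects $P$ such that $0\to\mathcal K(P,X)\to\mathcal K(P,Y)\to\mathcal K(P,Z)\to0$ is exact for every triangle $X\to Y\to Z\to\Sigma X$ in $\mathcal E$, and $\operatorname{inj}(\mathcal E)$ denotes the class of $\mathcal E$-injectives, i.e. the objects $I$ such that $0\to\mathcal K(Z,I)\to\mathcal K(Y,I)\to\mathcal K(X,I)\to0$ is exact for every triangle $X\to Y\to Z\to\Sigma X$ in $\mathcal E$. $\mathcal E$ is Frobenius if it is a proper class, every $X$ admits an $\mathcal E$-epimorphism $P\to X$ with $P$ $\mathcal E$-projective and an $\mathcal E$-monomorphism $X\to I$ with $I$ $\mathcal E$-injective, and $\operatorname{proj}(\mathcal E)=\operatorname{inj}(\mathcal E)$. For $\mathcal E$ Frobenius, $\pi\colon\mathcal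 K\to\underline{\mathcal K}_{\mathcal E}=\mathcal K/\operatorname{proj}(\mathcal E)$ is the additive quotient (same objects, morphisms modulo those factoring through an object of $\operatorname{proj}(\mathcal E)$). Its induced triangulated structure (Beligiannis): for each $X$ choose an $\mathcal E$-monomorphism $X\to X_{\mathcal E}$ with $X_{\mathcal E}\in\operatorname{inj}(\mathcal E)$ and a distinguished triangle $X\to X_{\mathcal E}\to X'\to\Sigma X$, and set $\Sigma_{\mathcal E}X=\pi(X')$. For $f\colon X\to Y$ in $\mathcal K$ form the homotopy pushout $Z$ of $X_{\mathcal E}\leftarrow X\xrightarrow{f}Y$ and the induced map from $X\to X_{\mathcal E}\to X'\to\Sigma X$ to the distinguished triangle $Y\xrightarrow{g}Z\xrightarrow{h}X'\to\Sigma Y$ which is the identity on $X'$; the distinguished triangles are those isomorphic to some $X\xrightarrow{\pi f}Y\xrightarrow{\pi g}Z\xrightarrow{\pi h}\Sigma_{\mathcal E}X$. *)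

theory Defs
  imports "HOL-Algebra.Exact_Sequence"
begin

section \<open>Categories\<close>

record ('o, 'm) cat =
  Obj :: "'o set"
  Arr :: "'m set"
  Dom :: "'m \<Rightarrow> 'o"
  Cod :: "'m \<Rightarrow> 'o"
  Idt :: "'o \<Rightarrow> 'm"
  Comp :: "'m \<Rightarrow> 'm \<Rightarrow> 'm"  (infixl \<open>\<cdot>\<index>\<close> 70)

definition Hom :: "('o, 'm, 'x) cat_scheme \<Rightarrow> 'o \<Rightarrow> 'o \<Rightarrow> 'm set" where
  "Hom C X Y = {f \<in> Arr C. Dom C f = X \<and> Cod C f = Y}"

locale category =
  fixes C :: "('o, 'm, 'x) cat_scheme" (structure)
  assumes Dom_in_Obj: "f \<in> Arr C \<Longrightarrow> Dom C f \<in> Obj C"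
    and Cod_in_Obj: "f \<in> Arr C \<Longrightarrow> Cod C f \<in> Obj C"
    and Idt_in_Hom: "X \<in> Obj C \<Longrightarrow> Idt C X \<in> Hom C X X"
    and Comp_in_Hom: "\<lbrakk>f \<in> Hom C X Y; g \<in> Hom C Y Z\<rbrakk> \<Longrightarrow> g \<cdot> f \<in> Hom C X Z"
    and Comp_Idt: "f \<in> Hom C X Y \<Longrightarrow> f \<cdot> Idt C X = f"
    and Idt_Comp: "f \<in> Hom C X Y \<Longrightarrow> Idt C Y \<cdot> f = f"
    and Comp_assoc: "\<lbrakk>f \<in> Hom C X Y; g \<in> Hom C Y Z; h \<in> Hom C Z W\<rbrakk>
      \<Longrightarrow> (h \<cdot> g) \<cdot> f = h \<cdot> (g \<cdot> f)"

definition is_iso :: "('o, 'm, 'x) cat_scheme \<Rightarrow> 'm \<Rightarrow> bool" where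
  "is_iso C f \<longleftrightarrow> f \<in> Arr C \<and>
     (\<exists>g \<in> Hom C (Cod C f) (Dom C f).
        g \<cdot>\<^bsub>C\<^esub> f = Idt C (Dom C f) \<and> f \<cdot>\<^bsub>C\<^esub> g = Idt C (Cod C f))"

definition isomorphic :: "('o, 'm, 'x) cat_scheme \<Rightarrow> 'o \<Rightarrow> 'o \<Rightarrow> bool" where
  "isomorphic C X Y \<longleftrightarrow> (\<exists>f \<in> Hom C X Y. is_iso C f)"

definition zero_object :: "('o, 'm, 'x) cat_scheme \<Rightarrow> 'o \<Rightarrow> bool" where
  "zero_object C Z \<longleftrightarrow> Z \<in> Obj C \<and>
     (\<forall>X \<in> Obj C. (\<exists>!f. f \<in> Hom C Z X) \<and> (\<exists>!f. f \<in> Hom C X Z))"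


section \<open>Functors, adjunctions and equivalences\<close>

record ('o, 'm, 'p, 'n) cfunctor =
  OMap :: "'o \<Rightarrow> 'p"
  AMap :: "'m \<Rightarrow> 'n"

definition is_functor ::
  "('o, 'm, 'x) cat_scheme \<Rightarrow> ('p, 'n, 'y) cat_scheme \<Rightarrow> ('o, 'm, 'p, 'n) cfunctor \<Rightarrow> bool" where
  "is_functor C D F \<longleftrightarrow> category C \<and> category D \<and>
     (\<forall>X \<in> Obj C. OMap F X \<in> Obj D \<and> AMap F (Idt C X) = Idt D (OMap F X)) \<and>
     (\<forall>f \<in> Arr C. AMap F f \<in> Hom D (OMap F (Dom C f)) (OMap F (Cod C f))) \<and>
     (\<forall>f \<in> Arr C. \<forall>g \<in> Arr C. Cod C f = Dom C g \<longrightarrow>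
        AMap F (g \<cdot>\<^bsub>C\<^esub> f) = AMap F g \<cdot>\<^bsub>D\<^esub> AMap F f)"

definition id_functor :: "('o, 'm, 'o, 'm) cfunctor" where
  "id_functor = \<lparr>OMap = \<lambda>X. X, AMap = \<lambda>f. f\<rparr>"

definition comp_functor ::
  "('p, 'n, 'q, 'k) cfunctor \<Rightarrow> ('o, 'm, 'p, 'n) cfunctor \<Rightarrow> ('o, 'm, 'q, 'k) cfunctor" where
  "comp_functor G F = \<lparr>OMap = OMap G \<circ> OMap F, AMap = AMap G \<circ> AMap F\<rparr>"

definition nat_iso ::
  "('o, 'm, 'x) cat_scheme \<Rightarrow> ('p, 'n, 'y) cat_scheme \<Rightarrow>
   ('o, 'm, 'p, 'n) cfunctor \<Rightarrow> ('o, 'm, 'p, 'n) cfunctor \<Rightarrow> ('o \<Rightarrow> 'n) \<Rightarrow> bool" where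
  "nat_iso C D F G \<eta> \<longleftrightarrow> is_functor C D F \<and> is_functor C D G \<and>
     (\<forall>X \<in> Obj C. \<eta> X \<in> Hom D (OMap F X) (OMap G X) \<and> is_iso D (\<eta> X)) \<and>
     (\<forall>f \<in> Arr C. \<eta> (Cod C f) \<cdot>\<^bsub>D\<^esub> AMap F f = AMap G f \<cdot>\<^bsub>D\<^esub> \<eta> (Dom C f))"

definition nat_isomorphic ::
  "('o, 'm, 'x) cat_scheme \<Rightarrow> ('p, 'n, 'y) cat_scheme \<Rightarrow>
   ('o, 'm, 'p, 'n) cfunctor \<Rightarrow> ('o, 'm, 'p, 'n) cfunctor \<Rightarrow> bool" where
  "nat_isomorphic C D F G \<longleftrightarrow> (\<exists>\<eta>. nat_iso C D F G \<eta>)"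

definition is_equivalence ::
  "('o, 'm, 'x) cat_scheme \<Rightarrow> ('p, 'n, 'y) cat_scheme \<Rightarrow> ('o, 'm, 'p, 'n) cfunctor \<Rightarrow> bool" where
  "is_equivalence C D F \<longleftrightarrow> is_functor C D F \<and>
     (\<exists>G. is_functor D C G \<and>
        nat_isomorphic C C (comp_functor G F) id_functor \<and>
        nat_isomorphic D D (comp_functor F G) id_functor)"

text \<open>\<open>adjoint C D F G\<close>: the functor \<open>F\<close> from \<open>C\<close> to \<open>D\<close> is left adjoint to
  the functor \<open>G\<close> from \<open>D\<close> to \<open>C\<close>.\<close>

definition adjoint ::
  "('o, 'm, 'x) cat_scheme \<Rightarrow> ('p, 'n, 'y) cat_scheme \<Rightarrow>
   ('o, 'm, 'p, 'n) cfunctor \<Rightarrow> ('p, 'n, 'o, 'm) cfunctor \<Rightarrow> bool" where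
  "adjoint C D F G \<longleftrightarrow> is_functor C D F \<and> is_functor D C G \<and>
     (\<exists>\<Phi>. (\<forall>X \<in> Obj C. \<forall>Y \<in> Obj D.
              bij_betw (\<Phi> X Y) (Hom D (OMap F X) Y) (Hom C X (OMap G Y))) \<and>
          (\<forall>a \<in> Arr C. \<forall>b \<in> Arr D. \<forall>f \<in> Hom D (OMap F (Cod C a)) (Dom D b).
              \<Phi> (Dom C a) (Cod D b) (b \<cdot>\<^bsub>D\<^esub> f \<cdot>\<^bsub>D\<^esub> AMap F a)
              = AMap G b \<cdot>\<^bsub>C\<^esub> \<Phi> (Cod C a) (Dom D b) f \<cdot>\<^bsub>C\<^esub> a))"

definition ess_image ::
  "('p, 'n, 'y) cat_scheme \<Rightarrow> ('o, 'm, 'x) cat_scheme \<Rightarrow> ('p, 'n, 'o, 'm) cfunctor \<Rightarrow> 'o set" where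
  "ess_image D C G = {X \<in> Obj C. \<exists>A \<in> Obj D. isomorphic C X (OMap G A)}"


section \<open>Additive categories\<close>

record ('o, 'm) addcat = "('o, 'm) cat" +
  Add :: "'m \<Rightarrow> 'm \<Rightarrow> 'm"  (infixl \<open>\<boxplus>\<index>\<close> 65)
  Zro :: "'o \<Rightarrow> 'o \<Rightarrow> 'm"

definition Hom_group :: "('o, 'm, 'x) addcat_scheme \<Rightarrow> 'o \<Rightarrow> 'o \<Rightarrow> 'm monoid" where
  "Hom_group C X Y = \<lparr>carrier = Hom C X Y, monoid.mult = Add C, one = Zro C X Y\<rparr>"

definition Neg :: "('o, 'm, 'x) addcat_scheme \<Rightarrow> 'm \<Rightarrow> 'm" where
  "Neg C f = inv\<^bsub>Hom_group C (Dom C f) (Cod C f)\<^esub> f"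

locale preadditive_category = category C for C :: "('o, 'm, 'x) addcat_scheme" (structure) +
  assumes Hom_comm_group: "\<lbrakk>X \<in> Obj C; Y \<in> Obj C\<rbrakk> \<Longrightarrow> comm_group (Hom_group C X Y)"
    and Comp_Add: "\<lbrakk>f \<in> Hom C X Y; f' \<in> Hom C X Y; g \<in> Hom C Y Z\<rbrakk>
      \<Longrightarrow> g \<cdot> (f \<boxplus> f') = g \<cdot> f \<boxplus> g \<cdot> f'"
    and Add_Comp: "\<lbrakk>f \<in> Hom C X Y; g \<in> Hom C Y Z; g' \<in> Hom C Y Z\<rbrakk>
      \<Longrightarrow> (g \<boxplus> g') \<cdot> f = g \<cdot> f \<boxplus> g' \<cdot> f"

text \<open>\<open>is_biproduct C X Y S i j p q\<close>: \<open>S\<close> is a direct sum of \<open>X\<close> and \<open>Y\<close>, with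
  inclusions \<open>i\<close>, \<open>j\<close> and projections \<open>p\<close>, \<open>q\<close>.\<close>

definition is_biproduct ::
  "('o, 'm, 'x) addcat_scheme \<Rightarrow> 'o \<Rightarrow> 'o \<Rightarrow> 'o \<Rightarrow> 'm \<Rightarrow> 'm \<Rightarrow> 'm \<Rightarrow> 'm \<Rightarrow> bool" where
  "is_biproduct C X Y S i j p q \<longleftrightarrow>
     X \<in> Obj C \<and> Y \<in> Obj C \<and> S \<in> Obj C \<and>
     i \<in> Hom C X S \<and> j \<in> Hom C Y S \<and> p \<in> Hom C S X \<and> q \<in> Hom C S Y \<and>
     p \<cdot>\<^bsub>C\<^esub> i = Idt C X \<and> q \<cdot>\<^bsub>C\<^esub> j = Idt C Y \<and>
     q \<cdot>\<^bsub>C\<^esub> i = Zro C X Y \<and> p \<cdot>\<^bsub>C\<^esub> j = Zro C Y X \<and>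
     i \<cdot>\<^bsub>C\<^esub> p \<boxplus>\<^bsub>C\<^esub> j \<cdot>\<^bsub>C\<^esub> q = Idt C S"

definition direct_sum :: "('o, 'm, 'x) addcat_scheme \<Rightarrow> 'o \<Rightarrow> 'o \<Rightarrow> 'o \<Rightarrow> bool" where
  "direct_sum C X Y S \<longleftrightarrow> (\<exists>i j p q. is_biproduct C X Y S i j p q)"

locale additive_category = preadditive_category C for C :: "('o, 'm, 'x) addcat_scheme" (structure) +
  assumes zero_object_exists: "\<exists>Z. zero_object C Z"
    and direct_sum_exists: "\<lbrakk>X \<in> Obj C; Y \<in> Obj C\<rbrakk> \<Longrightarrow> \<exists>S. direct_sum C X Y S"

definition is_additive_functor ::
  "('o, 'm, 'x) addcat_scheme \<Rightarrow> ('p, 'n, 'y) addcat_scheme \<Rightarrow> ('o, 'm, 'p, 'n) cfunctor \<Rightarrow> bool" where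
  "is_additive_functor C D F \<longleftrightarrow> is_functor C D F \<and>
     (\<forall>f \<in> Arr C. \<forall>g \<in> Arr C. Dom C f = Dom C g \<and> Cod C f = Cod C g \<longrightarrow>
        AMap F (f \<boxplus>\<^bsub>C\<^esub> g) = AMap F f \<boxplus>\<^bsub>D\<^esub> AMap F g)"

text \<open>The closure of a class of objects under finite direct sums (including the empty one) and
  direct summands. It is replete, since any object isomorphic to \<open>S\<close> is a direct sum of \<open>S\<close>
  and a zero object.\<close>

inductive_set add_closure :: "('o, 'm, 'x) addcat_scheme \<Rightarrow> 'o set \<Rightarrow> 'o set"
  for C :: "('o, 'm, 'x) addcat_scheme" and A :: "'o set" where
  base: "X \<in> A \<Longrightarrow> X \<in> add_closure C A"
| zero: "zero_object C Z \<Longrightarrow> Z \<in> add_closure C A"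
| sum: "\<lbrakk>X \<in> add_closure C A; Y \<in> add_closure C A; direct_sum C X Y S\<rbrakk> \<Longrightarrow> S \<in> add_closure C A"
| summand: "\<lbrakk>S \<in> add_closure C A; direct_sum C X Y S\<rbrakk> \<Longrightarrow> X \<in> add_closure C A"


section \<open>Triangulated categories\<close>

record ('o, 'm) suspcat = "('o, 'm) addcat" +
  Susp :: "('o, 'm, 'o, 'm) cfunctor"

text \<open>A triangle \<open>X \<rightarrow> Y \<rightarrow> Z \<rightarrow> \<Sigma>X\<close> is given by its three arrows; the
  objects are recovered as their domains.\<close>

type_synonym 'm triangle = "'m \<times> 'm \<times> 'm"

record ('o, 'm) tricat = "('o, 'm) suspcat" +
  Dist :: "'m triangle set"

definition triangles :: "('o, 'm, 'x) suspcat_scheme \<Rightarrow> 'm triangle set" where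
  "triangles K = {(f, g, h). f \<in> Arr K \<and> g \<in> Arr K \<and> h \<in> Arr K \<and>
     Cod K f = Dom K g \<and> Cod K g = Dom K h \<and> Cod K h = OMap (Susp K) (Dom K f)}"

fun tri_mor ::
  "('o, 'm, 'x) suspcat_scheme \<Rightarrow> 'm triangle \<Rightarrow> 'm triangle \<Rightarrow> 'm \<Rightarrow> 'm \<Rightarrow> 'm \<Rightarrow> bool" where
  "tri_mor K (f, g, h) (f', g', h') a b c \<longleftrightarrow>
     (f, g, h) \<in> triangles K \<and> (f', g', h') \<in> triangles K \<and>
     a \<in> Hom K (Dom K f) (Dom K f') \<and> b \<in> Hom K (Dom K g) (Dom K g') \<and>
     c \<in> Hom K (Dom K h) (Dom K h') \<and>
     b \<cdot>\<^bsub>K\<^esub> f = f' \<cdot>\<^bsub>K\<^esub> a \<and> c \<cdot>\<^bsub>K\<^esub> g = g' \<cdot>\<^bsub>K\<^esub> b \<and>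
     AMap (Susp K) a \<cdot>\<^bsub>K\<^esub> h = h' \<cdot>\<^bsub>K\<^esub> c"

definition tri_isomorphic :: "('o, 'm, 'x) suspcat_scheme \<Rightarrow> 'm triangle \<Rightarrow> 'm triangle \<Rightarrow> bool" where
  "tri_isomorphic K T T' \<longleftrightarrow>
     (\<exists>a b c. tri_mor K T T' a b c \<and> is_iso K a \<and> is_iso K b \<and> is_iso K c)"

fun tri_retract :: "('o, 'm, 'x) suspcat_scheme \<Rightarrow> 'm triangle \<Rightarrow> 'm triangle \<Rightarrow> bool" where
  "tri_retract K (f, g, h) T \<longleftrightarrow>
     (\<exists>a b c a' b' c'. tri_mor K (f, g, h) T a b c \<and> tri_mor K T (f, g, h) a' b' c' \<and>
        a' \<cdot>\<^bsub>K\<^esub> a = Idt K (Dom K f) \<and> b' \<cdot>\<^bsub>K\<^esub> b = Idt K (Dom K g) \<and>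
        c' \<cdot>\<^bsub>K\<^esub> c = Idt K (Dom K h))"

text \<open>The inclusions and projections exhibiting \<open>T = T1 \<oplus> T2\<close> are morphisms of triangles; this
  accounts for the identification of \<open>\<Sigma>(X1 \<oplus> X2)\<close> with \<open>\<Sigma>X1 \<oplus> \<Sigma>X2\<close> in the
  third arrow of \<open>T\<close>.\<close>

fun tri_sum ::
  "('o, 'm, 'x) suspcat_scheme \<Rightarrow> 'm triangle \<Rightarrow> 'm triangle \<Rightarrow> 'm triangle \<Rightarrow> bool" where
  "tri_sum K (f1, g1, h1) (f2, g2, h2) (f, g, h) \<longleftrightarrow>
     (\<exists>i1 i2 i3 j1 j2 j3 p1 p2 p3 q1 q2 q3.
        tri_mor K (f1, g1, h1) (f, g, h) i1 i2 i3 \<and> tri_mor K (f2, g2, h2) (f, g, h) j1 j2 j3 \<and>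
        tri_mor K (f, g, h) (f1, g1, h1) p1 p2 p3 \<and> tri_mor K (f, g, h) (f2, g2, h2) q1 q2 q3 \<and>
        is_biproduct K (Dom K f1) (Dom K f2) (Dom K f) i1 j1 p1 q1 \<and>
        is_biproduct K (Dom K g1) (Dom K g2) (Dom K g) i2 j2 p2 q2 \<and>
        is_biproduct K (Dom K h1) (Dom K h2) (Dom K h) i3 j3 p3 q3)"

text \<open>The suspension is an autoequivalence, not necessarily an automorphism: the suspension of a
  stable category, constructed below from choices, is in general only the former.\<close>

locale triangulated_category = additive_category K for K :: "('o, 'm, 'x) tricat_scheme" (structure) +
  assumes Susp_additive: "is_additive_functor K K (Susp K)"
    and Susp_equivalence: "is_equivalence K K (Susp K)"
    and Dist_triangles: "Dist K \<subseteq> triangles K"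
    and TR1_iso: "\<lbrakk>T \<in> Dist K; tri_isomorphic K T T'\<rbrakk> \<Longrightarrow> T' \<in> Dist K"
    and TR1_id: "\<lbrakk>X \<in> Obj K; zero_object K Z\<rbrakk>
      \<Longrightarrow> (Idt K X, Zro K X Z, Zro K Z (OMap (Susp K) X)) \<in> Dist K"
    and TR1_cone: "f \<in> Arr K \<Longrightarrow> \<exists>g h. (f, g, h) \<in> Dist K"
    and TR2: "(f, g, h) \<in> triangles K
      \<Longrightarrow> (f, g, h) \<in> Dist K \<longleftrightarrow> (g, h, Neg K (AMap (Susp K) f)) \<in> Dist K"
    and TR3: "\<lbrakk>(f, g, h) \<in> Dist K; (f', g', h') \<in> Dist K;
        a \<in> Hom K (Dom K f) (Dom K f'); b \<in> Hom K (Dom K g) (Dom K g'); b \<cdot> f = f' \<cdot> a\<rbrakk>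
      \<Longrightarrow> \<exists>c. tri_mor K (f, g, h) (f', g', h') a b c"
    and TR4: "\<lbrakk>(f, f', f'') \<in> Dist K; (g, g', g'') \<in> Dist K; Cod K f = Dom K g;
        (g \<cdot> f, h', h'') \<in> Dist K\<rbrakk>
      \<Longrightarrow> \<exists>u v. (u, v, AMap (Susp K) f' \<cdot> g'') \<in> Dist K \<and>
            u \<cdot> f' = h' \<cdot> g \<and> h'' \<cdot> u = f'' \<and>
            v \<cdot> h' = g' \<and> g'' \<cdot> v = AMap (Susp K) f \<cdot> h''"

text \<open>An exact functor comes with an isomorphism \<open>\<phi>\<close> from \<open>F \<Sigma>\<close> to \<open>\<Sigma> F\<close>.\<close>

definition exact_functor ::
  "('o, 'm, 'x) tricat_scheme \<Rightarrow> ('p, 'n, 'y) tricat_scheme \<Rightarrow>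
   ('o, 'm, 'p, 'n) cfunctor \<Rightarrow> ('o \<Rightarrow> 'n) \<Rightarrow> bool" where
  "exact_functor K L F \<phi> \<longleftrightarrow> is_additive_functor K L F \<and>
     nat_iso K L (comp_functor F (Susp K)) (comp_functor (Susp L) F) \<phi> \<and>
     (\<forall>(f, g, h) \<in> Dist K. (AMap F f, AMap F g, \<phi> (Dom K f) \<cdot>\<^bsub>L\<^esub> AMap F h) \<in> Dist L)"

text \<open>The square with arrows \<open>a : X \<rightarrow> A\<close>, \<open>b : X \<rightarrow> B\<close>,
  \<open>c : A \<rightarrow> Z\<close>, \<open>d : B \<rightarrow> Z\<close> is homotopy cartesian, i.e.\ \<open>(Z, c, d)\<close> is a
  homotopy pushout of \<open>a\<close> and \<open>b\<close>, and \<open>(X, a, b)\<close> is a homotopy pullback of \<open>c\<close> and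
  \<open>d\<close>: there is a distinguished triangle \<open>X \<rightarrow> A \<oplus> B \<rightarrow> Z \<rightarrow> \<Sigma>X\<close>
  with first arrow \<open>(a, - b)\<close> and second arrow \<open>(c, d)\<close>.\<close>

definition htpy_cartesian ::
  "('o, 'm, 'x) tricat_scheme \<Rightarrow> 'm \<Rightarrow> 'm \<Rightarrow> 'm \<Rightarrow> 'm \<Rightarrow> bool" where
  "htpy_cartesian K a b c d \<longleftrightarrow>
     a \<in> Arr K \<and> b \<in> Arr K \<and> c \<in> Arr K \<and> d \<in> Arr K \<and>
     Dom K a = Dom K b \<and> Cod K a = Dom K c \<and> Cod K b = Dom K d \<and> Cod K c = Cod K d \<and>
     (\<exists>S i j p q e. is_biproduct K (Cod K a) (Cod K b) S i j p q \<and>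
        (i \<cdot>\<^bsub>K\<^esub> a \<boxplus>\<^bsub>K\<^esub> Neg K (j \<cdot>\<^bsub>K\<^esub> b), c \<cdot>\<^bsub>K\<^esub> p \<boxplus>\<^bsub>K\<^esub> d \<cdot>\<^bsub>K\<^esub> q, e) \<in> Dist K)"


section \<open>Proper and Frobenius classes of triangles\<close>

definition E_monos :: "('o, 'm, 'x) tricat_scheme \<Rightarrow> 'm triangle set \<Rightarrow> 'm set" where
  "E_monos K E = {f. \<exists>g h. (f, g, h) \<in> E}"

definition E_epis :: "('o, 'm, 'x) tricat_scheme \<Rightarrow> 'm triangle set \<Rightarrow> 'm set" where
  "E_epis K E = {g. \<exists>f h. (f, g, h) \<in> E}"

text \<open>Note the order of arguments of \<^const>\<open>short_exact_sequence\<close>: in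
  \<open>short_exact_sequence A B C \<beta> \<alpha>\<close> the sequence is
  \<open>0 \<rightarrow> C \<rightarrow> B \<rightarrow> A \<rightarrow> 0\<close> with arrows \<open>\<alpha>\<close> and \<open>\<beta>\<close>.\<close>

definition projectives :: "('o, 'm, 'x) tricat_scheme \<Rightarrow> 'm triangle set \<Rightarrow> 'o set" where
  "projectives K E = {P \<in> Obj K. \<forall>(f, g, h) \<in> E.
     short_exact_sequence (Hom_group K P (Dom K h)) (Hom_group K P (Dom K g)) (Hom_group K P (Dom K f))
       (\<lambda>u. g \<cdot>\<^bsub>K\<^esub> u) (\<lambda>u. f \<cdot>\<^bsub>K\<^esub> u)}"

definition injectives :: "('o, 'm, 'x) tricat_scheme \<Rightarrow> 'm triangle set \<Rightarrow> 'o set" where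
  "injectives K E = {I \<in> Obj K. \<forall>(f, g, h) \<in> E.
     short_exact_sequence (Hom_group K (Dom K f) I) (Hom_group K (Dom K g) I) (Hom_group K (Dom K h) I)
       (\<lambda>u. u \<cdot>\<^bsub>K\<^esub> f) (\<lambda>u. u \<cdot>\<^bsub>K\<^esub> g)}"

text \<open>Closure under \<open>\<Sigma>\<^sup>n\<close> for all integers \<open>n\<close> is expressed, given closure under
  isomorphisms, by requiring a distinguished triangle to lie in \<open>E\<close> iff its triple rotation does.\<close>

definition proper_class :: "('o, 'm, 'x) tricat_scheme \<Rightarrow> 'm triangle set \<Rightarrow> bool" where
  "proper_class K E \<longleftrightarrow> E \<subseteq> Dist K \<and>
     (\<forall>T T'. T \<in> E \<and> tri_isomorphic K T T' \<longrightarrow> T' \<in> E) \<and>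
     (\<forall>(f, g, h) \<in> Dist K. (f, g, h) \<in> E \<longleftrightarrow>
        (Neg K (AMap (Susp K) f), Neg K (AMap (Susp K) g), Neg K (AMap (Susp K) h)) \<in> E) \<and>
     (\<forall>T1 T2 T. T1 \<in> E \<and> T2 \<in> E \<and> tri_sum K T1 T2 T \<longrightarrow> T \<in> E) \<and>
     (\<forall>T T'. T \<in> E \<and> tri_retract K T' T \<longrightarrow> T' \<in> E) \<and>
     (\<forall>X Z. X \<in> Obj K \<and> zero_object K Z \<longrightarrow>
        (Idt K X, Zro K X Z, Zro K Z (OMap (Susp K) X)) \<in> E \<and>
        (Zro K Z X, Idt K X, Zro K X (OMap (Susp K) Z)) \<in> E) \<and>
     (\<forall>a b c d. htpy_cartesian K a b c d \<and> a \<in> E_monos K E \<longrightarrow> d \<in> E_monos K E) \<and>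
     (\<forall>a b c d. htpy_cartesian K a b c d \<and> d \<in> E_epis K E \<longrightarrow> a \<in> E_epis K E) \<and>
     (\<forall>a b c d. htpy_cartesian K a b c d \<and> c \<in> E_epis K E \<and> a \<in> E_epis K E \<longrightarrow> d \<in> E_epis K E)"

definition frobenius :: "('o, 'm, 'x) tricat_scheme \<Rightarrow> 'm triangle set \<Rightarrow> bool" where
  "frobenius K E \<longleftrightarrow> proper_class K E \<and>
     (\<forall>X \<in> Obj K. \<exists>e \<in> E_epis K E. Dom K e \<in> projectives K E \<and> Cod K e = X) \<and>
     (\<forall>X \<in> Obj K. \<exists>i \<in> E_monos K E. Dom K i = X \<and> Cod K i \<in> injectives K E) \<and>
     projectives K E = injectives K E"

definition split_triangles ::
  "('o, 'm, 'x) tricat_scheme \<Rightarrow> ('p, 'n, 'y) tricat_scheme \<Rightarrow> ('o, 'm, 'p, 'n) cfunctor \<Rightarrow>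
   'm triangle set" where
  "split_triangles K L F = {(f, g, h) \<in> Dist K.
     AMap F h = Zro L (OMap F (Dom K h)) (OMap F (Cod K h))}"

definition F_projectives ::
  "('o, 'm, 'x) tricat_scheme \<Rightarrow> ('p, 'n, 'y) tricat_scheme \<Rightarrow> ('o, 'm, 'p, 'n) cfunctor \<Rightarrow> 'o set" where
  "F_projectives K L F = projectives K (split_triangles K L F)"

definition F_injectives ::
  "('o, 'm, 'x) tricat_scheme \<Rightarrow> ('p, 'n, 'y) tricat_scheme \<Rightarrow> ('o, 'm, 'p, 'n) cfunctor \<Rightarrow> 'o set" where
  "F_injectives K L F = injectives K (split_triangles K L F)"


section \<open>Additive quotients and the induced triangulated structure\<close>

definition factoring :: "('o, 'm, 'x) addcat_scheme \<Rightarrow> 'o set \<Rightarrow> 'm set" where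
  "factoring C P = {f \<in> Arr C. \<exists>Q \<in> P. \<exists>a \<in> Hom C (Dom C f) Q. \<exists>b \<in> Hom C Q (Cod C f). f = b \<cdot>\<^bsub>C\<^esub> a}"

definition quot_rel :: "('o, 'm, 'x) addcat_scheme \<Rightarrow> 'o set \<Rightarrow> 'm rel" where
  "quot_rel C P = {(f, g). f \<in> Arr C \<and> g \<in> Arr C \<and> Dom C f = Dom C g \<and> Cod C f = Cod C g \<and>
     f \<boxplus>\<^bsub>C\<^esub> Neg C g \<in> factoring C P}"

definition quot_map :: "('o, 'm, 'x) addcat_scheme \<Rightarrow> 'o set \<Rightarrow> 'm \<Rightarrow> 'm set" where
  "quot_map C P f = quot_rel C P `` {f}"

text \<open>The additive quotient \<open>C / P\<close>: its arrows are equivalence classes of arrows of \<open>C\<close>, and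
  \<^const>\<open>quot_map\<close> is the action on arrows of the quotient functor.\<close>

definition quot_cat :: "('o, 'm, 'x) addcat_scheme \<Rightarrow> 'o set \<Rightarrow> ('o, 'm set) addcat" where
  "quot_cat C P =
     \<lparr>Obj = Obj C,
      Arr = Arr C // quot_rel C P,
      Dom = \<lambda>\<phi>. the_elem (Dom C ` \<phi>),
      Cod = \<lambda>\<phi>. the_elem (Cod C ` \<phi>),
      Idt = \<lambda>X. quot_map C P (Idt C X),
      Comp = \<lambda>\<psi> \<phi>. \<Union>g \<in> \<psi>. \<Union>f \<in> \<phi>. quot_map C P (g \<cdot>\<^bsub>C\<^esub> f),
      Add = \<lambda>\<phi> \<psi>. \<Union>f \<in> \<phi>. \<Union>g \<in> \<psi>. quot_map C P (f \<boxplus>\<^bsub>C\<^esub> g),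
      Zro = \<lambda>X Y. quot_map C P (Zro C X Y)\<rparr>"

text \<open>A choice, for every object \<open>X\<close>, of a distinguished triangle
  \<open>X \<rightarrow> X\<^sub>E \<rightarrow> X' \<rightarrow> \<Sigma>X\<close> whose first arrow is an \<open>E\<close>-monomorphism into an
  \<open>E\<close>-injective object.\<close>

definition injective_choice ::
  "('o, 'm, 'x) tricat_scheme \<Rightarrow> 'm triangle set \<Rightarrow> ('o \<Rightarrow> 'm triangle) \<Rightarrow> bool" where
  "injective_choice K E t \<longleftrightarrow> (\<forall>X \<in> Obj K. t X \<in> Dist K \<and>
     (case t X of (i, v, w) \<Rightarrow> Dom K i = X \<and> i \<in> E_monos K E \<and> Cod K i \<in> injectives K E))"

text \<open>The suspension functor of the stable category. On objects it is \<open>X \<mapsto> X'\<close>; the class of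
  \<open>f : X \<rightarrow> Y\<close> is sent to the class of any \<open>f' : X' \<rightarrow> Y'\<close> belonging to a
  morphism \<open>(f, u, f')\<close> between the chosen triangles of \<open>X\<close> and \<open>Y\<close>.\<close>

definition stable_susp ::
  "('o, 'm, 'x) tricat_scheme \<Rightarrow> 'm triangle set \<Rightarrow> ('o \<Rightarrow> 'm triangle) \<Rightarrow>
   ('o, 'm set, 'o, 'm set) cfunctor" where
  "stable_susp K E t =
     \<lparr>OMap = \<lambda>X. case t X of (i, v, w) \<Rightarrow> Cod K v,
      AMap = \<lambda>\<phi>. THE \<psi>. \<exists>f \<in> \<phi>. \<exists>u f'. tri_mor K (t (Dom K f)) (t (Cod K f)) f u f' \<and>
               \<psi> = quot_map K (projectives K E) f'\<rparr>"

definition stable_suspcat ::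
  "('o, 'm, 'x) tricat_scheme \<Rightarrow> 'm triangle set \<Rightarrow> ('o \<Rightarrow> 'm triangle) \<Rightarrow> ('o, 'm set) suspcat" where
  "stable_suspcat K E t =
     addcat.extend (quot_cat K (projectives K E)) (suspcat.fields (stable_susp K E t))"

text \<open>The standard triangles: \<open>Z\<close> is a homotopy pushout of \<open>X\<^sub>E \<leftarrow> X \<rightarrow> Y\<close>, and
  \<open>(f, k, 1)\<close> is a morphism from the chosen triangle of \<open>X\<close> to a distinguished triangle
  \<open>Y \<rightarrow> Z \<rightarrow> X' \<rightarrow> \<Sigma>Y\<close>.\<close>

definition standard_triangles ::
  "('o, 'm, 'x) tricat_scheme \<Rightarrow> 'm triangle set \<Rightarrow> ('o \<Rightarrow> 'm triangle) \<Rightarrow> 'm set triangle set" where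
  "standard_triangles K E t =
     {(quot_map K P f, quot_map K P g, quot_map K P h) | P f g h i v w k e.
        P = projectives K E \<and> f \<in> Arr K \<and> t (Dom K f) = (i, v, w) \<and>
        htpy_cartesian K i f k g \<and> (g, h, e) \<in> Dist K \<and>
        tri_mor K (i, v, w) (g, h, e) f k (Idt K (Cod K v))}"

definition stable_tricat ::
  "('o, 'm, 'x) tricat_scheme \<Rightarrow> 'm triangle set \<Rightarrow> ('o \<Rightarrow> 'm triangle) \<Rightarrow> ('o, 'm set) tricat" where
  "stable_tricat K E t =
     suspcat.extend (stable_suspcat K E t)
       (tricat.fields {T. \<exists>S \<in> standard_triangles K E t. tri_isomorphic (stable_suspcat K E t) T S})"

end

theory Submission
  imports Defs
begin

text \<open>Write \<open>N\<close> for the class of arrows \<open>h\<close> of \<open>K\<close>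
  with \<open>F h = 0\<close>. It is an ideal that is stable under suspension and desuspension,
  and the \<open>F\<close>-split triangles are the distinguished triangles whose third arrow, the
  phantom, lies in \<open>N\<close>. Rotating triangles shows that an object is projective or
  injective for such a class exactly when every composite of an arrow out of it, respectively into
  it, with an arrow of \<open>N\<close> vanishes (\<open>projectives_iff\<close>,
  \<open>injectives_iff\<close>).

  For the adjunctions this means: the bijection \<open>K(V A, X) \<cong> L(A, F X)\<close> turns
  composition with \<open>h \<in> N\<close> into composition with \<open>F h = 0\<close>, so
  \<open>V A\<close> is projective. The counit \<open>V F X \<rightarrow> X\<close> becomes a
  split epimorphism under \<open>F\<close>, so the next arrow of its triangle lies in
  \<open>N\<close>; hence there are enough projectives, and a projective \<open>X\<close> is a
  direct summand of \<open>V F X\<close>. Dually the injectives are the summands of the objects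
  \<open>U A\<close>. Since \<open>U\<close> is isomorphic to \<open>V W\<close> with
  \<open>W\<close> an equivalence, \<open>U\<close> and \<open>V\<close> have the same essential
  image, and projectives and injectives coincide. The axioms of a proper class concern arrows that
  \<open>F\<close> makes monic or epic (\<open>kernel_iff_monic\<close>,
  \<open>kernel_iff_epic\<close>), and these are easily followed through homotopy cartesian
  squares of \<open>L\<close>.

  The stable category is treated for any suspension stable ideal \<open>N\<close> with enough
  projectives and injectives, the two being the same. Let \<open>X \<rightarrow> I \<rightarrow>
  X' \<rightarrow> \<Sigma>X\<close> be the chosen triangle and \<open>\<omega>\<close> its last
  arrow. Everything rests on one observation: composition with \<open>\<omega>\<close> identifies
  the stable arrows \<open>C \<rightarrow> X'\<close> with the phantoms \<open>C \<rightarrow>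
  \<Sigma>X\<close> (\<open>phantom_lift\<close>, \<open>q_eq_iff\<close>). So the stable
  suspension of \<open>f\<close> is determined by \<open>\<omega> f' = \<Sigma>f \<omega>\<close>,
  it is visibly fully faithful, and each triangle \<open>(f, g, h)\<close> with phantom
  \<open>h\<close> gives a stable triangle \<open>(f, g, \<partial>)\<close> with \<open>\<omega>
  \<partial> = -h\<close>. Up to isomorphism these are the standard triangles
  (\<open>Dist_S_iff\<close>), the sign coming from the sign in the homotopy pushout. They have
  exact Hom sequences, they admit fill-ins because a square that commutes stably can be corrected
  to commute in \<open>K\<close>, a standard triangle visibly rotates to a triangle of the form
  \<open>(f, g, \<partial>)\<close>, and the octahedral axiom is the one of \<open>K\<close> after
  both arrows have been replaced by stably isomorphic ones with phantom cone. What remains, such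
  as the converse of rotation and the octahedral axiom for arbitrary choices of the three
  triangles, is formal (locale \<open>triangulation_criterion\<close>).\<close>

section \<open>Calculating in categories\<close>

lemma Hom_iff [simp]: "f \<in> Hom C X Y \<longleftrightarrow> f \<in> Arr C \<and> Dom C f = X \<and> Cod C f = Y"
  by (auto simp: Hom_def)

context category
begin

lemmas Dom_Obj [simp] = Dom_in_Obj
lemmas Cod_Obj [simp] = Cod_in_Obj

lemma Idt_simps [simp]:
  assumes "X \<in> Obj C"
  shows "Idt C X \<in> Arr C" "Dom C (Idt C X) = X" "Cod C (Idt C X) = X"
  using Idt_in_Hom[OF assms] by auto

lemma Comp_simps [simp]:
  assumes "f \<in> Arr C" "g \<in> Arr C" "Cod C f = Dom C g"
  shows "g \<cdot> f \<in> Arr C" "Dom C (g \<cdot> f) = Dom C f" "Cod C (g \<cdot> f) = Cod C g"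
  using Comp_in_Hom[of f "Dom C f" "Cod C f" g "Cod C g"] assms by auto

lemma Comp_Idt' [simp]: "f \<in> Arr C \<Longrightarrow> Dom C f = X \<Longrightarrow> f \<cdot> Idt C X = f"
  using Comp_Idt[of f "Dom C f" "Cod C f"] by auto

lemma Idt_Comp' [simp]: "f \<in> Arr C \<Longrightarrow> Cod C f = X \<Longrightarrow> Idt C X \<cdot> f = f"
  using Idt_Comp[of f "Dom C f" "Cod C f"] by auto

lemma Comp_assoc' [simp]:
  "\<lbrakk>f \<in> Arr C; g \<in> Arr C; h \<in> Arr C; Cod C f = Dom C g; Cod C g = Dom C h\<rbrakk>
    \<Longrightarrow> (h \<cdot> g) \<cdot> f = h \<cdot> (g \<cdot> f)"
  using Comp_assoc[of f "Dom C f" "Cod C f" g "Cod C g" h "Cod C h"] by auto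

text \<open>Composites are kept bracketed to the right by the simplifier; this turns an equation
  for a composite of two arrows into one that also applies inside a longer composite.\<close>

lemma Comp_reduce:
  "\<lbrakk>g \<cdot> f = k; f \<in> Arr C; g \<in> Arr C; Cod C f = Dom C g; x \<in> Arr C; Cod C x = Dom C f\<rbrakk>
    \<Longrightarrow> g \<cdot> (f \<cdot> x) = k \<cdot> x"
  by (metis Comp_assoc')

lemma is_isoE:
  assumes "is_iso C f"
  obtains g where "f \<in> Arr C" "g \<in> Arr C" "Dom C g = Cod C f" "Cod C g = Dom C f"
    "g \<cdot> f = Idt C (Dom C f)" "f \<cdot> g = Idt C (Cod C f)" "is_iso C g"
proof -
  obtain g where g: "f \<in> Arr C" "g \<in> Arr C" "Dom C g = Cod C f" "Cod C g = Dom C f"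
    "g \<cdot> f = Idt C (Dom C f)" "f \<cdot> g = Idt C (Cod C f)"
    using assms unfolding is_iso_def by auto
  then have "is_iso C g" unfolding is_iso_def by auto
  with g that show ?thesis by blast
qed

lemma is_isoI:
  assumes "f \<in> Arr C" "g \<in> Arr C" "Dom C g = Cod C f" "Cod C g = Dom C f"
    "g \<cdot> f = Idt C (Dom C f)" "f \<cdot> g = Idt C (Cod C f)"
  shows "is_iso C f"
  using assms unfolding is_iso_def by auto

lemma is_iso_Arr [simp]: "is_iso C f \<Longrightarrow> f \<in> Arr C"
  by (simp add: is_iso_def)

lemma is_iso_Idt [simp]: "X \<in> Obj C \<Longrightarrow> is_iso C (Idt C X)"
  by (rule is_isoI[of _ "Idt C X"]) auto

lemma is_iso_Comp [simp]:
  assumes "is_iso C f" "is_iso C g" "Cod C f = Dom C g"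
  shows "is_iso C (g \<cdot> f)"
proof -
  obtain f' g' where f: "f \<in> Arr C" "f' \<in> Arr C" "Dom C f' = Cod C f" "Cod C f' = Dom C f"
    "f' \<cdot> f = Idt C (Dom C f)" "f \<cdot> f' = Idt C (Cod C f)"
    and g: "g \<in> Arr C" "g' \<in> Arr C" "Dom C g' = Cod C g" "Cod C g' = Dom C g"
    "g' \<cdot> g = Idt C (Dom C g)" "g \<cdot> g' = Idt C (Cod C g)"
    using assms by (metis is_isoE)
  show ?thesis
    by (rule is_isoI[of _ "f' \<cdot> g'"])
      (use f g assms(3) in \<open>simp_all add: Comp_reduce[OF f(5)] Comp_reduce[OF f(6)]
        Comp_reduce[OF g(5)] Comp_reduce[OF g(6)]\<close>)
qed

lemma iso_cancel_left:
  assumes "is_iso C f" "a \<in> Arr C" "b \<in> Arr C" "Cod C a = Dom C f" "Cod C b = Dom C f"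
    "f \<cdot> a = f \<cdot> b"
  shows "a = b"
proof -
  obtain f' where f: "f \<in> Arr C" "f' \<in> Arr C" "Dom C f' = Cod C f" "Cod C f' = Dom C f"
    "f' \<cdot> f = Idt C (Dom C f)"
    using assms(1) by (metis is_isoE)
  have "a = f' \<cdot> (f \<cdot> a)" "b = f' \<cdot> (f \<cdot> b)"
    using assms(2-5) f by (simp_all add: Comp_reduce[OF f(5)])
  then show ?thesis using assms(6) by simp
qed

lemma isomorphic_sym: "isomorphic C X Y \<Longrightarrow> isomorphic C Y X"
  unfolding isomorphic_def by (metis Hom_iff is_isoE)

lemma isomorphic_trans: "isomorphic C X Y \<Longrightarrow> isomorphic C Y Z \<Longrightarrow> isomorphic C X Z"
  unfolding isomorphic_def by (metis Comp_in_Hom Hom_iff is_iso_Comp)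

lemma zero_object_Obj [simp]: "zero_object C Z \<Longrightarrow> Z \<in> Obj C"
  by (simp add: zero_object_def)

end

section \<open>Preadditive categories\<close>

context preadditive_category
begin

lemma group_facts:
  assumes "X \<in> Obj C" "Y \<in> Obj C"
  shows "comm_group (Hom_group C X Y)" "carrier (Hom_group C X Y) = Hom C X Y"
    "monoid.mult (Hom_group C X Y) = Add C" "one (Hom_group C X Y) = Zro C X Y"
  using Hom_comm_group[OF assms] by (auto simp: Hom_group_def)

lemma Zro_simps [simp]:
  assumes "X \<in> Obj C" "Y \<in> Obj C"
  shows "Zro C X Y \<in> Arr C" "Dom C (Zro C X Y) = X" "Cod C (Zro C X Y) = Y"
proof -
  interpret comm_group "Hom_group C X Y" using assms by (rule group_facts)
  show "Zro C X Y \<in> Arr C" "Dom C (Zro C X Y) = X" "Cod C (Zro C X Y) = Y"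
    using one_closed by (simp_all only: group_facts[OF assms] Hom_iff)
qed

lemma Add_simps [simp]:
  assumes "f \<in> Arr C" "g \<in> Arr C" "Dom C f = Dom C g" "Cod C f = Cod C g"
  shows "f \<boxplus> g \<in> Arr C" "Dom C (f \<boxplus> g) = Dom C g" "Cod C (f \<boxplus> g) = Cod C g"
proof -
  have o: "Dom C g \<in> Obj C" "Cod C g \<in> Obj C" using assms by auto
  interpret comm_group "Hom_group C (Dom C g) (Cod C g)" using o by (rule group_facts)
  show "f \<boxplus> g \<in> Arr C" "Dom C (f \<boxplus> g) = Dom C g" "Cod C (f \<boxplus> g) = Cod C g"
    using m_closed[of f g] assms unfolding group_facts[OF o] Hom_iff by simp_all
qed

lemma Add_comm:
  assumes "f \<in> Arr C" "g \<in> Arr C" "Dom C f = Dom C g" "Cod C f = Cod C g"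
  shows "f \<boxplus> g = g \<boxplus> f"
proof -
  have o: "Dom C g \<in> Obj C" "Cod C g \<in> Obj C" using assms by auto
  interpret comm_group "Hom_group C (Dom C g) (Cod C g)" using o by (rule group_facts)
  show ?thesis
    using m_comm[of f g] assms unfolding group_facts[OF o] Hom_iff by simp
qed

lemma Add_assoc [simp]:
  assumes "f \<in> Arr C" "g \<in> Arr C" "h \<in> Arr C" "Dom C f = Dom C g" "Cod C f = Cod C g"
    "Dom C g = Dom C h" "Cod C g = Cod C h"
  shows "(f \<boxplus> g) \<boxplus> h = f \<boxplus> (g \<boxplus> h)"
proof -
  have o: "Dom C h \<in> Obj C" "Cod C h \<in> Obj C" using assms by auto
  interpret comm_group "Hom_group C (Dom C h) (Cod C h)" using o by (rule group_facts)
  show ?thesis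
    using m_assoc[of f g h] assms unfolding group_facts[OF o] Hom_iff by simp
qed

lemma Add_left_comm:
  assumes "f \<in> Arr C" "g \<in> Arr C" "h \<in> Arr C" "Dom C f = Dom C g" "Cod C f = Cod C g"
    "Dom C g = Dom C h" "Cod C g = Cod C h"
  shows "f \<boxplus> (g \<boxplus> h) = g \<boxplus> (f \<boxplus> h)"
  using assms Add_comm[of f g] Add_assoc[of f g h] Add_assoc[of g f h] by simp

lemma Add_Zro [simp]:
  assumes "f \<in> Arr C" "Dom C f = X" "Cod C f = Y"
  shows "f \<boxplus> Zro C X Y = f" "Zro C X Y \<boxplus> f = f"
proof -
  have o: "X \<in> Obj C" "Y \<in> Obj C" using assms by auto
  interpret comm_group "Hom_group C X Y" using o by (rule group_facts)
  show "f \<boxplus> Zro C X Y = f" "Zro C X Y \<boxplus> f = f"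
    using r_one[of f] l_one[of f] assms unfolding group_facts[OF o] Hom_iff by simp_all
qed

lemma Neg_facts:
  assumes "f \<in> Arr C"
  shows "Neg C f \<in> Arr C \<and> Dom C (Neg C f) = Dom C f \<and> Cod C (Neg C f) = Cod C f \<and>
    f \<boxplus> Neg C f = Zro C (Dom C f) (Cod C f)"
proof -
  have o: "Dom C f \<in> Obj C" "Cod C f \<in> Obj C" using assms by auto
  interpret comm_group "Hom_group C (Dom C f) (Cod C f)" using o by (rule group_facts)
  show ?thesis
    using inv_closed[of f] r_inv[of f] assms
    unfolding group_facts[OF o] Hom_iff Neg_def[symmetric] by simp
qed

lemma Neg_simps [simp]:
  assumes "f \<in> Arr C"
  shows "Neg C f \<in> Arr C" "Dom C (Neg C f) = Dom C f" "Cod C (Neg C f) = Cod C f"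
  using Neg_facts[OF assms] by auto

lemma Add_Neg [simp]:
  assumes "f \<in> Arr C"
  shows "f \<boxplus> Neg C f = Zro C (Dom C f) (Cod C f)" "Neg C f \<boxplus> f = Zro C (Dom C f) (Cod C f)"
  using Neg_facts[OF assms] assms Add_comm[of "Neg C f" f] by auto

lemma Add_Neg_cancel [simp]:
  assumes "f \<in> Arr C" "g \<in> Arr C" "Dom C f = Dom C g" "Cod C f = Cod C g"
  shows "f \<boxplus> (Neg C f \<boxplus> g) = g" "Neg C f \<boxplus> (f \<boxplus> g) = g"
  using assms Add_assoc[of f "Neg C f" g] Add_assoc[of "Neg C f" f g] by auto

lemma Add_left_cancel:
  assumes "f \<in> Arr C" "g \<in> Arr C" "h \<in> Arr C" "Dom C f = Dom C g" "Cod C f = Cod C g"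
    "Dom C f = Dom C h" "Cod C f = Cod C h"
  shows "f \<boxplus> g = f \<boxplus> h \<longleftrightarrow> g = h"
  using assms Add_Neg_cancel(2)[of f g] Add_Neg_cancel(2)[of f h] by metis

lemma Neg_unique:
  assumes "f \<in> Arr C" "g \<in> Arr C" "Dom C f = Dom C g" "Cod C f = Cod C g"
    "f \<boxplus> g = Zro C (Dom C f) (Cod C f)"
  shows "g = Neg C f"
  using assms Add_Neg(1)[of f] Add_left_cancel[of f g "Neg C f"] by simp

text \<open>Equality of arrows is tested on their difference. The objects are free variables, so
  that the lemma applies to a zero arrow whose domain is written in another way.\<close>

lemma Sub_eq_Zro:
  assumes "f \<in> Arr C" "g \<in> Arr C" "Dom C f = Dom C g" "Cod C f = Cod C g"
    "f \<boxplus> Neg C g = Zro C X Y" "X = Dom C g" "Y = Cod C g"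
  shows "f = g"
proof -
  have "f \<boxplus> Neg C g \<boxplus> g = f \<boxplus> (Neg C g \<boxplus> g)"
    by (rule Add_assoc) (use assms(1-4) in auto)
  then show ?thesis using assms by simp
qed

lemma Comp_Add' [simp]:
  "\<lbrakk>f \<in> Arr C; f' \<in> Arr C; g \<in> Arr C; Dom C f = Dom C f'; Cod C f = Cod C f'; Cod C f' = Dom C g\<rbrakk>
    \<Longrightarrow> g \<cdot> (f \<boxplus> f') = g \<cdot> f \<boxplus> g \<cdot> f'"
  using Comp_Add[of f "Dom C f" "Dom C g" f' g "Cod C g"] by auto

lemma Add_Comp' [simp]:
  "\<lbrakk>f \<in> Arr C; g' \<in> Arr C; g \<in> Arr C; Dom C g = Dom C g'; Cod C g = Cod C g'; Cod C f = Dom C g'\<rbrakk>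
    \<Longrightarrow> (g \<boxplus> g') \<cdot> f = g \<cdot> f \<boxplus> g' \<cdot> f"
  using Add_Comp[of f "Dom C f" "Cod C f" g "Cod C g" g'] by auto

lemma idem_Zro:
  assumes "f \<in> Arr C" "f \<boxplus> f = f" shows "f = Zro C (Dom C f) (Cod C f)"
  using assms Add_left_cancel[of f f "Zro C (Dom C f) (Cod C f)"] by simp

lemma Comp_Zro [simp]:
  assumes "g \<in> Arr C" "Dom C g = Y" "X \<in> Obj C"
  shows "g \<cdot> Zro C X Y = Zro C X (Cod C g)"
proof -
  have Y: "Y \<in> Obj C" using assms by auto
  have "g \<cdot> (Zro C X Y \<boxplus> Zro C X Y) = g \<cdot> Zro C X Y \<boxplus> g \<cdot> Zro C X Y"
    by (rule Comp_Add') (use assms Y in simp_all)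
  then show ?thesis using idem_Zro[of "g \<cdot> Zro C X Y"] assms Y by simp
qed

lemma Zro_Comp [simp]:
  assumes "f \<in> Arr C" "Cod C f = X" "Y \<in> Obj C"
  shows "Zro C X Y \<cdot> f = Zro C (Dom C f) Y"
proof -
  have X: "X \<in> Obj C" using assms by auto
  have "(Zro C X Y \<boxplus> Zro C X Y) \<cdot> f = Zro C X Y \<cdot> f \<boxplus> Zro C X Y \<cdot> f"
    by (rule Add_Comp') (use assms X in simp_all)
  then show ?thesis using idem_Zro[of "Zro C X Y \<cdot> f"] assms X by simp
qed

lemma Neg_Zro [simp]: "X \<in> Obj C \<Longrightarrow> Y \<in> Obj C \<Longrightarrow> Neg C (Zro C X Y) = Zro C X Y"
  using Neg_unique[of "Zro C X Y" "Zro C X Y"] by simp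

lemma Neg_Neg [simp]: "f \<in> Arr C \<Longrightarrow> Neg C (Neg C f) = f"
  using Neg_unique[of "Neg C f" f] by simp

lemma Comp_Neg [simp]:
  assumes "f \<in> Arr C" "g \<in> Arr C" "Cod C f = Dom C g"
  shows "g \<cdot> Neg C f = Neg C (g \<cdot> f)"
proof (rule Neg_unique)
  have "g \<cdot> f \<boxplus> g \<cdot> Neg C f = g \<cdot> (f \<boxplus> Neg C f)"
    by (rule Comp_Add'[symmetric]) (use assms in simp_all)
  then show "g \<cdot> f \<boxplus> g \<cdot> Neg C f = Zro C (Dom C (g \<cdot> f)) (Cod C (g \<cdot> f))"
    using assms by simp
qed (use assms in simp_all)

lemma Neg_Comp [simp]:
  assumes "f \<in> Arr C" "g \<in> Arr C" "Cod C f = Dom C g"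
  shows "Neg C g \<cdot> f = Neg C (g \<cdot> f)"
proof (rule Neg_unique)
  have "g \<cdot> f \<boxplus> Neg C g \<cdot> f = (g \<boxplus> Neg C g) \<cdot> f"
    by (rule Add_Comp'[symmetric]) (use assms in simp_all)
  then show "g \<cdot> f \<boxplus> Neg C g \<cdot> f = Zro C (Dom C (g \<cdot> f)) (Cod C (g \<cdot> f))"
    using assms by simp
qed (use assms in simp_all)

lemma Neg_Add [simp]:
  assumes "f \<in> Arr C" "g \<in> Arr C" "Dom C f = Dom C g" "Cod C f = Cod C g"
  shows "Neg C (f \<boxplus> g) = Neg C f \<boxplus> Neg C g"
  by (rule Neg_unique[symmetric])
    (use assms in \<open>simp_all add: Add_left_comm[of "Neg C f" g] Add_left_comm[of g "Neg C f"]\<close>)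

lemma Neg_eq_iff:
  assumes "f \<in> Arr C" "g \<in> Arr C"
  shows "Neg C f = Neg C g \<longleftrightarrow> f = g"
  using Neg_Neg assms by metis

lemma Neg_eq_Zro:
  assumes "f \<in> Arr C" "X \<in> Obj C" "Y \<in> Obj C"
  shows "Neg C f = Zro C X Y \<longleftrightarrow> f = Zro C X Y"
  using Neg_Neg assms Neg_Zro by metis

lemma is_iso_Neg [simp]:
  assumes "is_iso C f" shows "is_iso C (Neg C f)"
proof -
  obtain g where g: "f \<in> Arr C" "g \<in> Arr C" "Dom C g = Cod C f" "Cod C g = Dom C f"
    "g \<cdot> f = Idt C (Dom C f)" "f \<cdot> g = Idt C (Cod C f)"
    using assms by (metis is_isoE)
  show ?thesis by (rule is_isoI[of _ "Neg C g"]) (use g in simp_all)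
qed

text \<open>If \<open>s\<close> is a section of \<open>f\<close>, then \<open>f\<close>
  annihilates \<open>s f - 1\<close>, which measures the failure of \<open>s\<close> to be a left
  inverse.\<close>

lemma is_iso_split_epi_mono:
  assumes f: "f \<in> Arr C" and s: "s \<in> Arr C" "Dom C s = Cod C f" "Cod C s = Dom C f"
    "f \<cdot> s = Idt C (Cod C f)"
    and mono: "\<And>u. \<lbrakk>u \<in> Arr C; Cod C u = Dom C f; f \<cdot> u = Zro C (Dom C u) (Cod C f)\<rbrakk>
      \<Longrightarrow> u = Zro C (Dom C u) (Dom C f)"
  shows "is_iso C f"
proof -
  have "s \<cdot> f \<boxplus> Neg C (Idt C (Dom C f)) = Zro C (Dom C f) (Dom C f)"
    using mono[of "s \<cdot> f \<boxplus> Neg C (Idt C (Dom C f))"] f s Comp_reduce[OF s(4)] by simp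
  then have "s \<cdot> f = Idt C (Dom C f)"
    by (rule Sub_eq_Zro[rotated 4]) (use f s in simp_all)
  then show ?thesis using f s by (intro is_isoI[of f s]) simp_all
qed

lemma zero_object_unique:
  assumes "zero_object C Z" "f \<in> Arr C" "g \<in> Arr C" "Dom C f = Dom C g" "Cod C f = Cod C g"
    "Dom C g = Z \<or> Cod C g = Z"
  shows "f = g"
  using assms unfolding zero_object_def by (metis Cod_Obj Dom_Obj Hom_iff)

lemma zero_object_iff: "zero_object C Z \<longleftrightarrow> Z \<in> Obj C \<and> Idt C Z = Zro C Z Z"
proof
  assume "zero_object C Z"
  then show "Z \<in> Obj C \<and> Idt C Z = Zro C Z Z"
    using zero_object_unique[of Z "Idt C Z" "Zro C Z Z"] by simp
next
  assume Z: "Z \<in> Obj C \<and> Idt C Z = Zro C Z Z"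
  have "f = Zro C Z X" if "f \<in> Hom C Z X" for f X
    using that Z Comp_Idt'[of f Z] Comp_Zro[of f Z Z] by auto
  moreover have "f = Zro C X Z" if "f \<in> Hom C X Z" for f X
    using that Z Idt_Comp'[of f Z] Zro_Comp[of f Z Z] by auto
  ultimately show "zero_object C Z"
    unfolding zero_object_def using Z by (metis Hom_iff Zro_simps)
qed

lemma biproductD:
  assumes "is_biproduct C X Y S i j p q"
  shows "X \<in> Obj C" "Y \<in> Obj C" "S \<in> Obj C"
    "i \<in> Arr C" "Dom C i = X" "Cod C i = S" "j \<in> Arr C" "Dom C j = Y" "Cod C j = S"
    "p \<in> Arr C" "Dom C p = S" "Cod C p = X" "q \<in> Arr C" "Dom C q = S" "Cod C q = Y"
    "p \<cdot> i = Idt C X" "q \<cdot> j = Idt C Y" "q \<cdot> i = Zro C X Y" "p \<cdot> j = Zro C Y X"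
    "i \<cdot> p \<boxplus> j \<cdot> q = Idt C S"
    "\<And>x. \<lbrakk>x \<in> Arr C; Cod C x = X\<rbrakk> \<Longrightarrow> p \<cdot> (i \<cdot> x) = x"
    "\<And>x. \<lbrakk>x \<in> Arr C; Cod C x = Y\<rbrakk> \<Longrightarrow> q \<cdot> (j \<cdot> x) = x"
    "\<And>x. \<lbrakk>x \<in> Arr C; Cod C x = X\<rbrakk> \<Longrightarrow> q \<cdot> (i \<cdot> x) = Zro C (Dom C x) Y"
    "\<And>x. \<lbrakk>x \<in> Arr C; Cod C x = Y\<rbrakk> \<Longrightarrow> p \<cdot> (j \<cdot> x) = Zro C (Dom C x) X"
proof -
  show a: "X \<in> Obj C" "Y \<in> Obj C" "S \<in> Obj C"
    "i \<in> Arr C" "Dom C i = X" "Cod C i = S" "j \<in> Arr C" "Dom C j = Y" "Cod C j = S"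
    "p \<in> Arr C" "Dom C p = S" "Cod C p = X" "q \<in> Arr C" "Dom C q = S" "Cod C q = Y"
    and b: "p \<cdot> i = Idt C X" "q \<cdot> j = Idt C Y" "q \<cdot> i = Zro C X Y" "p \<cdot> j = Zro C Y X"
    and "i \<cdot> p \<boxplus> j \<cdot> q = Idt C S"
    using assms unfolding is_biproduct_def Hom_iff by auto
  show "\<And>x. \<lbrakk>x \<in> Arr C; Cod C x = X\<rbrakk> \<Longrightarrow> p \<cdot> (i \<cdot> x) = x"
    "\<And>x. \<lbrakk>x \<in> Arr C; Cod C x = Y\<rbrakk> \<Longrightarrow> q \<cdot> (j \<cdot> x) = x"
    "\<And>x. \<lbrakk>x \<in> Arr C; Cod C x = X\<rbrakk> \<Longrightarrow> q \<cdot> (i \<cdot> x) = Zro C (Dom C x) Y"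
    "\<And>x. \<lbrakk>x \<in> Arr C; Cod C x = Y\<rbrakk> \<Longrightarrow> p \<cdot> (j \<cdot> x) = Zro C (Dom C x) X"
    using a Comp_reduce[OF b(1)] Comp_reduce[OF b(2)] Comp_reduce[OF b(3)] Comp_reduce[OF b(4)]
    by simp_all
qed

lemma biproduct_out:
  assumes S: "is_biproduct C X Y S i j p q" and x: "x \<in> Arr C" "Dom C x = S"
  shows "x = (x \<cdot> i) \<cdot> p \<boxplus> (x \<cdot> j) \<cdot> q"
proof -
  note [simp] = biproductD[OF S]
  have "x = x \<cdot> (i \<cdot> p \<boxplus> j \<cdot> q)" using x by (simp only: biproductD(20)[OF S] Comp_Idt')
  also have "\<dots> = (x \<cdot> i) \<cdot> p \<boxplus> (x \<cdot> j) \<cdot> q" using x by (simp del: biproductD(20)[OF S])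
  finally show ?thesis .
qed

lemma biproduct_in:
  assumes S: "is_biproduct C X Y S i j p q" and x: "x \<in> Arr C" "Cod C x = S"
  shows "x = i \<cdot> (p \<cdot> x) \<boxplus> j \<cdot> (q \<cdot> x)"
proof -
  note [simp] = biproductD[OF S]
  have "x = (i \<cdot> p \<boxplus> j \<cdot> q) \<cdot> x" using x by (simp only: biproductD(20)[OF S] Idt_Comp')
  also have "\<dots> = i \<cdot> (p \<cdot> x) \<boxplus> j \<cdot> (q \<cdot> x)" using x by (simp del: biproductD(20)[OF S])
  finally show ?thesis .
qed

definition exact_at :: "'m \<Rightarrow> 'm \<Rightarrow> bool" where
  "exact_at f g \<longleftrightarrow> f \<in> Arr C \<and> g \<in> Arr C \<and> Cod C f = Dom C g \<and>
     g \<cdot> f = Zro C (Dom C f) (Cod C g) \<and>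
     (\<forall>u \<in> Arr C. Cod C u = Dom C g \<longrightarrow> g \<cdot> u = Zro C (Dom C u) (Cod C g) \<longrightarrow>
        (\<exists>x \<in> Hom C (Dom C u) (Dom C f). f \<cdot> x = u))"

lemma exact_atE:
  assumes "exact_at f g" "u \<in> Arr C" "Cod C u = Dom C g" "g \<cdot> u = Zro C (Dom C u) (Cod C g)"
  obtains x where "x \<in> Arr C" "Dom C x = Dom C u" "Cod C x = Dom C f" "f \<cdot> x = u"
  using assms unfolding exact_at_def by (metis Hom_iff)

lemma exact_at_retract:
  assumes E: "exact_at f g"
    and f': "f' \<in> Arr C" "g' \<in> Arr C" "Cod C f' = Dom C g'"
    and a: "a \<in> Hom C (Dom C f') (Dom C f)" "a' \<in> Hom C (Dom C f) (Dom C f')"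
    and b: "b \<in> Hom C (Dom C g') (Dom C g)" "b' \<in> Hom C (Dom C g) (Dom C g')" "b' \<cdot> b = Idt C (Dom C g')"
    and c: "c \<in> Hom C (Cod C g') (Cod C g)" "c' \<in> Hom C (Cod C g) (Cod C g')" "c' \<cdot> c = Idt C (Cod C g')"
    and comm: "b \<cdot> f' = f \<cdot> a" "c \<cdot> g' = g \<cdot> b" "b' \<cdot> f = f' \<cdot> a'"
  shows "exact_at f' g'"
proof -
  have fg[simp]: "f \<in> Arr C" "g \<in> Arr C" "Cod C f = Dom C g"
    and z: "g \<cdot> f = Zro C (Dom C f) (Cod C g)" using E by (simp_all add: exact_at_def)
  note [simp] = f' a[simplified] b(1,2)[simplified] c(1,2)[simplified]
  have "c' \<cdot> (c \<cdot> (g' \<cdot> f')) = Zro C (Dom C f') (Cod C g')"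
    by (simp add: Comp_reduce[OF comm(2)] comm(1) Comp_reduce[OF z])
  then have z': "g' \<cdot> f' = Zro C (Dom C f') (Cod C g')" by (simp add: Comp_reduce[OF c(3)])
  have "\<exists>x \<in> Hom C (Dom C u) (Dom C f'). f' \<cdot> x = u"
    if u: "u \<in> Arr C" "Cod C u = Dom C g'" "g' \<cdot> u = Zro C (Dom C u) (Cod C g')" for u
  proof -
    note [simp] = u(1,2)
    have "g \<cdot> (b \<cdot> u) = Zro C (Dom C (b \<cdot> u)) (Cod C g)"
      by (simp add: Comp_reduce[OF comm(2)[symmetric]] u(3))
    then obtain x where x: "x \<in> Arr C" "Dom C x = Dom C u" "Cod C x = Dom C f" "f \<cdot> x = b \<cdot> u"
      using exact_atE[OF E, of "b \<cdot> u"] by auto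
    have "f' \<cdot> (a' \<cdot> x) = u"
      using x(1-3) by (simp add: Comp_reduce[OF comm(3)[symmetric]] x(4) Comp_reduce[OF b(3)])
    then show ?thesis using x(1-3) by - (rule bexI[of _ "a' \<cdot> x"], simp_all)
  qed
  then show ?thesis unfolding exact_at_def using z' by simp
qed

lemma exact_at_sum:
  assumes E1: "exact_at f1 g1" and E2: "exact_at f2 g2"
    and f: "f \<in> Arr C" "g \<in> Arr C" "Cod C f = Dom C g"
    and A: "is_biproduct C (Dom C f1) (Dom C f2) (Dom C f) i1 j1 p1 q1"
    and B: "is_biproduct C (Dom C g1) (Dom C g2) (Dom C g) i2 j2 p2 q2"
    and D: "is_biproduct C (Cod C g1) (Cod C g2) (Cod C g) i3 j3 p3 q3"
    and comm: "i2 \<cdot> f1 = f \<cdot> i1" "j2 \<cdot> f2 = f \<cdot> j1" "p3 \<cdot> g = g1 \<cdot> p2" "q3 \<cdot> g = g2 \<cdot> q2"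
      "p2 \<cdot> f = f1 \<cdot> p1" "q2 \<cdot> f = f2 \<cdot> q1"
  shows "exact_at f g"
proof -
  have [simp]: "f1 \<in> Arr C" "g1 \<in> Arr C" "Cod C f1 = Dom C g1" "f2 \<in> Arr C" "g2 \<in> Arr C" "Cod C f2 = Dom C g2"
    and z: "g1 \<cdot> f1 = Zro C (Dom C f1) (Cod C g1)" "g2 \<cdot> f2 = Zro C (Dom C f2) (Cod C g2)"
    using E1 E2 by (simp_all add: exact_at_def)
  note [simp] = f biproductD[OF A] biproductD[OF B] biproductD[OF D]
  have "p3 \<cdot> (g \<cdot> f) = Zro C (Dom C f) (Cod C g1)"
    by (simp add: Comp_reduce[OF comm(3)] comm(5) Comp_reduce[OF z(1)])
  moreover have "q3 \<cdot> (g \<cdot> f) = Zro C (Dom C f) (Cod C g2)"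
    by (simp add: Comp_reduce[OF comm(4)] comm(6) Comp_reduce[OF z(2)])
  ultimately have gf: "g \<cdot> f = Zro C (Dom C f) (Cod C g)"
    using biproduct_in[OF D, of "g \<cdot> f"] by simp
  have "\<exists>x \<in> Hom C (Dom C u) (Dom C f). f \<cdot> x = u"
    if u: "u \<in> Arr C" "Cod C u = Dom C g" "g \<cdot> u = Zro C (Dom C u) (Cod C g)" for u
  proof -
    note [simp] = u(1,2)
    have "g1 \<cdot> (p2 \<cdot> u) = Zro C (Dom C (p2 \<cdot> u)) (Cod C g1)"
      by (simp add: Comp_reduce[OF comm(3)[symmetric]] u(3))
    then obtain x where x: "x \<in> Arr C" "Dom C x = Dom C u" "Cod C x = Dom C f1" "f1 \<cdot> x = p2 \<cdot> u"
      using exact_atE[OF E1, of "p2 \<cdot> u"] by auto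
    have "g2 \<cdot> (q2 \<cdot> u) = Zro C (Dom C (q2 \<cdot> u)) (Cod C g2)"
      by (simp add: Comp_reduce[OF comm(4)[symmetric]] u(3))
    then obtain y where y: "y \<in> Arr C" "Dom C y = Dom C u" "Cod C y = Dom C f2" "f2 \<cdot> y = q2 \<cdot> u"
      using exact_atE[OF E2, of "q2 \<cdot> u"] by auto
    note [simp] = x(1-3) y(1-3)
    have "f \<cdot> (i1 \<cdot> x \<boxplus> j1 \<cdot> y) = i2 \<cdot> (p2 \<cdot> u) \<boxplus> j2 \<cdot> (q2 \<cdot> u)"
      by (simp add: Comp_reduce[OF comm(1)[symmetric]] Comp_reduce[OF comm(2)[symmetric]] x(4) y(4))
    also have "\<dots> = u" by (rule biproduct_in[OF B, symmetric]) simp_all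
    finally show ?thesis by - (rule bexI[of _ "i1 \<cdot> x \<boxplus> j1 \<cdot> y"], simp_all)
  qed
  then show ?thesis unfolding exact_at_def using gf by simp
qed

lemma biproduct_swap:
  assumes B: "is_biproduct C X Y T i j p q" shows "is_biproduct C Y X T j i q p"
proof -
  note [simp] = biproductD[OF B]
  have "j \<cdot> q \<boxplus> i \<cdot> p = i \<cdot> p \<boxplus> j \<cdot> q" by (rule Add_comm) simp_all
  then show ?thesis unfolding is_biproduct_def by simp
qed

lemma isomorphic_direct_sum:
  assumes I: "isomorphic C X Y" and Z: "zero_object C Z"
  shows "direct_sum C X Z Y"
proof -
  obtain f where f: "f \<in> Arr C" "Dom C f = X" "Cod C f = Y" "is_iso C f"
    using I unfolding isomorphic_def by auto
  obtain g where g: "g \<in> Arr C" "Dom C g = Y" "Cod C g = X" "g \<cdot> f = Idt C X" "f \<cdot> g = Idt C Y"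
    using is_isoE[OF f(4)] f by metis
  have [simp]: "X \<in> Obj C" "Y \<in> Obj C" "Z \<in> Obj C" using f Z by auto
  have "is_biproduct C X Z Y f (Zro C Z Y) g (Zro C Y Z)"
    unfolding is_biproduct_def using f g zero_object_iff[of Z] Z by simp
  then show ?thesis unfolding direct_sum_def by blast
qed

text \<open>By additivity it suffices to cancel against zero.\<close>

definition monic :: "'m \<Rightarrow> bool" where
  "monic f \<longleftrightarrow> f \<in> Arr C \<and>
     (\<forall>u \<in> Arr C. Cod C u = Dom C f \<longrightarrow> f \<cdot> u = Zro C (Dom C u) (Cod C f) \<longrightarrow> u = Zro C (Dom C u) (Dom C f))"

definition epic :: "'m \<Rightarrow> bool" where
  "epic f \<longleftrightarrow> f \<in> Arr C \<and>
     (\<forall>u \<in> Arr C. Dom C u = Cod C f \<longrightarrow> u \<cdot> f = Zro C (Dom C f) (Cod C u) \<longrightarrow> u = Zro C (Cod C f) (Cod C u))"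

lemma monicD: "\<lbrakk>monic f; u \<in> Arr C; Cod C u = Dom C f; f \<cdot> u = Zro C (Dom C u) (Cod C f)\<rbrakk>
    \<Longrightarrow> u = Zro C (Dom C u) (Dom C f)"
  by (simp add: monic_def)

lemma epicD: "\<lbrakk>epic f; u \<in> Arr C; Dom C u = Cod C f; u \<cdot> f = Zro C (Dom C f) (Cod C u)\<rbrakk>
    \<Longrightarrow> u = Zro C (Cod C f) (Cod C u)"
  by (simp add: epic_def)

lemma split_monic:
  assumes f: "f \<in> Arr C" and r: "r \<in> Arr C" "Dom C r = Cod C f" "r \<cdot> f = Idt C (Dom C f)"
  shows "monic f"
  unfolding monic_def
proof (intro conjI ballI impI)
  fix u assume u: "u \<in> Arr C" "Cod C u = Dom C f" "f \<cdot> u = Zro C (Dom C u) (Cod C f)"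
  have "Cod C r = Dom C f" using r f Comp_simps(3)[of f r] by simp
  then have "u = r \<cdot> (f \<cdot> u)" using f r u(1,2) by (simp add: Comp_reduce[OF r(3)])
  then show "u = Zro C (Dom C u) (Dom C f)" unfolding u(3) using f r u(1) \<open>Cod C r = Dom C f\<close> by simp
qed (rule f)

lemma split_epic:
  assumes f: "f \<in> Arr C" and s: "s \<in> Arr C" "Cod C s = Dom C f" "f \<cdot> s = Idt C (Cod C f)"
  shows "epic f"
  unfolding epic_def
proof (intro conjI ballI impI)
  fix u assume u: "u \<in> Arr C" "Dom C u = Cod C f" "u \<cdot> f = Zro C (Dom C f) (Cod C u)"
  have d: "Dom C s = Cod C f" using s f Comp_simps(2)[of s f] by simp
  have "u = (u \<cdot> f) \<cdot> s" using f s u(1,2) d by simp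
  then show "u = Zro C (Cod C f) (Cod C u)" unfolding u(3) using f s u(1) d by simp
qed (rule f)

end

section \<open>Functors\<close>

locale cat_functor = C: category C + D: category D
  for C :: "('o, 'm, 'x) cat_scheme" and D :: "('p, 'n, 'y) cat_scheme"
    and F :: "('o, 'm, 'p, 'n) cfunctor" +
  assumes is_functor: "is_functor C D F"
begin

lemma OMap_Obj [simp]: "X \<in> Obj C \<Longrightarrow> OMap F X \<in> Obj D"
  and AMap_Idt [simp]: "X \<in> Obj C \<Longrightarrow> AMap F (Idt C X) = Idt D (OMap F X)"
  using is_functor by (auto simp: is_functor_def)

lemma AMap_simps [simp]:
  assumes "f \<in> Arr C"
  shows "AMap F f \<in> Arr D" "Dom D (AMap F f) = OMap F (Dom C f)"
    "Cod D (AMap F f) = OMap F (Cod C f)"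
  using is_functor assms by (auto simp: is_functor_def)

lemma AMap_Comp [simp]:
  "\<lbrakk>f \<in> Arr C; g \<in> Arr C; Cod C f = Dom C g\<rbrakk> \<Longrightarrow> AMap F (g \<cdot>\<^bsub>C\<^esub> f) = AMap F g \<cdot>\<^bsub>D\<^esub> AMap F f"
  using is_functor by (auto simp: is_functor_def)

lemma AMap_iso [simp]:
  assumes "is_iso C f" shows "is_iso D (AMap F f)"
proof -
  obtain g where g: "f \<in> Arr C" "g \<in> Arr C" "Dom C g = Cod C f" "Cod C g = Dom C f"
    "g \<cdot>\<^bsub>C\<^esub> f = Idt C (Dom C f)" "f \<cdot>\<^bsub>C\<^esub> g = Idt C (Cod C f)"
    using assms by (metis C.is_isoE)
  show ?thesis
    by (rule D.is_isoI[of _ "AMap F g"]) (use g in \<open>simp_all flip: AMap_Comp\<close>)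
qed

lemma isomorphic_OMap: "isomorphic C X Y \<Longrightarrow> isomorphic D (OMap F X) (OMap F Y)"
  unfolding isomorphic_def by (metis AMap_iso AMap_simps Hom_iff)

end

lemma cat_functorI: "is_functor C D F \<Longrightarrow> cat_functor C D F"
  by (simp add: cat_functor_def cat_functor_axioms_def is_functor_def)

locale additive_functor = cat_functor C D F + C: preadditive_category C + D: preadditive_category D
  for C :: "('o, 'm, 'x) addcat_scheme" and D :: "('p, 'n, 'y) addcat_scheme"
    and F :: "('o, 'm, 'p, 'n) cfunctor" +
  assumes is_additive: "is_additive_functor C D F"
begin

lemma AMap_Add [simp]:
  "\<lbrakk>f \<in> Arr C; g \<in> Arr C; Dom C f = Dom C g; Cod C f = Cod C g\<rbrakk>
    \<Longrightarrow> AMap F (f \<boxplus>\<^bsub>C\<^esub> g) = AMap F f \<boxplus>\<^bsub>D\<^esub> AMap F g"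
  using is_additive by (auto simp: is_additive_functor_def)

lemma AMap_Zro [simp]:
  assumes "X \<in> Obj C" "Y \<in> Obj C"
  shows "AMap F (Zro C X Y) = Zro D (OMap F X) (OMap F Y)"
  using D.idem_Zro[of "AMap F (Zro C X Y)"] AMap_Add[of "Zro C X Y" "Zro C X Y"] assms
  by (simp del: AMap_Add)

lemma AMap_Neg [simp]: "f \<in> Arr C \<Longrightarrow> AMap F (Neg C f) = Neg D (AMap F f)"
  using D.Neg_unique[of "AMap F f" "AMap F (Neg C f)"] by (simp flip: AMap_Add)

lemma zero_object_OMap: "zero_object C Z \<Longrightarrow> zero_object D (OMap F Z)"
  unfolding C.zero_object_iff D.zero_object_iff by (metis AMap_Idt AMap_Zro OMap_Obj)

lemma biproduct_OMap:
  assumes "is_biproduct C X Y S i j p q"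
  shows "is_biproduct D (OMap F X) (OMap F Y) (OMap F S) (AMap F i) (AMap F j) (AMap F p) (AMap F q)"
  using C.biproductD[OF assms] unfolding is_biproduct_def Hom_iff
  by (simp flip: AMap_Comp AMap_Add)

end

lemma additive_functorI:
  "\<lbrakk>is_additive_functor C D F; preadditive_category C; preadditive_category D\<rbrakk>
    \<Longrightarrow> additive_functor C D F"
  by (simp add: additive_functor_def additive_functor_axioms_def is_additive_functor_def
      cat_functorI)

text \<open>The quasi-inverse is chosen object by object, and acts on arrows by conjugation with
  the chosen isomorphisms. Functoriality and naturality are checked after applying the faithful
  functor \<open>F\<close>.\<close>

lemma is_equivalence_criterion:
  assumes F: "is_functor C D F"
    and inj: "\<And>f g. \<lbrakk>f \<in> Arr C; g \<in> Arr C; Dom C f = Dom C g; Cod C f = Cod C g; AMap F f = AMap F g\<rbrakk>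
      \<Longrightarrow> f = g"
    and surj: "\<And>X Y u. \<lbrakk>X \<in> Obj C; Y \<in> Obj C; u \<in> Hom D (OMap F X) (OMap F Y)\<rbrakk>
      \<Longrightarrow> \<exists>f \<in> Hom C X Y. AMap F f = u"
    and ess: "\<And>Y. Y \<in> Obj D \<Longrightarrow> \<exists>X \<in> Obj C. isomorphic D (OMap F X) Y"
  shows "is_equivalence C D F"
proof -
  interpret cat_functor C D F using F by (rule cat_functorI)
  have "\<forall>Y. \<exists>X e e'. Y \<in> Obj D \<longrightarrow> X \<in> Obj C \<and> e \<in> Arr D \<and> e' \<in> Arr D \<and>
      Dom D e = OMap F X \<and> Cod D e = Y \<and> Dom D e' = Y \<and> Cod D e' = OMap F X \<and>
      e' \<cdot>\<^bsub>D\<^esub> e = Idt D (OMap F X) \<and> e \<cdot>\<^bsub>D\<^esub> e' = Idt D Y \<and> is_iso D e"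
    using ess unfolding isomorphic_def by (metis D.is_isoE Hom_iff)
  then obtain G e e' where G: "\<And>Y. Y \<in> Obj D \<Longrightarrow> G Y \<in> Obj C \<and> e Y \<in> Arr D \<and> e' Y \<in> Arr D \<and>
      Dom D (e Y) = OMap F (G Y) \<and> Cod D (e Y) = Y \<and> Dom D (e' Y) = Y \<and>
      Cod D (e' Y) = OMap F (G Y) \<and>
      e' Y \<cdot>\<^bsub>D\<^esub> e Y = Idt D (OMap F (G Y)) \<and> e Y \<cdot>\<^bsub>D\<^esub> e' Y = Idt D Y \<and> is_iso D (e Y)"
    by metis
  have e: "G Y \<in> Obj C" "e Y \<in> Arr D" "e' Y \<in> Arr D"
      "Dom D (e Y) = OMap F (G Y)" "Cod D (e Y) = Y" "Dom D (e' Y) = Y"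
      "Cod D (e' Y) = OMap F (G Y)"
      "e' Y \<cdot>\<^bsub>D\<^esub> e Y = Idt D (OMap F (G Y))" "e Y \<cdot>\<^bsub>D\<^esub> e' Y = Idt D Y" "is_iso D (e Y)"
      "\<And>x. \<lbrakk>x \<in> Arr D; Cod D x = OMap F (G Y)\<rbrakk> \<Longrightarrow> e' Y \<cdot>\<^bsub>D\<^esub> (e Y \<cdot>\<^bsub>D\<^esub> x) = x"
      "\<And>x. \<lbrakk>x \<in> Arr D; Cod D x = Y\<rbrakk> \<Longrightarrow> e Y \<cdot>\<^bsub>D\<^esub> (e' Y \<cdot>\<^bsub>D\<^esub> x) = x"
    if "Y \<in> Obj D" for Y
    using G[OF that] D.Comp_reduce[of "e' Y" "e Y"] D.Comp_reduce[of "e Y" "e' Y"] by auto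
  define pre where "pre X Y u = (SOME f. f \<in> Hom C X Y \<and> AMap F f = u)" for X Y u
  have pre: "pre X Y u \<in> Arr C" "Dom C (pre X Y u) = X" "Cod C (pre X Y u) = Y"
      "AMap F (pre X Y u) = u"
    if "X \<in> Obj C" "Y \<in> Obj C" "u \<in> Arr D" "Dom D u = OMap F X" "Cod D u = OMap F Y" for X Y u
  proof -
    have "pre X Y u \<in> Hom C X Y \<and> AMap F (pre X Y u) = u"
      unfolding pre_def by (rule someI_ex) (use surj[of X Y u] that in auto)
    then show "pre X Y u \<in> Arr C" "Dom C (pre X Y u) = X" "Cod C (pre X Y u) = Y"
      "AMap F (pre X Y u) = u" by auto
  qed
  define G' where "G' = \<lparr>OMap = G, AMap = \<lambda>u. pre (G (Dom D u)) (G (Cod D u))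
      (e' (Cod D u) \<cdot>\<^bsub>D\<^esub> (u \<cdot>\<^bsub>D\<^esub> e (Dom D u)))\<rparr>"
  have G': "OMap G' Y = G Y" for Y by (simp add: G'_def)
  have G'A: "AMap G' u \<in> Arr C" "Dom C (AMap G' u) = G (Dom D u)" "Cod C (AMap G' u) = G (Cod D u)"
     "AMap F (AMap G' u) = e' (Cod D u) \<cdot>\<^bsub>D\<^esub> (u \<cdot>\<^bsub>D\<^esub> e (Dom D u))" if "u \<in> Arr D" for u
    using pre[of "G (Dom D u)" "G (Cod D u)" "e' (Cod D u) \<cdot>\<^bsub>D\<^esub> (u \<cdot>\<^bsub>D\<^esub> e (Dom D u))"] that e
    by (simp_all add: G'_def)
  have funG: "is_functor D C G'"
    unfolding is_functor_def
  proof (intro conjI ballI impI)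
    fix Y assume Y: "Y \<in> Obj D"
    show "AMap G' (Idt D Y) = Idt C (OMap G' Y)"
      by (rule inj) (use Y G'A[of "Idt D Y"] e G' in simp_all)
  next
    fix u v assume u: "u \<in> Arr D" "v \<in> Arr D" "Cod D u = Dom D v"
    show "AMap G' (v \<cdot>\<^bsub>D\<^esub> u) = AMap G' v \<cdot>\<^bsub>C\<^esub> AMap G' u"
      by (rule inj) (use u G'A[of "v \<cdot>\<^bsub>D\<^esub> u"] G'A[of u] G'A[of v] e G' in simp_all)
  qed (use e G' G'A C.category_axioms D.category_axioms in auto)
  have "nat_iso D D (comp_functor F G') id_functor e"
    unfolding nat_iso_def
  proof (intro conjI ballI)
    show "is_functor D D (comp_functor F G')"
      using funG F unfolding is_functor_def comp_functor_def by auto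
    show "is_functor D D id_functor"
      using D.category_axioms unfolding is_functor_def id_functor_def by auto
    fix u assume "u \<in> Arr D"
    then show "e (Cod D u) \<cdot>\<^bsub>D\<^esub> AMap (comp_functor F G') u = AMap id_functor u \<cdot>\<^bsub>D\<^esub> e (Dom D u)"
      using G'A e by (simp add: comp_functor_def id_functor_def)
  qed (use e G' in \<open>simp_all add: comp_functor_def id_functor_def\<close>)
  then have FG: "nat_isomorphic D D (comp_functor F G') id_functor"
    unfolding nat_isomorphic_def by blast
  define n where "n X = pre (G (OMap F X)) X (e (OMap F X))" for X
  have n: "n X \<in> Arr C" "Dom C (n X) = G (OMap F X)" "Cod C (n X) = X" "AMap F (n X) = e (OMap F X)"
    if "X \<in> Obj C" for X
    unfolding n_def using pre[of "G (OMap F X)" X "e (OMap F X)"] that e by simp_all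
  have niso: "is_iso C (n X)" if X: "X \<in> Obj C" for X
  proof -
    define k where "k = pre X (G (OMap F X)) (e' (OMap F X))"
    have k: "k \<in> Arr C" "Dom C k = X" "Cod C k = G (OMap F X)" "AMap F k = e' (OMap F X)"
      unfolding k_def using pre[of X "G (OMap F X)" "e' (OMap F X)"] X e by simp_all
    have 1: "k \<cdot>\<^bsub>C\<^esub> n X = Idt C (G (OMap F X))"
      by (rule inj) (use X k n[of X] e in simp_all)
    have 2: "n X \<cdot>\<^bsub>C\<^esub> k = Idt C X"
      by (rule inj) (use X k n[of X] e in simp_all)
    show ?thesis by (rule C.is_isoI[of _ k]) (use X k n[of X] e 1 2 in simp_all)
  qed
  have "nat_iso C C (comp_functor G' F) id_functor n"
    unfolding nat_iso_def
  proof (intro conjI ballI)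
    show "is_functor C C (comp_functor G' F)"
      using funG F unfolding is_functor_def comp_functor_def by auto
    show "is_functor C C id_functor"
      using C.category_axioms unfolding is_functor_def id_functor_def by auto
    fix u assume u: "u \<in> Arr C"
    show "n (Cod C u) \<cdot>\<^bsub>C\<^esub> AMap (comp_functor G' F) u = AMap id_functor u \<cdot>\<^bsub>C\<^esub> n (Dom C u)"
      by (rule inj)
        (use u G'A[of "AMap F u"] e n in \<open>simp_all add: comp_functor_def id_functor_def\<close>)
  qed (use e n niso G' in \<open>simp_all add: comp_functor_def id_functor_def\<close>)
  then have "nat_isomorphic C C (comp_functor G' F) id_functor"
    unfolding nat_isomorphic_def by blast
  with FG funG F show ?thesis unfolding is_equivalence_def by blast
qed

lemma nat_iso_id_faithful:
  assumes "nat_iso C C T id_functor n" "f \<in> Arr C" "g \<in> Arr C" "Dom C f = Dom C g" "Cod C f = Cod C g"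
    "AMap T f = AMap T g"
  shows "f = g"
proof -
  interpret category C using assms(1) unfolding nat_iso_def is_functor_def by blast
  have n: "\<And>X. X \<in> Obj C \<Longrightarrow> is_iso C (n X) \<and> Dom C (n X) = OMap T X \<and> Cod C (n X) = X"
    "\<And>f. f \<in> Arr C \<Longrightarrow> n (Cod C f) \<cdot>\<^bsub>C\<^esub> AMap T f = f \<cdot>\<^bsub>C\<^esub> n (Dom C f)"
    using assms(1) unfolding nat_iso_def id_functor_def by auto
  have "f \<cdot>\<^bsub>C\<^esub> n (Dom C f) = g \<cdot>\<^bsub>C\<^esub> n (Dom C f)" using n(2) assms by metis
  moreover obtain k where k: "k \<in> Arr C" "Dom C k = Dom C f" "Cod C k = OMap T (Dom C f)"
    "n (Dom C f) \<cdot>\<^bsub>C\<^esub> k = Idt C (Dom C f)"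
    using n(1)[of "Dom C f"] assms(2) by (metis Dom_Obj is_isoE)
  ultimately have "(f \<cdot>\<^bsub>C\<^esub> n (Dom C f)) \<cdot>\<^bsub>C\<^esub> k = (g \<cdot>\<^bsub>C\<^esub> n (Dom C f)) \<cdot>\<^bsub>C\<^esub> k" by simp
  then show ?thesis using k assms n(1)[of "Dom C f"] by simp
qed

text \<open>Both functors are faithful, because a composite with each is isomorphic to an identity
  functor; faithfulness of the quasi-inverse \<open>G\<close> then gives fullness of
  \<open>F\<close>.\<close>

lemma is_equivalenceD:
  assumes "is_equivalence C D F"
  shows "\<And>f g. \<lbrakk>f \<in> Arr C; g \<in> Arr C; Dom C f = Dom C g; Cod C f = Cod C g; AMap F f = AMap F g\<rbrakk>
      \<Longrightarrow> f = g"
    and "\<And>X Y u. \<lbrakk>X \<in> Obj C; Y \<in> Obj C; u \<in> Hom D (OMap F X) (OMap F Y)\<rbrakk>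
      \<Longrightarrow> \<exists>f \<in> Hom C X Y. AMap F f = u"
    and "\<And>Y. Y \<in> Obj D \<Longrightarrow> \<exists>X \<in> Obj C. isomorphic D (OMap F X) Y"
proof -
  obtain G n m where F: "is_functor C D F" and G: "is_functor D C G"
    and n: "nat_iso C C (comp_functor G F) id_functor n"
    and m: "nat_iso D D (comp_functor F G) id_functor m"
    using assms unfolding is_equivalence_def nat_isomorphic_def by blast
  interpret F: cat_functor C D F using F by (rule cat_functorI)
  interpret G: cat_functor D C G using G by (rule cat_functorI)
  show ff: "f = g" if "f \<in> Arr C" "g \<in> Arr C" "Dom C f = Dom C g" "Cod C f = Cod C g"
    "AMap F f = AMap F g" for f g
    by (rule nat_iso_id_faithful[OF n]) (use that in \<open>simp_all add: comp_functor_def\<close>)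
  have Gff: "f = g" if "f \<in> Arr D" "g \<in> Arr D" "Dom D f = Dom D g" "Cod D f = Cod D g"
    "AMap G f = AMap G g" for f g
    by (rule nat_iso_id_faithful[OF m]) (use that in \<open>simp_all add: comp_functor_def\<close>)
  show "\<exists>f \<in> Hom C X Y. AMap F f = u"
    if X: "X \<in> Obj C" "Y \<in> Obj C" and u: "u \<in> Hom D (OMap F X) (OMap F Y)" for X Y u
  proof -
    have n': "\<And>X. X \<in> Obj C \<Longrightarrow> n X \<in> Arr C \<and> is_iso C (n X) \<and> Dom C (n X) = OMap G (OMap F X) \<and> Cod C (n X) = X"
      "\<And>f. f \<in> Arr C \<Longrightarrow> n (Cod C f) \<cdot>\<^bsub>C\<^esub> AMap G (AMap F f) = f \<cdot>\<^bsub>C\<^esub> n (Dom C f)"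
      using n unfolding nat_iso_def id_functor_def comp_functor_def by auto
    obtain k where k: "k \<in> Arr C" "Dom C k = X" "Cod C k = OMap G (OMap F X)"
      "k \<cdot>\<^bsub>C\<^esub> n X = Idt C (Dom C (n X))"
      using n'(1)[of X] X by (metis F.C.is_isoE)
    define f where "f = n Y \<cdot>\<^bsub>C\<^esub> (AMap G u \<cdot>\<^bsub>C\<^esub> k)"
    have f: "f \<in> Hom C X Y" using k u n'(1)[of X] n'(1)[of Y] X by (simp add: f_def)
    have "n Y \<cdot>\<^bsub>C\<^esub> AMap G (AMap F f) = f \<cdot>\<^bsub>C\<^esub> n X" using n'(2)[of f] f by simp
    also have "\<dots> = n Y \<cdot>\<^bsub>C\<^esub> AMap G u"
      using k u n'(1)[of X] n'(1)[of Y] X by (simp add: f_def)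
    finally have "AMap G (AMap F f) = AMap G u"
      by (rule F.C.iso_cancel_left[rotated 5]) (use f u n' X in auto)
    then have "AMap F f = u" by (rule Gff[rotated 4]) (use f u in auto)
    with f show ?thesis by blast
  qed
  show "\<exists>X \<in> Obj C. isomorphic D (OMap F X) Y" if "Y \<in> Obj D" for Y
    using m that unfolding nat_iso_def isomorphic_def id_functor_def comp_functor_def
    by (metis G.OMap_Obj comp_apply cfunctor.select_convs(1))
qed

section \<open>Adjunctions\<close>

text \<open>Naturality of the adjunction bijection, separated into the two variables.\<close>

lemma adjointE:
  assumes "adjoint C D F G"
  obtains \<Phi> where "is_functor C D F" "is_functor D C G"
    "\<And>X Y. \<lbrakk>X \<in> Obj C; Y \<in> Obj D\<rbrakk> \<Longrightarrow> bij_betw (\<Phi> X Y) (Hom D (OMap F X) Y) (Hom C X (OMap G Y))"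
    "\<And>X b f. \<lbrakk>X \<in> Obj C; b \<in> Arr D; f \<in> Hom D (OMap F X) (Dom D b)\<rbrakk>
      \<Longrightarrow> \<Phi> X (Cod D b) (b \<cdot>\<^bsub>D\<^esub> f) = AMap G b \<cdot>\<^bsub>C\<^esub> \<Phi> X (Dom D b) f"
    "\<And>Y a f. \<lbrakk>Y \<in> Obj D; a \<in> Arr C; f \<in> Hom D (OMap F (Cod C a)) Y\<rbrakk>
      \<Longrightarrow> \<Phi> (Dom C a) Y (f \<cdot>\<^bsub>D\<^esub> AMap F a) = \<Phi> (Cod C a) Y f \<cdot>\<^bsub>C\<^esub> a"
proof -
  obtain \<Phi> where F: "is_functor C D F" and G: "is_functor D C G"
    and bij: "\<And>X Y. \<lbrakk>X \<in> Obj C; Y \<in> Obj D\<rbrakk> \<Longrightarrow> bij_betw (\<Phi> X Y) (Hom D (OMap F X) Y) (Hom C X (OMap G Y))"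
    and nat: "\<And>a b f. \<lbrakk>a \<in> Arr C; b \<in> Arr D; f \<in> Hom D (OMap F (Cod C a)) (Dom D b)\<rbrakk> \<Longrightarrow>
      \<Phi> (Dom C a) (Cod D b) (b \<cdot>\<^bsub>D\<^esub> f \<cdot>\<^bsub>D\<^esub> AMap F a) = AMap G b \<cdot>\<^bsub>C\<^esub> \<Phi> (Cod C a) (Dom D b) f \<cdot>\<^bsub>C\<^esub> a"
    using assms unfolding adjoint_def by blast
  interpret F: cat_functor C D F using F by (rule cat_functorI)
  interpret G: cat_functor D C G using G by (rule cat_functorI)
  have \<Phi>: "\<Phi> X Y f \<in> Hom C X (OMap G Y)" if "X \<in> Obj C" "Y \<in> Obj D" "f \<in> Hom D (OMap F X) Y" for X Y f
    using bij[OF that(1,2)] that(3) bij_betwE by blast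
  have post: "\<Phi> X (Cod D b) (b \<cdot>\<^bsub>D\<^esub> f) = AMap G b \<cdot>\<^bsub>C\<^esub> \<Phi> X (Dom D b) f"
    if "X \<in> Obj C" "b \<in> Arr D" "f \<in> Hom D (OMap F X) (Dom D b)" for X b f
  proof -
    have t: "\<Phi> X (Dom D b) f \<in> Hom C X (OMap G (Dom D b))" by (rule \<Phi>) (use that in simp_all)
    show ?thesis using nat[of "Idt C X" b f] that t by simp
  qed
  have pre: "\<Phi> (Dom C a) Y (f \<cdot>\<^bsub>D\<^esub> AMap F a) = \<Phi> (Cod C a) Y f \<cdot>\<^bsub>C\<^esub> a"
    if "Y \<in> Obj D" "a \<in> Arr C" "f \<in> Hom D (OMap F (Cod C a)) Y" for Y a f
  proof -
    have t: "\<Phi> (Cod C a) Y f \<in> Hom C (Cod C a) (OMap G Y)" by (rule \<Phi>) (use that in simp_all)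
    show ?thesis using nat[of a "Idt D Y" f] that t by simp
  qed
  show ?thesis by (rule that[OF F G bij post pre])
qed

text \<open>The counit \<open>e\<close> at \<open>Y\<close> corresponds to the identity of
  \<open>G Y\<close>, and the unit at \<open>G Y\<close> splits \<open>G e\<close> by the triangle
  identity.\<close>

lemma adjoint_counit:
  assumes A: "adjoint C D F G" and Y: "Y \<in> Obj D"
  obtains e s where "e \<in> Hom D (OMap F (OMap G Y)) Y"
    "s \<in> Hom C (OMap G Y) (OMap G (OMap F (OMap G Y)))" "AMap G e \<cdot>\<^bsub>C\<^esub> s = Idt C (OMap G Y)"
proof -
  obtain \<Phi> where F: "is_functor C D F" and G: "is_functor D C G"
    and bij: "\<And>X Y. \<lbrakk>X \<in> Obj C; Y \<in> Obj D\<rbrakk> \<Longrightarrow> bij_betw (\<Phi> X Y) (Hom D (OMap F X) Y) (Hom C X (OMap G Y))"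
    and post: "\<And>X b f. \<lbrakk>X \<in> Obj C; b \<in> Arr D; f \<in> Hom D (OMap F X) (Dom D b)\<rbrakk>
      \<Longrightarrow> \<Phi> X (Cod D b) (b \<cdot>\<^bsub>D\<^esub> f) = AMap G b \<cdot>\<^bsub>C\<^esub> \<Phi> X (Dom D b) f"
    using adjointE[OF A] by metis
  interpret F: cat_functor C D F using F by (rule cat_functorI)
  interpret G: cat_functor D C G using G by (rule cat_functorI)
  define X where "X = OMap G Y"
  have X[simp]: "X \<in> Obj C" "OMap G Y = X" using Y by (simp_all add: X_def[symmetric]) (simp add: X_def)
  note [simp] = Y
  have "Idt C X \<in> \<Phi> X Y ` Hom D (OMap F X) Y"
    using bij[OF X(1) Y] by (simp add: bij_betw_def)
  then obtain e where e: "e \<in> Hom D (OMap F X) Y" and \<Phi>e: "\<Phi> X Y e = Idt C X" by force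
  define s where "s = \<Phi> X (OMap F X) (Idt D (OMap F X))"
  have s: "s \<in> Hom C X (OMap G (OMap F X))"
    unfolding s_def using bij[of X "OMap F X"] F.D.Idt_in_Hom[of "OMap F X"] by (metis bij_betwE F.OMap_Obj X(1))
  have "AMap G e \<cdot>\<^bsub>C\<^esub> s = \<Phi> X Y (e \<cdot>\<^bsub>D\<^esub> Idt D (OMap F X))"
    unfolding s_def using post[of X e "Idt D (OMap F X)"] e by simp
  also have "\<dots> = Idt C X" using e \<Phi>e by simp
  finally show ?thesis using that e s by simp
qed

lemma adjoint_unit:
  assumes A: "adjoint C D F G" and X: "X \<in> Obj C"
  obtains n r where "n \<in> Hom C X (OMap G (OMap F X))"
    "r \<in> Hom D (OMap F (OMap G (OMap F X))) (OMap F X)" "r \<cdot>\<^bsub>D\<^esub> AMap F n = Idt D (OMap F X)"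
proof -
  obtain \<Phi> where F: "is_functor C D F" and G: "is_functor D C G"
    and bij: "\<And>X Y. \<lbrakk>X \<in> Obj C; Y \<in> Obj D\<rbrakk> \<Longrightarrow> bij_betw (\<Phi> X Y) (Hom D (OMap F X) Y) (Hom C X (OMap G Y))"
    and pre: "\<And>Y a f. \<lbrakk>Y \<in> Obj D; a \<in> Arr C; f \<in> Hom D (OMap F (Cod C a)) Y\<rbrakk>
      \<Longrightarrow> \<Phi> (Dom C a) Y (f \<cdot>\<^bsub>D\<^esub> AMap F a) = \<Phi> (Cod C a) Y f \<cdot>\<^bsub>C\<^esub> a"
    using adjointE[OF A] by metis
  interpret F: cat_functor C D F using F by (rule cat_functorI)
  interpret G: cat_functor D C G using G by (rule cat_functorI)
  define Y where "Y = OMap F X"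
  have Y[simp]: "Y \<in> Obj D" "OMap F X = Y" using X by (simp_all add: Y_def[symmetric]) (simp add: Y_def)
  note [simp] = X
  define n where "n = \<Phi> X Y (Idt D Y)"
  have n: "n \<in> Hom C X (OMap G Y)"
    unfolding n_def using bij[of X Y] F.D.Idt_in_Hom[of Y] by (metis bij_betwE X Y)
  have "Idt C (OMap G Y) \<in> \<Phi> (OMap G Y) Y ` Hom D (OMap F (OMap G Y)) Y"
    using bij[of "OMap G Y" Y] by (simp add: bij_betw_def)
  then obtain r where r: "r \<in> Hom D (OMap F (OMap G Y)) Y" and \<Phi>r: "\<Phi> (OMap G Y) Y r = Idt C (OMap G Y)"
    by force
  have "\<Phi> X Y (r \<cdot>\<^bsub>D\<^esub> AMap F n) = n" using pre[of Y n r] n r \<Phi>r by simp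
  then have "\<Phi> X Y (r \<cdot>\<^bsub>D\<^esub> AMap F n) = \<Phi> X Y (Idt D Y)" by (simp add: n_def)
  moreover have "r \<cdot>\<^bsub>D\<^esub> AMap F n \<in> Hom D (OMap F X) Y" "Idt D Y \<in> Hom D (OMap F X) Y"
    using r n by simp_all
  ultimately have "r \<cdot>\<^bsub>D\<^esub> AMap F n = Idt D Y"
    using bij[of X Y] X Y(1) unfolding bij_betw_def inj_on_def by blast
  then show ?thesis using that n r by simp
qed

section \<open>Categories with a suspension\<close>

text \<open>Exactness of the covariant Hom sequences at the second, third and fourth vertex of a
  triangle. This is the part of the long exact sequence that the five lemma uses and that passes
  to retracts and direct sums.\<close>

definition hom_exact :: "('o, 'm, 'x) suspcat_scheme \<Rightarrow> 'm triangle \<Rightarrow> bool" where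
  "hom_exact C T \<longleftrightarrow> T \<in> triangles C \<and> (case T of (f, g, h) \<Rightarrow>
     g \<cdot>\<^bsub>C\<^esub> f = Zro C (Dom C f) (Dom C h) \<and>
     h \<cdot>\<^bsub>C\<^esub> g = Zro C (Dom C g) (OMap (Susp C) (Dom C f)) \<and>
     AMap (Susp C) f \<cdot>\<^bsub>C\<^esub> h = Zro C (Dom C h) (OMap (Susp C) (Dom C g)) \<and>
     (\<forall>u \<in> Arr C. Cod C u = Dom C g \<longrightarrow> g \<cdot>\<^bsub>C\<^esub> u = Zro C (Dom C u) (Dom C h) \<longrightarrow>
        (\<exists>x \<in> Hom C (Dom C u) (Dom C f). f \<cdot>\<^bsub>C\<^esub> x = u)) \<and>
     (\<forall>u \<in> Arr C. Cod C u = Dom C h \<longrightarrow> h \<cdot>\<^bsub>C\<^esub> u = Zro C (Dom C u) (OMap (Susp C) (Dom C f)) \<longrightarrow>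
        (\<exists>x \<in> Hom C (Dom C u) (Dom C g). g \<cdot>\<^bsub>C\<^esub> x = u)) \<and>
     (\<forall>u \<in> Arr C. Cod C u = OMap (Susp C) (Dom C f) \<longrightarrow>
        AMap (Susp C) f \<cdot>\<^bsub>C\<^esub> u = Zro C (Dom C u) (OMap (Susp C) (Dom C g)) \<longrightarrow>
        (\<exists>x \<in> Hom C (Dom C u) (Dom C h). h \<cdot>\<^bsub>C\<^esub> x = u)))"

lemma trianglesD:
  assumes "(f, g, h) \<in> triangles C"
  shows "f \<in> Arr C" "g \<in> Arr C" "h \<in> Arr C" "Cod C f = Dom C g" "Cod C g = Dom C h"
    "Cod C h = OMap (Susp C) (Dom C f)"
  using assms by (auto simp: triangles_def)

lemma trianglesI:
  "\<lbrakk>f \<in> Arr C; g \<in> Arr C; h \<in> Arr C; Cod C f = Dom C g; Cod C g = Dom C h;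
    Cod C h = OMap (Susp C) (Dom C f)\<rbrakk> \<Longrightarrow> (f, g, h) \<in> triangles C"
  by (simp add: triangles_def)

lemma tri_morD:
  assumes "tri_mor C (f, g, h) (f', g', h') a b c"
  shows "(f, g, h) \<in> triangles C" "(f', g', h') \<in> triangles C"
    "a \<in> Arr C" "Dom C a = Dom C f" "Cod C a = Dom C f'"
    "b \<in> Arr C" "Dom C b = Dom C g" "Cod C b = Dom C g'"
    "c \<in> Arr C" "Dom C c = Dom C h" "Cod C c = Dom C h'"
    "b \<cdot>\<^bsub>C\<^esub> f = f' \<cdot>\<^bsub>C\<^esub> a" "c \<cdot>\<^bsub>C\<^esub> g = g' \<cdot>\<^bsub>C\<^esub> b"
    "AMap (Susp C) a \<cdot>\<^bsub>C\<^esub> h = h' \<cdot>\<^bsub>C\<^esub> c"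
  using assms by auto

lemma hom_exactD:
  assumes "hom_exact C (f, g, h)"
  shows "(f, g, h) \<in> triangles C"
    "g \<cdot>\<^bsub>C\<^esub> f = Zro C (Dom C f) (Dom C h)"
    "h \<cdot>\<^bsub>C\<^esub> g = Zro C (Dom C g) (OMap (Susp C) (Dom C f))"
    "AMap (Susp C) f \<cdot>\<^bsub>C\<^esub> h = Zro C (Dom C h) (OMap (Susp C) (Dom C g))"
    "\<And>u. \<lbrakk>u \<in> Arr C; Cod C u = Dom C g; g \<cdot>\<^bsub>C\<^esub> u = Zro C (Dom C u) (Dom C h)\<rbrakk>
      \<Longrightarrow> \<exists>x. x \<in> Arr C \<and> Dom C x = Dom C u \<and> Cod C x = Dom C f \<and> f \<cdot>\<^bsub>C\<^esub> x = u"
    "\<And>u. \<lbrakk>u \<in> Arr C; Cod C u = Dom C h; h \<cdot>\<^bsub>C\<^esub> u = Zro C (Dom C u) (OMap (Susp C) (Dom C f))\<rbrakk>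
      \<Longrightarrow> \<exists>x. x \<in> Arr C \<and> Dom C x = Dom C u \<and> Cod C x = Dom C g \<and> g \<cdot>\<^bsub>C\<^esub> x = u"
    "\<And>u. \<lbrakk>u \<in> Arr C; Cod C u = OMap (Susp C) (Dom C f);
        AMap (Susp C) f \<cdot>\<^bsub>C\<^esub> u = Zro C (Dom C u) (OMap (Susp C) (Dom C g))\<rbrakk>
      \<Longrightarrow> \<exists>x. x \<in> Arr C \<and> Dom C x = Dom C u \<and> Cod C x = Dom C h \<and> h \<cdot>\<^bsub>C\<^esub> x = u"
  using assms unfolding hom_exact_def by (fastforce)+

locale suspended_category = additive_category C for C :: "('o, 'm, 'x) suspcat_scheme" (structure) +
  assumes suspension_additive: "is_additive_functor C C (Susp C)"

sublocale suspended_category \<subseteq> Susp: additive_functor C C "Susp C"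
  by (rule additive_functorI) (rule suspension_additive preadditive_category_axioms)+

context suspended_category
begin

text \<open>The suspension, on objects and on arrows.\<close>

abbreviation SO :: "'o \<Rightarrow> 'o" where "SO \<equiv> OMap (Susp C)"
abbreviation SA :: "'m \<Rightarrow> 'm" where "SA \<equiv> AMap (Susp C)"

lemma tri_mor_comp:
  assumes "tri_mor C (f, g, h) (f', g', h') a b c" "tri_mor C (f', g', h') (f'', g'', h'') a' b' c'"
  shows "tri_mor C (f, g, h) (f'', g'', h'') (a' \<cdot> a) (b' \<cdot> b) (c' \<cdot> c)"
proof -
  note 1 = tri_morD[OF assms(1)] and 2 = tri_morD[OF assms(2)]
  note [simp] = trianglesD[OF 1(1)] trianglesD[OF 1(2)] trianglesD[OF 2(2)] 1(3-11) 2(3-11)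
  show ?thesis
    using 1(1) 2(2) by (simp add: 1(12-14) 2(12-14)
      Comp_reduce[OF 2(12)] Comp_reduce[OF 2(13)] Comp_reduce[OF 2(14)])
qed

lemma tri_mor_inverse:
  assumes T: "tri_mor C (f, g, h) (f', g', h') a b c"
    and a: "a' \<in> Arr C" "Dom C a' = Dom C f'" "Cod C a' = Dom C f" "a' \<cdot> a = Idt C (Dom C f)"
      "a \<cdot> a' = Idt C (Dom C f')"
    and b: "b' \<in> Arr C" "Dom C b' = Dom C g'" "Cod C b' = Dom C g" "b' \<cdot> b = Idt C (Dom C g)"
      "b \<cdot> b' = Idt C (Dom C g')"
    and c: "c' \<in> Arr C" "Dom C c' = Dom C h'" "Cod C c' = Dom C h" "c' \<cdot> c = Idt C (Dom C h)"
      "c \<cdot> c' = Idt C (Dom C h')"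
  shows "tri_mor C (f', g', h') (f, g, h) a' b' c'"
proof -
  note 1 = tri_morD[OF T]
  note [simp] = trianglesD[OF 1(1)] trianglesD[OF 1(2)] 1(3-11) a b c
  have sa: "SA a' \<cdot> SA a = Idt C (SO (Dom C f))"
    using Susp.AMap_Comp[of a a'] by (simp del: Susp.AMap_Comp)
  have "b' \<cdot> (f' \<cdot> a) \<cdot> a' = b' \<cdot> (b \<cdot> f) \<cdot> a'" using 1(12) by simp
  then have f: "b' \<cdot> f' = f \<cdot> a'" by (simp add: Comp_reduce[OF b(4)])
  have "c' \<cdot> (g' \<cdot> b) \<cdot> b' = c' \<cdot> (c \<cdot> g) \<cdot> b'" using 1(13) by simp
  then have g: "c' \<cdot> g' = g \<cdot> b'" by (simp add: Comp_reduce[OF c(4)])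
  have "SA a' \<cdot> (h' \<cdot> c) \<cdot> c' = SA a' \<cdot> (SA a \<cdot> h) \<cdot> c'" using 1(14) by simp
  then have h: "SA a' \<cdot> h' = h \<cdot> c'" by (simp add: Comp_reduce[OF sa])
  show ?thesis using 1(1,2) f g h by simp
qed

lemma tri_isomorphicI:
  "\<lbrakk>tri_mor C T T' a b c; is_iso C a; is_iso C b; is_iso C c\<rbrakk> \<Longrightarrow> tri_isomorphic C T T'"
  unfolding tri_isomorphic_def by blast

lemma tri_isomorphicE:
  assumes "tri_isomorphic C (f, g, h) (f', g', h')"
  obtains a b c a' b' c' where
    "tri_mor C (f, g, h) (f', g', h') a b c" "is_iso C a" "is_iso C b" "is_iso C c"
    "tri_mor C (f', g', h') (f, g, h) a' b' c'" "is_iso C a'" "is_iso C b'" "is_iso C c'"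
    "a' \<cdot> a = Idt C (Dom C f)" "a \<cdot> a' = Idt C (Dom C f')"
    "b' \<cdot> b = Idt C (Dom C g)" "b \<cdot> b' = Idt C (Dom C g')"
    "c' \<cdot> c = Idt C (Dom C h)" "c \<cdot> c' = Idt C (Dom C h')"
proof -
  obtain a b c where m: "tri_mor C (f, g, h) (f', g', h') a b c" and i: "is_iso C a" "is_iso C b" "is_iso C c"
    using assms unfolding tri_isomorphic_def by blast
  note 1 = tri_morD[OF m]
  obtain a' where a: "a' \<in> Arr C" "Dom C a' = Dom C f'" "Cod C a' = Dom C f"
    "a' \<cdot> a = Idt C (Dom C f)" "a \<cdot> a' = Idt C (Dom C f')" "is_iso C a'"
    using i(1) 1(4,5) by (metis is_isoE)
  obtain b' where b: "b' \<in> Arr C" "Dom C b' = Dom C g'" "Cod C b' = Dom C g"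
    "b' \<cdot> b = Idt C (Dom C g)" "b \<cdot> b' = Idt C (Dom C g')" "is_iso C b'"
    using i(2) 1(7,8) by (metis is_isoE)
  obtain c' where c: "c' \<in> Arr C" "Dom C c' = Dom C h'" "Cod C c' = Dom C h"
    "c' \<cdot> c = Idt C (Dom C h)" "c \<cdot> c' = Idt C (Dom C h')" "is_iso C c'"
    using i(3) 1(10,11) by (metis is_isoE)
  show ?thesis
    by (rule that[OF m i tri_mor_inverse[OF m a(1-5) b(1-5) c(1-5)] a(6) b(6) c(6)
      a(4,5) b(4,5) c(4,5)])
qed

lemma tri_isomorphic_sym:
  assumes "tri_isomorphic C T T'" shows "tri_isomorphic C T' T"
proof -
  obtain f g h f' g' h' where T: "T = (f, g, h)" "T' = (f', g', h')" by (metis prod_cases3)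
  obtain a b c where "tri_mor C (f', g', h') (f, g, h) a b c" "is_iso C a" "is_iso C b" "is_iso C c"
    using tri_isomorphicE[OF assms[unfolded T]] by metis
  then show ?thesis unfolding T by (rule tri_isomorphicI)
qed

lemma tri_isomorphic_trans:
  assumes "tri_isomorphic C T T'" "tri_isomorphic C T' T''" shows "tri_isomorphic C T T''"
proof -
  obtain f g h f' g' h' f'' g'' h'' where T: "T = (f, g, h)" "T' = (f', g', h')" "T'' = (f'', g'', h'')"
    by (metis prod_cases3)
  obtain a b c a' b' c' where m: "tri_mor C T T' a b c" "is_iso C a" "is_iso C b" "is_iso C c"
    "tri_mor C T' T'' a' b' c'" "is_iso C a'" "is_iso C b'" "is_iso C c'"
    using assms unfolding tri_isomorphic_def by blast
  note 1 = tri_morD[OF m(1)[unfolded T]] and 2 = tri_morD[OF m(5)[unfolded T]]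
  show ?thesis
    unfolding tri_isomorphic_def T
    using tri_mor_comp[OF m(1)[unfolded T] m(5)[unfolded T]] m 1(3-11) 2(3-11)
    by (metis is_iso_Comp)
qed

lemma tri_isomorphic_triangles: "tri_isomorphic C T T' \<Longrightarrow> T \<in> triangles C \<and> T' \<in> triangles C"
  unfolding tri_isomorphic_def by (cases T; cases T') (auto dest: tri_morD)

text \<open>The usual chase: a lift of the identity of the third vertex gives a section of
  \<open>c\<close>, and the second half of the chase cancels \<open>c\<close> on the left.
  Elements are arrows from an arbitrary object.\<close>

lemma five_lemma:
  assumes T: "hom_exact C (f, g, h)" and T': "hom_exact C (f', g', h')"
    and m: "tri_mor C (f, g, h) (f', g', h') a b c" and ia: "is_iso C a" and ib: "is_iso C b"
  shows "is_iso C c"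
proof -
  note 1 = hom_exactD[OF T] and 2 = hom_exactD[OF T'] and M = tri_morD[OF m]
  note [simp] = trianglesD[OF 1(1)] trianglesD[OF 2(1)] M(3-11)
  obtain a' where a': "a' \<in> Arr C" "Dom C a' = Dom C f'" "Cod C a' = Dom C f"
    "a' \<cdot> a = Idt C (Dom C f)" "a \<cdot> a' = Idt C (Dom C f')"
    using ia M by (metis is_isoE)
  obtain b' where b': "b' \<in> Arr C" "Dom C b' = Dom C g'" "Cod C b' = Dom C g"
    "b' \<cdot> b = Idt C (Dom C g)" "b \<cdot> b' = Idt C (Dom C g')"
    using ib M by (metis is_isoE)
  note [simp] = a' b'
  have sa: "SA a' \<cdot> SA a = Idt C (SO (Dom C f))" "SA a \<cdot> SA a' = Idt C (SO (Dom C f'))"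
    using Susp.AMap_Comp[of a a'] Susp.AMap_Comp[of a' a] by (simp_all del: Susp.AMap_Comp)
  have sb: "SA b' \<cdot> SA b = Idt C (SO (Dom C g))"
    using Susp.AMap_Comp[of b b'] by (simp del: Susp.AMap_Comp)
  have sf: "SA b \<cdot> SA f = SA f' \<cdot> SA a" using M(12) by (simp flip: Susp.AMap_Comp)
  \<comment> \<open>Every arrow into the third vertex of the target lifts along \<open>c\<close>.\<close>
  have surj: "\<exists>x \<in> Arr C. Dom C x = Dom C y \<and> Cod C x = Dom C h \<and> c \<cdot> x = y"
    if y: "y \<in> Arr C" "Cod C y = Dom C h'" for y
  proof -
    define e where "e = SA a' \<cdot> (h' \<cdot> y)"
    have e[simp]: "e \<in> Arr C" "Dom C e = Dom C y" "Cod C e = SO (Dom C f)" using y by (simp_all add: e_def)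
    have ae: "SA a \<cdot> e = h' \<cdot> y" using y by (simp add: e_def Comp_reduce[OF sa(2)])
    have "SA b \<cdot> (SA f \<cdot> e) = SA f' \<cdot> (h' \<cdot> y)"
      by (simp add: Comp_reduce[OF sf] ae)
    also have "\<dots> = Zro C (Dom C y) (SO (Dom C g'))" using y by (simp add: Comp_reduce[OF 2(4)])
    finally have "SA b' \<cdot> (SA b \<cdot> (SA f \<cdot> e)) = SA b' \<cdot> Zro C (Dom C y) (SO (Dom C g'))" by simp
    then have "SA f \<cdot> e = Zro C (Dom C e) (SO (Dom C g))" using y by (simp add: Comp_reduce[OF sb])
    then obtain z where z[simp]: "z \<in> Arr C" "Dom C z = Dom C y" "Cod C z = Dom C h" "h \<cdot> z = e"
      using 1(7)[of e] by auto
    have "h' \<cdot> (c \<cdot> z) = h' \<cdot> y" by (simp add: Comp_reduce[OF M(14)[symmetric]] ae)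
    then have "h' \<cdot> (y \<boxplus> Neg C (c \<cdot> z)) = Zro C (Dom C y) (SO (Dom C f'))" using y by simp
    then obtain x where x[simp]: "x \<in> Arr C" "Dom C x = Dom C y" "Cod C x = Dom C g'"
      and gx: "g' \<cdot> x = y \<boxplus> Neg C (c \<cdot> z)"
      using 2(6)[of "y \<boxplus> Neg C (c \<cdot> z)"] y by auto
    have "c \<cdot> (z \<boxplus> g \<cdot> (b' \<cdot> x)) = c \<cdot> z \<boxplus> g' \<cdot> x"
      by (simp add: Comp_reduce[OF M(13)] Comp_reduce[OF b'(5)])
    also have "\<dots> = y" using y unfolding gx by (subst Add_comm) simp_all
    finally show ?thesis by (intro bexI[of _ "z \<boxplus> g \<cdot> (b' \<cdot> x)"]) simp_all
  qed
  obtain s where s: "s \<in> Arr C" "Dom C s = Dom C h'" "Cod C s = Dom C h" "c \<cdot> s = Idt C (Dom C h')"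
    using surj[of "Idt C (Dom C h')"] by auto
  show ?thesis
  proof (rule is_iso_split_epi_mono)
    fix u assume u[simp]: "u \<in> Arr C" "Cod C u = Dom C c" and cu: "c \<cdot> u = Zro C (Dom C u) (Cod C c)"
    have "SA a \<cdot> (h \<cdot> u) = h' \<cdot> (c \<cdot> u)" by (simp add: Comp_reduce[OF M(14)])
    also have "\<dots> = Zro C (Dom C u) (SO (Dom C f'))" by (simp add: cu)
    finally have "SA a' \<cdot> (SA a \<cdot> (h \<cdot> u)) = SA a' \<cdot> Zro C (Dom C u) (SO (Dom C f'))" by simp
    then have "h \<cdot> u = Zro C (Dom C u) (SO (Dom C f))" by (simp add: Comp_reduce[OF sa(1)])
    then obtain x where x[simp]: "x \<in> Arr C" "Dom C x = Dom C u" "Cod C x = Dom C g" "g \<cdot> x = u"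
      using 1(6)[of u] by auto
    have "g' \<cdot> (b \<cdot> x) = c \<cdot> (g \<cdot> x)" by (simp add: Comp_reduce[OF M(13)[symmetric]] del: x(4))
    then have "g' \<cdot> (b \<cdot> x) = Zro C (Dom C (b \<cdot> x)) (Dom C h')" using cu by simp
    then obtain y where y[simp]: "y \<in> Arr C" "Dom C y = Dom C u" "Cod C y = Dom C f'" "f' \<cdot> y = b \<cdot> x"
      using 2(5)[of "b \<cdot> x"] by auto
    have "b \<cdot> (f \<cdot> (a' \<cdot> y)) = b \<cdot> x" by (simp add: Comp_reduce[OF M(12)] Comp_reduce[OF a'(5)])
    then have "f \<cdot> (a' \<cdot> y) = x" by (rule iso_cancel_left[OF ib, rotated 4]) simp_all
    then have "g \<cdot> (f \<cdot> (a' \<cdot> y)) = u" by simp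
    then show "u = Zro C (Dom C u) (Dom C c)" by (simp add: Comp_reduce[OF 1(2)])
  qed (use s in simp_all)
qed

end

section \<open>Triangulated categories\<close>

sublocale triangulated_category \<subseteq> suspended_category K
  by unfold_locales (rule Susp_additive)

context triangulated_category
begin

lemma susp_inj:
  "\<lbrakk>f \<in> Arr K; g \<in> Arr K; Dom K f = Dom K g; Cod K f = Cod K g; SA f = SA g\<rbrakk> \<Longrightarrow> f = g"
  by (rule is_equivalenceD(1)[OF Susp_equivalence])

lemma susp_surj:
  assumes "u \<in> Arr K" "Dom K u = SO X" "Cod K u = SO Y" "X \<in> Obj K" "Y \<in> Obj K"
  obtains f where "f \<in> Arr K" "Dom K f = X" "Cod K f = Y" "SA f = u"
  using is_equivalenceD(2)[OF Susp_equivalence, of X Y u] assms by auto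

lemma susp_eq_Zro:
  "\<lbrakk>f \<in> Arr K; SA f = Zro K (SO (Dom K f)) (SO (Cod K f))\<rbrakk> \<Longrightarrow> f = Zro K (Dom K f) (Cod K f)"
  by (rule susp_inj) auto

lemma susp_reflects_iso:
  assumes f: "f \<in> Arr K" and i: "is_iso K (SA f)" shows "is_iso K f"
proof -
  obtain u where u: "u \<in> Arr K" "Dom K u = SO (Cod K f)" "Cod K u = SO (Dom K f)"
    "u \<cdot> SA f = Idt K (SO (Dom K f))" "SA f \<cdot> u = Idt K (SO (Cod K f))"
    using i f by (metis is_isoE Susp.AMap_simps(2,3))
  obtain g where g: "g \<in> Arr K" "Dom K g = Cod K f" "Cod K g = Dom K f" "SA g = u"
    using susp_surj[of u "Cod K f" "Dom K f"] u f by auto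
  have 1: "g \<cdot> f = Idt K (Dom K f)" by (rule susp_inj) (use u g f in simp_all)
  have 2: "f \<cdot> g = Idt K (Cod K f)" by (rule susp_inj) (use u g f in simp_all)
  show ?thesis by (rule is_isoI[of f g]) (use f g 1 2 in simp_all)
qed

lemma DistD:
  assumes "(f, g, h) \<in> Dist K"
  shows "f \<in> Arr K" "g \<in> Arr K" "h \<in> Arr K" "Cod K f = Dom K g" "Cod K g = Dom K h"
    "Cod K h = SO (Dom K f)"
  using trianglesD[of f g h K] assms Dist_triangles by blast+

lemma Dist_rotate: "(f, g, h) \<in> Dist K \<Longrightarrow> (g, h, Neg K (SA f)) \<in> Dist K"
  using TR2 Dist_triangles by blast

lemma Dist_unrotate:
  assumes "(g, h, Neg K (SA f)) \<in> Dist K" "f \<in> Arr K" "Cod K f = Dom K g"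
  shows "(f, g, h) \<in> Dist K"
proof -
  have "(f, g, h) \<in> triangles K"
    using DistD[OF assms(1)] assms(2,3) by (intro trianglesI) simp_all
  then show ?thesis using TR2 assms by blast
qed

text \<open>Compare with the triangle on the identity of the first vertex, whose third vertex is
  zero.\<close>

lemma Dist_comp_zero1:
  assumes T: "(f, g, h) \<in> Dist K" shows "g \<cdot> f = Zro K (Dom K f) (Dom K h)"
proof -
  note [simp] = DistD[OF T]
  obtain Z where Z: "zero_object K Z" using zero_object_exists by blast
  have [simp]: "Z \<in> Obj K" using Z by simp
  have T0: "(Idt K (Dom K f), Zro K (Dom K f) Z, Zro K Z (SO (Dom K f))) \<in> Dist K"
    by (rule TR1_id) (use Z in simp_all)
  obtain c where "tri_mor K (Idt K (Dom K f), Zro K (Dom K f) Z, Zro K Z (SO (Dom K f))) (f, g, h)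
      (Idt K (Dom K f)) f c"
    using TR3[OF T0 T, of "Idt K (Dom K f)" f] by auto
  from tri_morD[OF this] show ?thesis by simp
qed

lemma Dist_comp_zero2:
  "(f, g, h) \<in> Dist K \<Longrightarrow> h \<cdot> g = Zro K (Dom K g) (SO (Dom K f))"
  using Dist_comp_zero1[OF Dist_rotate] DistD by (metis Neg_simps(2) Susp.AMap_simps(1,2))

lemma Dist_comp_zero3:
  assumes T: "(f, g, h) \<in> Dist K"
  shows "SA f \<cdot> h = Zro K (Dom K h) (SO (Dom K g))"
proof -
  note [simp] = DistD[OF T]
  have "Neg K (SA f) \<cdot> h = Zro K (Dom K h) (SO (Dom K g))"
    using Dist_comp_zero2[OF Dist_rotate[OF T]] by simp
  then show ?thesis by (simp add: Neg_eq_Zro)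
qed

lemma Dist_trivial2:
  assumes "zero_object K Z" "X \<in> Obj K"
  shows "(Zro K Z X, Idt K X, Zro K X (SO Z)) \<in> Dist K"
proof (rule Dist_unrotate)
  have [simp]: "Z \<in> Obj K" using assms by simp
  have "zero_object K (SO Z)" using assms Susp.zero_object_OMap by blast
  then show "(Idt K X, Zro K X (SO Z), Neg K (SA (Zro K Z X))) \<in> Dist K"
    using TR1_id[of X "SO Z"] assms by simp
qed (use assms in simp_all)

text \<open>Compare with the rotated identity triangle on the domain of \<open>u\<close>: the
  fill-in is an arrow between suspensions, and its desuspension is the factorisation.\<close>

lemma Dist_exact1:
  assumes T: "(f, g, h) \<in> Dist K" and u: "u \<in> Arr K" "Cod K u = Dom K g"
    "g \<cdot> u = Zro K (Dom K u) (Dom K h)"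
  obtains x where "x \<in> Arr K" "Dom K x = Dom K u" "Cod K x = Dom K f" "f \<cdot> x = u"
proof -
  note [simp] = DistD[OF T] u
  obtain Z where Z: "zero_object K Z" using zero_object_exists by blast
  have [simp]: "Z \<in> Obj K" using Z by simp
  have "(Idt K (Dom K u), Zro K (Dom K u) Z, Zro K Z (SO (Dom K u))) \<in> Dist K"
    by (rule TR1_id) (use Z in simp_all)
  from Dist_rotate[OF this]
  have T0: "(Zro K (Dom K u) Z, Zro K Z (SO (Dom K u)), Neg K (Idt K (SO (Dom K u)))) \<in> Dist K"
    by simp
  obtain c where "tri_mor K (Zro K (Dom K u) Z, Zro K Z (SO (Dom K u)), Neg K (Idt K (SO (Dom K u))))
     (g, h, Neg K (SA f)) u (Zro K Z (Dom K h)) c"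
    using TR3[OF T0 Dist_rotate[OF T], of u "Zro K Z (Dom K h)"] by auto
  note c = tri_morD[OF this]
  have c1: "c \<in> Arr K" "Dom K c = SO (Dom K u)" "Cod K c = SO (Dom K f)" using c by simp_all
  obtain x where x: "x \<in> Arr K" "Dom K x = Dom K u" "Cod K x = Dom K f" "SA x = c"
    using susp_surj[OF c1] by auto
  note [simp] = c1
  have "SA (f \<cdot> x) = SA u" using c(14) x(1-3) by (simp add: Neg_eq_iff x(4))
  then have "f \<cdot> x = u" by (rule susp_inj[rotated 4]) (use x in simp_all)
  with x that show ?thesis by blast
qed

lemma Dist_exact2:
  assumes T: "(f, g, h) \<in> Dist K" and u: "u \<in> Arr K" "Cod K u = Dom K h"
    "h \<cdot> u = Zro K (Dom K u) (SO (Dom K f))"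
  obtains x where "x \<in> Arr K" "Dom K x = Dom K u" "Cod K x = Dom K g" "g \<cdot> x = u"
  using Dist_exact1[OF Dist_rotate[OF T], of u] DistD[OF T] u by auto

lemma Dist_exact3:
  assumes T: "(f, g, h) \<in> Dist K" and u: "u \<in> Arr K" "Cod K u = SO (Dom K f)"
    "SA f \<cdot> u = Zro K (Dom K u) (SO (Dom K g))"
  obtains x where "x \<in> Arr K" "Dom K x = Dom K u" "Cod K x = Dom K h" "h \<cdot> x = u"
  using Dist_exact2[OF Dist_rotate[OF T], of u] DistD[OF T] u by auto

lemma Dist_hom_exact: "(f, g, h) \<in> Dist K \<Longrightarrow> hom_exact K (f, g, h)"
  unfolding hom_exact_def prod.case
proof (intro conjI ballI impI)
  assume T: "(f, g, h) \<in> Dist K"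
  then show "(f, g, h) \<in> triangles K" using Dist_triangles by blast
  fix u assume u: "u \<in> Arr K"
  show "\<exists>x\<in>Hom K (Dom K u) (Dom K f). f \<cdot> x = u"
    if "Cod K u = Dom K g" "g \<cdot> u = Zro K (Dom K u) (Dom K h)"
    using Dist_exact1[OF T u that] by (metis Hom_iff)
  show "\<exists>x\<in>Hom K (Dom K u) (Dom K g). g \<cdot> x = u"
    if "Cod K u = Dom K h" "h \<cdot> u = Zro K (Dom K u) (SO (Dom K f))"
    using Dist_exact2[OF T u that] by (metis Hom_iff)
  show "\<exists>x\<in>Hom K (Dom K u) (Dom K h). h \<cdot> x = u"
    if "Cod K u = SO (Dom K f)" "SA f \<cdot> u = Zro K (Dom K u) (SO (Dom K g))"
    using Dist_exact3[OF T u that] by (metis Hom_iff)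
qed (rule Dist_comp_zero1 Dist_comp_zero2 Dist_comp_zero3, assumption)+

lemma Dist_coexact2:
  assumes T: "(f, g, h) \<in> Dist K" and u: "u \<in> Arr K" "Dom K u = Dom K g"
    "u \<cdot> f = Zro K (Dom K f) (Cod K u)"
  obtains x where "x \<in> Arr K" "Dom K x = Dom K h" "Cod K x = Cod K u" "x \<cdot> g = u"
proof -
  note [simp] = DistD[OF T] u
  obtain Z where Z: "zero_object K Z" using zero_object_exists by blast
  have [simp]: "Z \<in> Obj K" using Z by simp
  have T0: "(Zro K Z (Cod K u), Idt K (Cod K u), Zro K (Cod K u) (SO Z)) \<in> Dist K"
    by (rule Dist_trivial2) (use Z in simp_all)
  obtain c where "tri_mor K (f, g, h) (Zro K Z (Cod K u), Idt K (Cod K u), Zro K (Cod K u) (SO Z))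
      (Zro K (Dom K f) Z) u c"
    using TR3[OF T T0, of "Zro K (Dom K f) Z" u] by auto
  from tri_morD[OF this] that[of c] show ?thesis by simp
qed

lemma Dist_coexact3:
  assumes T: "(f, g, h) \<in> Dist K" and u: "u \<in> Arr K" "Dom K u = Dom K h"
    "u \<cdot> g = Zro K (Dom K g) (Cod K u)"
  obtains x where "x \<in> Arr K" "Dom K x = SO (Dom K f)" "Cod K x = Cod K u" "x \<cdot> h = u"
  using Dist_coexact2[OF Dist_rotate[OF T], of u] DistD[OF T] u by auto

text \<open>The obstruction to extending \<open>u\<close> along \<open>f\<close> is
  \<open>\<Sigma>u h\<close>, by exactness for the triangle rotated twice.\<close>

lemma Dist_extend:
  assumes T: "(f, g, h) \<in> Dist K" and u: "u \<in> Arr K" "Dom K u = Dom K f"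
    "SA u \<cdot> h = Zro K (Dom K h) (SO (Cod K u))"
  obtains x where "x \<in> Arr K" "Dom K x = Dom K g" "Cod K x = Cod K u" "x \<cdot> f = u"
proof -
  note [simp] = DistD[OF T] u
  obtain y where y: "y \<in> Arr K" "Dom K y = SO (Dom K g)" "Cod K y = SO (Cod K u)"
    "y \<cdot> Neg K (SA f) = SA u"
    using Dist_coexact3[OF Dist_rotate[OF T], of "SA u"] by auto
  obtain x where x: "x \<in> Arr K" "Dom K x = Dom K g" "Cod K x = Cod K u" "SA x = y"
    using susp_surj[OF y(1-3)] by auto
  have "Neg K x \<cdot> f = u" by (rule susp_inj) (use x y in simp_all)
  then show ?thesis using that[of "Neg K x"] x by simp
qed

text \<open>By rotation, a morphism of triangles can be completed from any two of its components;
  the component found is the suspension of the one wanted.\<close>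

lemma TR3_first:
  assumes T: "(f, g, h) \<in> Dist K" and T': "(f', g', h') \<in> Dist K"
    and b: "b \<in> Arr K" "Dom K b = Dom K g" "Cod K b = Dom K g'"
    and c: "c \<in> Arr K" "Dom K c = Dom K h" "Cod K c = Dom K h'" "c \<cdot> g = g' \<cdot> b"
  obtains a where "tri_mor K (f, g, h) (f', g', h') a b c"
proof -
  note [simp] = DistD[OF T] DistD[OF T'] b c(1-3)
  obtain d where "tri_mor K (g, h, Neg K (SA f)) (g', h', Neg K (SA f')) b c d"
    using TR3[OF Dist_rotate[OF T] Dist_rotate[OF T'], of b c] c(4) by auto
  note d = tri_morD[OF this]
  have "d \<in> Arr K" "Dom K d = SO (Dom K f)" "Cod K d = SO (Dom K f')" using d by simp_all
  then obtain a where a: "a \<in> Arr K" "Dom K a = Dom K f" "Cod K a = Dom K f'" "SA a = d"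
    using susp_surj by (metis Dom_Obj DistD(1)[OF T] DistD(1)[OF T'])
  have "b \<cdot> f = f' \<cdot> a"
    by (rule susp_inj) (use a \<open>d \<in> Arr K\<close> \<open>Dom K d = SO (Dom K f)\<close> \<open>Cod K d = SO (Dom K f')\<close> d(14)
      in \<open>simp_all add: Neg_eq_iff\<close>)
  then show ?thesis using that[of a] a d(13) c(4) T T' Dist_triangles by auto
qed

lemma TR3_second:
  assumes T: "(f, g, h) \<in> Dist K" and T': "(f', g', h') \<in> Dist K"
    and a: "a \<in> Arr K" "Dom K a = Dom K f" "Cod K a = Dom K f'"
    and c: "c \<in> Arr K" "Dom K c = Dom K h" "Cod K c = Dom K h'" "SA a \<cdot> h = h' \<cdot> c"
  obtains b where "tri_mor K (f, g, h) (f', g', h') a b c"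
proof -
  note [simp] = DistD[OF T] DistD[OF T'] a c(1-3)
  obtain d where "tri_mor K (g, h, Neg K (SA f)) (g', h', Neg K (SA f')) d c (SA a)"
    by (rule TR3_first[OF Dist_rotate[OF T] Dist_rotate[OF T'], of c "SA a"]) (use c(4) in auto)
  note d = tri_morD[OF this]
  note [simp] = d(3)[simplified] d(4)[simplified] d(5)[simplified]
  have "SA d \<cdot> SA f = SA f' \<cdot> SA a" using d(14) by (simp add: Neg_eq_iff)
  then have df: "d \<cdot> f = f' \<cdot> a" by - (rule susp_inj, simp_all)
  have "(f, g, h) \<in> triangles K" "(f', g', h') \<in> triangles K" using T T' Dist_triangles by blast+
  then show ?thesis using that[of d] df d(12) c(4) by simp
qed

lemma Dist_five_lemma:
  assumes T: "(f, g, h) \<in> Dist K" and T': "(f', g', h') \<in> Dist K"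
    and m: "tri_mor K (f, g, h) (f', g', h') a b c"
  shows "is_iso K a \<Longrightarrow> is_iso K b \<Longrightarrow> is_iso K c" "is_iso K a \<Longrightarrow> is_iso K c \<Longrightarrow> is_iso K b"
proof -
  show "is_iso K a \<Longrightarrow> is_iso K b \<Longrightarrow> is_iso K c"
    using five_lemma[OF Dist_hom_exact[OF T] Dist_hom_exact[OF T'] m] .
  assume i: "is_iso K a" "is_iso K c"
  note M = tri_morD[OF m]
  note [simp] = DistD[OF T] DistD[OF T'] M(3-11)
  note R = Dist_rotate[OF Dist_rotate[OF T]] and R' = Dist_rotate[OF Dist_rotate[OF T']]
  have "SA b \<cdot> SA f = SA f' \<cdot> SA a" "SA c \<cdot> SA g = SA g' \<cdot> SA b"
    using M(12,13) by (simp_all flip: Susp.AMap_Comp)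
  then have "tri_mor K (h, Neg K (SA f), Neg K (SA g)) (h', Neg K (SA f'), Neg K (SA g')) c (SA a) (SA b)"
    using R R' Dist_triangles M(14) by auto
  then have "is_iso K (SA b)"
    by (rule five_lemma[OF Dist_hom_exact[OF R] Dist_hom_exact[OF R']]) (use i in simp_all)
  then show "is_iso K b" by (rule susp_reflects_iso[rotated]) simp
qed

text \<open>The suspension is only essentially surjective, so the cone is replaced by an
  isomorphic object that is a suspension before the triangle is rotated back.\<close>

lemma Dist_fiber:
  assumes g: "g \<in> Arr K" obtains f h where "(f, g, h) \<in> Dist K"
proof -
  obtain k l where T: "(g, k, l) \<in> Dist K" using TR1_cone[OF g] by blast
  note [simp] = DistD[OF T]
  obtain Y r where Y: "Y \<in> Obj K" and r: "r \<in> Arr K" "Dom K r = Dom K l" "Cod K r = SO Y" "is_iso K r"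
    using is_equivalenceD(3)[OF Susp_equivalence, of "Dom K l"] isomorphic_sym
    unfolding isomorphic_def by (metis DistD(3)[OF T] Dom_Obj Hom_iff)
  obtain s where s: "s \<in> Arr K" "Dom K s = SO Y" "Cod K s = Dom K l"
    "s \<cdot> r = Idt K (Dom K l)" "r \<cdot> s = Idt K (SO Y)" "is_iso K s"
    using r by (metis is_isoE)
  note [simp] = Y r(1-3) s(1-5)
  have "tri_mor K (g, k, l) (g, r \<cdot> k, l \<cdot> s) (Idt K (Dom K g)) (Idt K (Dom K k)) r"
    by (simp add: triangles_def)
  then have "tri_isomorphic K (g, k, l) (g, r \<cdot> k, l \<cdot> s)"
    unfolding tri_isomorphic_def using r(4) by (metis Dom_Obj DistD(1,2)[OF T] is_iso_Idt)
  then have T2: "(g, r \<cdot> k, l \<cdot> s) \<in> Dist K" using T TR1_iso by blast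
  obtain f where f: "f \<in> Arr K" "Dom K f = Y" "Cod K f = Dom K g" "SA f = l \<cdot> s"
    by (rule susp_surj[of "l \<cdot> s" Y "Dom K g"]) simp_all
  have "(Neg K f, g, r \<cdot> k) \<in> Dist K"
    by (rule Dist_unrotate) (use f T2 in simp_all)
  then show ?thesis using that by blast
qed

lemma Dist_cocone:
  assumes k: "k \<in> Arr K" "Cod K k = SO X" "X \<in> Obj K"
  obtains f g where "(f, g, k) \<in> Dist K" "Dom K f = X"
proof -
  obtain g l where T: "(g, k, l) \<in> Dist K" using Dist_fiber[OF k(1)] by blast
  note [simp] = DistD[OF T] k
  have [simp]: "Dom K l = SO X" using DistD(5)[OF T] k by simp
  obtain f where f: "f \<in> Arr K" "Dom K f = X" "Cod K f = Dom K g" "SA f = l"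
    by (rule susp_surj[of l X "Dom K g"]) simp_all
  have "(Neg K f, g, k) \<in> Dist K" by (rule Dist_unrotate) (use f T in simp_all)
  then show ?thesis using that f by simp
qed

text \<open>The third arrow is annihilated by \<open>\<Sigma>f\<close>; after desuspending its
  domain, cancelling \<open>f\<close> shows that it vanishes.\<close>

lemma Dist_mono_imp_zero:
  assumes T: "(f, g, h) \<in> Dist K"
    and mono: "\<And>u. \<lbrakk>u \<in> Arr K; Cod K u = Dom K f; f \<cdot> u = Zro K (Dom K u) (Dom K g)\<rbrakk>
      \<Longrightarrow> u = Zro K (Dom K u) (Dom K f)"
  shows "h = Zro K (Dom K h) (SO (Dom K f))"
proof -
  note [simp] = DistD[OF T]
  obtain Y r where Y: "Y \<in> Obj K" and r: "r \<in> Arr K" "Dom K r = SO Y" "Cod K r = Dom K h" "is_iso K r"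
    using is_equivalenceD(3)[OF Susp_equivalence, of "Dom K h"]
    unfolding isomorphic_def by (metis DistD(3)[OF T] Dom_Obj Hom_iff)
  obtain s where s: "s \<in> Arr K" "Dom K s = Dom K h" "Cod K s = SO Y" "r \<cdot> s = Idt K (Dom K h)"
    using r by (metis is_isoE)
  note [simp] = Y r(1-3) s
  obtain u where u: "u \<in> Arr K" "Dom K u = Y" "Cod K u = Dom K f" "SA u = h \<cdot> r"
    by (rule susp_surj[of "h \<cdot> r" Y "Dom K f"]) simp_all
  have "f \<cdot> u = Zro K (Dom K u) (Dom K g)"
    by (rule susp_inj) (use u in \<open>simp_all add: Comp_reduce[OF Dist_comp_zero3[OF T]]\<close>)
  then have "u = Zro K (Dom K u) (Dom K f)" using mono u by blast
  then have hr: "h \<cdot> r = Zro K (SO Y) (SO (Dom K f))" using u Susp.AMap_Zro by (metis Dom_Obj DistD(1)[OF T] Y)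
  have "h = (h \<cdot> r) \<cdot> s" by simp
  also have "\<dots> = Zro K (Dom K h) (SO (Dom K f))" unfolding hr by simp
  finally show ?thesis .
qed

lemma Dist_zero_imp_mono:
  assumes T: "(f, g, h) \<in> Dist K" and h: "h = Zro K (Dom K h) (SO (Dom K f))"
    and u: "u \<in> Arr K" "Cod K u = Dom K f" "f \<cdot> u = Zro K (Dom K u) (Dom K g)"
  shows "u = Zro K (Dom K u) (Dom K f)"
proof (rule susp_inj)
  note [simp] = DistD[OF T] u
  have "SA f \<cdot> SA u = Zro K (SO (Dom K u)) (SO (Dom K g))"
    using u(3) by (simp flip: Susp.AMap_Comp)
  then obtain x where x: "x \<in> Arr K" "Dom K x = SO (Dom K u)" "Cod K x = Dom K h" "h \<cdot> x = SA u"
    using Dist_exact3[OF T, of "SA u"] by auto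
  then have "SA u = Zro K (Dom K h) (SO (Dom K f)) \<cdot> x" using h by simp
  then show "SA u = SA (Zro K (Dom K u) (Dom K f))" using x(1-3) by simp
qed (use u DistD[OF T] in simp_all)

lemma Dist_epi_imp_zero:
  assumes T: "(f, g, h) \<in> Dist K"
    and epi: "\<And>u. \<lbrakk>u \<in> Arr K; Dom K u = Dom K h; u \<cdot> g = Zro K (Dom K g) (Cod K u)\<rbrakk>
      \<Longrightarrow> u = Zro K (Dom K h) (Cod K u)"
  shows "h = Zro K (Dom K h) (SO (Dom K f))"
  using epi[of h] DistD[OF T] Dist_comp_zero2[OF T] by simp

lemma Dist_zero_imp_epi:
  assumes T: "(f, g, h) \<in> Dist K" and h: "h = Zro K (Dom K h) (SO (Dom K f))"
    and u: "u \<in> Arr K" "Dom K u = Dom K h" "u \<cdot> g = Zro K (Dom K g) (Cod K u)"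
  shows "u = Zro K (Dom K u) (Cod K u)"
proof -
  note [simp] = DistD[OF T] u
  obtain x where x: "x \<in> Arr K" "Dom K x = SO (Dom K f)" "Cod K x = Cod K u" "x \<cdot> h = u"
    using Dist_coexact3[OF T, of u] by auto
  then have "u = x \<cdot> Zro K (Dom K h) (SO (Dom K f))" using h by simp
  then show ?thesis using x(1-3) by simp
qed

text \<open>The inclusion \<open>j\<close> has a left inverse, so the last arrow of its triangle
  vanishes and the arrow to the cone is epic. This makes the comparison of the cone with the
  complement \<open>X\<close> invertible.\<close>

lemma Dist_biproduct:
  assumes S: "is_biproduct K X Y S i j p q"
  shows "(j, p, Zro K X (SO Y)) \<in> Dist K"
proof -
  note [simp] = biproductD[OF S]
  obtain c d where T: "(j, c, d) \<in> Dist K" using TR1_cone[of j] by auto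
  note t = DistD[OF T, simplified]
  note [simp] = t(1,2,3) t(5,6) t(4)[symmetric]
  have d0: "d = Zro K (Dom K d) (SO Y)"
  proof -
    have "SA q \<cdot> (SA j \<cdot> d) = SA q \<cdot> Zro K (Dom K d) (SO S)"
      using Dist_comp_zero3[OF T] by simp
    moreover have "SA q \<cdot> SA j = Idt K (SO Y)" by (simp flip: Susp.AMap_Comp)
    ultimately show ?thesis by (simp add: Comp_reduce)
  qed
  have cj: "c \<cdot> j = Zro K Y (Dom K d)" using Dist_comp_zero1[OF T] by simp
  obtain x where x: "x \<in> Arr K" "Dom K x = Dom K d" "Cod K x = X" "x \<cdot> c = p"
    using Dist_coexact2[OF T, of p] by auto
  note [simp] = x
  have "c \<cdot> (i \<cdot> p \<boxplus> j \<cdot> q) = c \<cdot> (i \<cdot> p)"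
    by (simp add: Comp_reduce[OF cj] del: biproductD(20)[OF S])
  then have cip: "c \<cdot> (i \<cdot> p) = c" by simp
  define u where "u = c \<cdot> (i \<cdot> x) \<boxplus> Neg K (Idt K (Dom K d))"
  have u[simp]: "u \<in> Arr K" "Dom K u = Dom K d" "Cod K u = Dom K d" by (simp_all add: u_def)
  have "u \<cdot> c = Zro K S (Dom K d)" by (simp add: u_def cip)
  then have "u = Zro K (Dom K d) (Dom K d)"
    using Dist_zero_imp_epi[of j c d u] T d0 by simp
  then have cix: "c \<cdot> (i \<cdot> x) = Idt K (Dom K d)"
    unfolding u_def by (rule Sub_eq_Zro[rotated 4]) simp_all
  have xci: "x \<cdot> (c \<cdot> i) = Idt K X" by (simp add: Comp_reduce[OF x(4)])
  have "is_iso K x" by (rule is_isoI[of x "c \<cdot> i"]) (use cix xci in simp_all)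
  moreover have "tri_mor K (j, c, d) (j, p, Zro K X (SO Y)) (Idt K Y) (Idt K S) x"
    using d0 by (simp add: triangles_def)
  ultimately have "tri_isomorphic K (j, c, d) (j, p, Zro K X (SO Y))"
    unfolding tri_isomorphic_def by (metis biproductD(2,3)[OF S] is_iso_Idt)
  then show ?thesis using T TR1_iso by blast
qed

text \<open>The octahedral axiom with the types of its two new arrows. They follow from the
  equations: comparing domains in \<open>g'' v = \<Sigma>f h''\<close> gives that of
  \<open>v\<close>, and in \<open>h'' u = f''\<close> that of \<open>u\<close>.\<close>

lemma octahedron:
  assumes 1: "(f, f', f'') \<in> Dist K" and 2: "(g, g', g'') \<in> Dist K" and fg: "Cod K f = Dom K g"
    and 3: "(g \<cdot> f, h', h'') \<in> Dist K"
  obtains u v where "(u, v, SA f' \<cdot> g'') \<in> Dist K" "u \<cdot> f' = h' \<cdot> g" "h'' \<cdot> u = f''"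
    "v \<cdot> h' = g'" "g'' \<cdot> v = SA f \<cdot> h''" "u \<in> Arr K" "v \<in> Arr K"
    "Dom K u = Dom K f''" "Cod K u = Dom K h''" "Dom K v = Dom K h''" "Cod K v = Dom K g''"
proof -
  obtain u v where uv: "(u, v, SA f' \<cdot> g'') \<in> Dist K" "u \<cdot> f' = h' \<cdot> g" "h'' \<cdot> u = f''"
    "v \<cdot> h' = g'" "g'' \<cdot> v = SA f \<cdot> h''"
    using TR4[OF 1 2 fg 3] by blast
  note [simp] = DistD[OF 1] DistD(1-3)[OF 2]
  have [simp]: "Cod K g = Dom K g'" "Cod K g' = Dom K g''" "Cod K g'' = SO (Dom K g)"
    using DistD[OF 2] by auto
  have [simp]: "Dom K g = Dom K f'" using fg by simp
  note t = DistD[OF 3, simplified]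
  note [simp] = t(2,3,5,6)
  note U = DistD[OF uv(1)]
  note [simp] = U(1,2,4)
  have [simp]: "Cod K v = Dom K g''" using U(5) by simp
  have "Dom K (g'' \<cdot> v) = Dom K v" "Dom K (SA f \<cdot> h'') = Dom K h''" by simp_all
  then have [simp]: "Dom K v = Dom K h''" using uv(5) by simp
  have "Dom K (h'' \<cdot> u) = Dom K u" by simp
  then have "Dom K u = Dom K f''" using uv(3) by simp
  with uv that[of u v] show ?thesis by simp
qed

text \<open>The arrow \<open>g\<close> opposite to \<open>i\<close> in a homotopy pushout has the
  same cone as \<open>i\<close>. This is the octahedral axiom for \<open>X \<rightarrow> I
  \<oplus> Y \<rightarrow> I\<close>, with the split triangle on the projection. The equation
  \<open>w u = e\<close> relates the connecting arrow of the pushout to the one of the given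
  triangle.\<close>

lemma homotopy_pushout_cone:
  assumes T: "(i, v, w) \<in> Dist K" and f: "f \<in> Arr K" "Dom K f = Dom K i"
    and S: "is_biproduct K (Cod K i) (Cod K f) S i' j' p q"
    and k: "k \<in> Arr K" "Dom K k = Cod K i" and g: "g \<in> Arr K" "Dom K g = Cod K f" "Cod K g = Cod K k"
    and P: "(i' \<cdot> i \<boxplus> Neg K (j' \<cdot> f), k \<cdot> p \<boxplus> g \<cdot> q, e) \<in> Dist K"
  obtains u where "u \<in> Arr K" "Dom K u = Cod K k" "Cod K u = Dom K w" "u \<cdot> k = v"
    "u \<cdot> g = Zro K (Cod K f) (Dom K w)" "w \<cdot> u = e" "(g, u, SA f \<cdot> w) \<in> Dist K"
proof -
  note [simp] = DistD[OF T]
  note [simp] = biproductD[OF S, simplified] f k[simplified] g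
  note e[simp] = DistD(3,5,6)[OF P, simplified]
  have "(p, Zro K (Cod K i) (SO (Cod K f)), Neg K (SA j')) \<in> Dist K"
    using Dist_rotate[OF Dist_biproduct[OF S]] .
  note T2 = this[simplified]
  have "(p \<cdot> (i' \<cdot> i \<boxplus> Neg K (j' \<cdot> f)), v, w) \<in> Dist K" using T by simp
  note T3 = this
  obtain u x where
    ux: "(u, x, SA (k \<cdot> p \<boxplus> g \<cdot> q) \<cdot> Neg K (SA j')) \<in> Dist K"
    "u \<cdot> (k \<cdot> p \<boxplus> g \<cdot> q) = v \<cdot> p" "w \<cdot> u = e"
    "Neg K (SA j') \<cdot> x = SA (i' \<cdot> i \<boxplus> Neg K (j' \<cdot> f)) \<cdot> w"
    and uxt: "u \<in> Arr K" "x \<in> Arr K" "Dom K u = Dom K e" "Cod K u = Dom K w" "Dom K x = Dom K w"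
      "Cod K x = Dom K (Neg K (SA j'))"
    by (rule octahedron[OF P T2 _ T3]) (simp only: biproductD[OF S], simp, blast)
  note [simp] = uxt[simplified]
  \<comment> \<open>The third arrow of the octahedral triangle is \<open>-\<Sigma>g\<close>, so that the triangle can be rotated back.\<close>
  have third: "SA (k \<cdot> p \<boxplus> g \<cdot> q) \<cdot> Neg K (SA j') = Neg K (SA g)"
  proof -
    have "SA (k \<cdot> p \<boxplus> g \<cdot> q) \<cdot> SA j' = SA ((k \<cdot> p \<boxplus> g \<cdot> q) \<cdot> j')"
      by (rule Susp.AMap_Comp[symmetric]) simp_all
    also have "(k \<cdot> p \<boxplus> g \<cdot> q) \<cdot> j' = g" by simp
    finally show ?thesis by (simp del: Susp.AMap_Comp Susp.AMap_Add)
  qed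
  note U = ux(1)[unfolded third]
  have uk: "u \<cdot> k = v"
  proof -
    have "u \<cdot> k = (u \<cdot> (k \<cdot> p \<boxplus> g \<cdot> q)) \<cdot> i'" by simp
    also have "\<dots> = v" unfolding ux(2) by simp
    finally show ?thesis .
  qed
  have ug: "u \<cdot> g = Zro K (Cod K f) (Dom K w)"
  proof -
    have "u \<cdot> g = (u \<cdot> (k \<cdot> p \<boxplus> g \<cdot> q)) \<cdot> j'" by simp
    also have "\<dots> = Zro K (Cod K f) (Dom K w)" unfolding ux(2) by simp
    finally show ?thesis .
  qed
  have x: "x = SA f \<cdot> w"
  proof -
    have ii: "SA q \<cdot> SA i' = Zro K (SO (Cod K i)) (SO (Cod K f))" "SA q \<cdot> SA j' = Idt K (SO (Cod K f))"
      by (simp_all flip: Susp.AMap_Comp)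
    have "SA q \<cdot> (Neg K (SA j') \<cdot> x) = SA q \<cdot> (SA (i' \<cdot> i \<boxplus> Neg K (j' \<cdot> f)) \<cdot> w)"
      by (simp only: ux(4))
    then show ?thesis by (simp add: Comp_reduce[OF ii(1)] Comp_reduce[OF ii(2)] Neg_eq_iff)
  qed
  have "(g, u, x) \<in> Dist K" by (rule Dist_unrotate[OF U]) simp_all
  then show ?thesis using that[of u] uk ug ux(3) x by simp
qed

text \<open>By the five lemma the comparison is invertible. Retracts and direct sums of
  distinguished triangles are recognised in this way.\<close>

lemma Dist_of_hom_exact:
  assumes E: "hom_exact K (f, g, h)" and T: "(f, g', h') \<in> Dist K"
    and c: "tri_mor K (f, g, h) (f, g', h') (Idt K (Dom K f)) (Idt K (Dom K g)) c"
  shows "(f, g, h) \<in> Dist K"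
proof -
  note [simp] = trianglesD[OF hom_exactD(1)[OF E]]
  have "is_iso K c" by (rule five_lemma[OF E Dist_hom_exact[OF T] c]) simp_all
  then have "tri_isomorphic K (f, g, h) (f, g', h')"
    unfolding tri_isomorphic_def using c
    by (metis trianglesD(1,2)[OF hom_exactD(1)[OF E]] Dom_Obj is_iso_Idt)
  then show ?thesis using T TR1_iso tri_isomorphic_sym by blast
qed

end

text \<open>From here on morphisms of triangles are built and taken apart by rules; unfolded,
  their three equations would be used as rewrite rules.\<close>

declare tri_mor.simps [simp del]

section \<open>Retracts and direct sums of triangles\<close>

context suspended_category
begin

lemma tri_morI:
  assumes "f \<in> Arr C" "g \<in> Arr C" "h \<in> Arr C" "Cod C f = Dom C g" "Cod C g = Dom C h"
    "Cod C h = SO (Dom C f)"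
    "f' \<in> Arr C" "g' \<in> Arr C" "h' \<in> Arr C" "Cod C f' = Dom C g'" "Cod C g' = Dom C h'"
    "Cod C h' = SO (Dom C f')"
    "a \<in> Arr C" "Dom C a = Dom C f" "Cod C a = Dom C f'"
    "b \<in> Arr C" "Dom C b = Dom C g" "Cod C b = Dom C g'"
    "c \<in> Arr C" "Dom C c = Dom C h" "Cod C c = Dom C h'"
    "b \<cdot> f = f' \<cdot> a" "c \<cdot> g = g' \<cdot> b" "SA a \<cdot> h = h' \<cdot> c"
  shows "tri_mor C (f, g, h) (f', g', h') a b c"
  using assms by (simp add: tri_mor.simps triangles_def)

lemma tri_isomorphic_rotate:
  assumes "tri_isomorphic C (f, g, h) (f', g', h')"
  shows "tri_isomorphic C (g, h, Neg C (SA f)) (g', h', Neg C (SA f'))"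
proof -
  obtain a b c where m: "tri_mor C (f, g, h) (f', g', h') a b c" and i: "is_iso C a" "is_iso C b" "is_iso C c"
    using assms unfolding tri_isomorphic_def by blast
  note M = tri_morD[OF m]
  note [simp] = trianglesD[OF M(1)] trianglesD[OF M(2)] M(3-11)
  have "SA b \<cdot> SA f = SA f' \<cdot> SA a" using M(12) by (simp flip: Susp.AMap_Comp)
  then have "tri_mor C (g, h, Neg C (SA f)) (g', h', Neg C (SA f')) b c (SA a)"
    by - (rule tri_morI, simp_all add: M(13,14))
  then show ?thesis by (rule tri_isomorphicI) (use i in simp_all)
qed

text \<open>A fill-in is conjugated by the two isomorphisms.\<close>

lemma fill_transport:
  assumes I: "tri_isomorphic C (f, g, h) (f0, g0, h0)" and J: "tri_isomorphic C (f', g', h') (f1, g1, h1)"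
    and fill: "\<And>a b. \<lbrakk>a \<in> Hom C (Dom C f0) (Dom C f1); b \<in> Hom C (Dom C g0) (Dom C g1);
      b \<cdot> f0 = f1 \<cdot> a\<rbrakk> \<Longrightarrow> \<exists>c. tri_mor C (f0, g0, h0) (f1, g1, h1) a b c"
    and a: "a \<in> Hom C (Dom C f) (Dom C f')" and b: "b \<in> Hom C (Dom C g) (Dom C g')"
    and ab: "b \<cdot> f = f' \<cdot> a"
  shows "\<exists>c. tri_mor C (f, g, h) (f', g', h') a b c"
proof -
  obtain a1 b1 c1 a1' b1' c1' where m: "tri_mor C (f, g, h) (f0, g0, h0) a1 b1 c1"
    and m': "tri_mor C (f0, g0, h0) (f, g, h) a1' b1' c1'"
    and inv: "a1' \<cdot> a1 = Idt C (Dom C f)" "b1' \<cdot> b1 = Idt C (Dom C g)"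
    using tri_isomorphicE[OF I] by metis
  obtain a2 b2 c2 a2' b2' c2' where n: "tri_mor C (f', g', h') (f1, g1, h1) a2 b2 c2"
    and n': "tri_mor C (f1, g1, h1) (f', g', h') a2' b2' c2'"
    and inv2: "a2' \<cdot> a2 = Idt C (Dom C f')" "b2' \<cdot> b2 = Idt C (Dom C g')"
    using tri_isomorphicE[OF J] by metis
  note M = tri_morD[OF m] and M' = tri_morD[OF m'] and N = tri_morD[OF n] and N' = tri_morD[OF n']
  note [simp] = trianglesD[OF M(1)] trianglesD[OF M(2)] trianglesD[OF N(1)] trianglesD[OF N(2)]
    M(3-11) M'(3-11) N(3-11) N'(3-11)
  have [simp]: "a \<in> Arr C" "Dom C a = Dom C f" "Cod C a = Dom C f'"
    "b \<in> Arr C" "Dom C b = Dom C g" "Cod C b = Dom C g'" using a b by simp_all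
  have "(b2 \<cdot> (b \<cdot> b1')) \<cdot> f0 = f1 \<cdot> (a2 \<cdot> (a \<cdot> a1'))"
    by (simp add: M'(12) Comp_reduce[OF ab] Comp_reduce[OF N(12)])
  then obtain c where c: "tri_mor C (f0, g0, h0) (f1, g1, h1) (a2 \<cdot> (a \<cdot> a1')) (b2 \<cdot> (b \<cdot> b1')) c"
    using fill[of "a2 \<cdot> (a \<cdot> a1')" "b2 \<cdot> (b \<cdot> b1')"] by auto
  have "tri_mor C (f, g, h) (f', g', h') (a2' \<cdot> ((a2 \<cdot> (a \<cdot> a1')) \<cdot> a1))
     (b2' \<cdot> ((b2 \<cdot> (b \<cdot> b1')) \<cdot> b1)) (c2' \<cdot> (c \<cdot> c1))"
    by (rule tri_mor_comp[OF tri_mor_comp[OF m c] n'])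
  moreover have "a2' \<cdot> ((a2 \<cdot> (a \<cdot> a1')) \<cdot> a1) = a" "b2' \<cdot> ((b2 \<cdot> (b \<cdot> b1')) \<cdot> b1) = b"
    by (simp_all add: inv Comp_reduce[OF inv2(1)] Comp_reduce[OF inv2(2)])
  ultimately show ?thesis by metis
qed

lemma hom_exact_iff:
  assumes t: "(f, g, h) \<in> triangles C"
  shows "hom_exact C (f, g, h) \<longleftrightarrow> exact_at f g \<and> exact_at g h \<and> exact_at h (SA f)"
  unfolding hom_exact_def exact_at_def prod.case using t trianglesD[OF t] by auto

lemma hom_exact_retract:
  assumes E: "hom_exact C (f, g, h)" and R: "tri_retract C (f', g', h') (f, g, h)"
  shows "hom_exact C (f', g', h')"
proof -
  obtain a b c a' b' c' where m: "tri_mor C (f', g', h') (f, g, h) a b c"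
    and m': "tri_mor C (f, g, h) (f', g', h') a' b' c'"
    and r: "a' \<cdot> a = Idt C (Dom C f')" "b' \<cdot> b = Idt C (Dom C g')" "c' \<cdot> c = Idt C (Dom C h')"
    using R by auto
  note M = tri_morD[OF m] and M' = tri_morD[OF m']
  note [simp] = trianglesD[OF M(1)] trianglesD[OF M(2)] M(3-11) M'(3-11)
  have ra: "SA a' \<cdot> SA a = Idt C (SO (Dom C f'))" "SA b' \<cdot> SA b = Idt C (SO (Dom C g'))"
    using r(1,2) Susp.AMap_Comp[of a a'] Susp.AMap_Comp[of b b'] by simp_all
  have sf: "SA b \<cdot> SA f' = SA f \<cdot> SA a"
    using M(12) by (simp flip: Susp.AMap_Comp)
  have e: "exact_at f g" "exact_at g h" "exact_at h (SA f)"
    using E hom_exact_iff[OF M(2)] by blast+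
  have 1: "exact_at f' g'"
    by (rule exact_at_retract[OF e(1), of f' g' a a' b b' c c'])
      (simp_all add: r M(12,13) M'(12))
  have 2: "exact_at g' h'"
    by (rule exact_at_retract[OF e(2), of g' h' b b' c c' "SA a" "SA a'"])
      (simp_all add: r ra M(13,14) M'(13))
  have 3: "exact_at h' (SA f')"
    by (rule exact_at_retract[OF e(3), of h' "SA f'" c c' "SA a" "SA a'" "SA b" "SA b'"])
      (simp_all add: r ra sf M(14) M'(14))
  show ?thesis using 1 2 3 hom_exact_iff[OF M(1)] by blast
qed

lemma hom_exact_iso:
  assumes E: "hom_exact C (f', g', h')" and I: "tri_isomorphic C (f, g, h) (f', g', h')"
  shows "hom_exact C (f, g, h)"
proof -
  obtain a b c a' b' c' where "tri_mor C (f, g, h) (f', g', h') a b c" "tri_mor C (f', g', h') (f, g, h) a' b' c'"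
    "a' \<cdot> a = Idt C (Dom C f)" "b' \<cdot> b = Idt C (Dom C g)" "c' \<cdot> c = Idt C (Dom C h)"
    using tri_isomorphicE[OF I] by metis
  then have "tri_retract C (f, g, h) (f', g', h')" unfolding tri_retract.simps by blast
  then show ?thesis by (rule hom_exact_retract[OF E])
qed

lemma hom_exact_sum:
  assumes E1: "hom_exact C (f1, g1, h1)" and E2: "hom_exact C (f2, g2, h2)"
    and mi: "tri_mor C (f1, g1, h1) (f, g, h) i1 i2 i3" and mj: "tri_mor C (f2, g2, h2) (f, g, h) j1 j2 j3"
    and mp: "tri_mor C (f, g, h) (f1, g1, h1) p1 p2 p3" and mq: "tri_mor C (f, g, h) (f2, g2, h2) q1 q2 q3"
    and A: "is_biproduct C (Dom C f1) (Dom C f2) (Dom C f) i1 j1 p1 q1"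
    and B: "is_biproduct C (Dom C g1) (Dom C g2) (Dom C g) i2 j2 p2 q2"
    and D: "is_biproduct C (Dom C h1) (Dom C h2) (Dom C h) i3 j3 p3 q3"
  shows "hom_exact C (f, g, h)"
proof -
  note I = tri_morD[OF mi] and J = tri_morD[OF mj] and P = tri_morD[OF mp] and Q = tri_morD[OF mq]
  note [simp] = trianglesD[OF I(1)] trianglesD[OF I(2)] trianglesD[OF J(1)]
    I(3-11) J(3-11) P(3-11) Q(3-11)
  have SA: "is_biproduct C (SO (Dom C f1)) (SO (Dom C f2)) (SO (Dom C f)) (SA i1) (SA j1) (SA p1) (SA q1)"
    "is_biproduct C (SO (Dom C g1)) (SO (Dom C g2)) (SO (Dom C g)) (SA i2) (SA j2) (SA p2) (SA q2)"
    using A B by (simp_all add: Susp.biproduct_OMap)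
  have s: "SA i2 \<cdot> SA f1 = SA f \<cdot> SA i1" "SA j2 \<cdot> SA f2 = SA f \<cdot> SA j1"
    "SA p2 \<cdot> SA f = SA f1 \<cdot> SA p1" "SA q2 \<cdot> SA f = SA f2 \<cdot> SA q1"
    using I(12) J(12) P(12) Q(12) by (simp_all flip: Susp.AMap_Comp)
  have e: "exact_at f1 g1" "exact_at g1 h1" "exact_at h1 (SA f1)"
    "exact_at f2 g2" "exact_at g2 h2" "exact_at h2 (SA f2)"
    using E1 E2 hom_exact_iff[OF I(1)] hom_exact_iff[OF J(1)] by blast+
  have 1: "exact_at f g"
    by (rule exact_at_sum[OF e(1,4), of f g i1 j1 p1 q1 i2 j2 p2 q2 i3 j3 p3 q3])
      (use A B D I(12) J(12) P(12,13) Q(12,13) in simp_all)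
  have 2: "exact_at g h"
    by (rule exact_at_sum[OF e(2,5), of g h i2 j2 p2 q2 i3 j3 p3 q3 "SA i1" "SA j1" "SA p1" "SA q1"])
      (use B D SA(1) I(13) J(13) P(13,14) Q(13,14) in simp_all)
  have 3: "exact_at h (SA f)"
    by (rule exact_at_sum[OF e(3,6), of h "SA f" i3 j3 p3 q3 "SA i1" "SA j1" "SA p1" "SA q1"
          "SA i2" "SA j2" "SA p2" "SA q2"])
      (use D SA I(14) J(14) P(14) Q(14) s in simp_all)
  show ?thesis using 1 2 3 hom_exact_iff[OF I(2)] by blast
qed

end

context triangulated_category
begin

lemma Dist_retract:
  assumes T: "T \<in> Dist K" and R: "tri_retract K T' T"
  shows "T' \<in> Dist K"
proof -
  obtain f g h f' g' h' where e: "T = (f, g, h)" "T' = (f', g', h')" by (metis prod_cases3)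
  note T = T[unfolded e] and R = R[unfolded e]
  obtain a b c a' b' c' where m: "tri_mor K (f', g', h') (f, g, h) a b c"
    and m': "tri_mor K (f, g, h) (f', g', h') a' b' c'"
    and r: "a' \<cdot> a = Idt K (Dom K f')" "b' \<cdot> b = Idt K (Dom K g')"
    using R by auto
  note M = tri_morD[OF m] and M' = tri_morD[OF m']
  obtain g1 h1 where T1: "(f', g1, h1) \<in> Dist K" using TR1_cone trianglesD(1)[OF M(1)] by blast
  have d: "Dom K g1 = Dom K g'" using DistD(4)[OF T1] trianglesD(4)[OF M(1)] by simp
  obtain c1 where c1: "tri_mor K (f, g, h) (f', g1, h1) a' b' c1"
    using TR3[OF T T1, of a' b'] M'(3-8,12) d by auto
  have "tri_mor K (f', g', h') (f', g1, h1) (Idt K (Dom K f')) (Idt K (Dom K g')) (c1 \<cdot> c)"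
    using tri_mor_comp[OF m c1] unfolding r .
  then show ?thesis unfolding e
    by (rule Dist_of_hom_exact[OF hom_exact_retract[OF Dist_hom_exact[OF T] R] T1])
qed

lemma Dist_sum:
  assumes T1: "(f1, g1, h1) \<in> Dist K" and T2: "(f2, g2, h2) \<in> Dist K"
    and mi: "tri_mor K (f1, g1, h1) (f, g, h) i1 i2 i3" and mj: "tri_mor K (f2, g2, h2) (f, g, h) j1 j2 j3"
    and mp: "tri_mor K (f, g, h) (f1, g1, h1) p1 p2 p3" and mq: "tri_mor K (f, g, h) (f2, g2, h2) q1 q2 q3"
    and A: "is_biproduct K (Dom K f1) (Dom K f2) (Dom K f) i1 j1 p1 q1"
    and B: "is_biproduct K (Dom K g1) (Dom K g2) (Dom K g) i2 j2 p2 q2"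
    and D: "is_biproduct K (Dom K h1) (Dom K h2) (Dom K h) i3 j3 p3 q3"
  shows "(f, g, h) \<in> Dist K"
proof -
  note I = tri_morD[OF mi] and J = tri_morD[OF mj] and P = tri_morD[OF mp] and Q = tri_morD[OF mq]
  note [simp] = trianglesD[OF I(1)] trianglesD[OF I(2)] trianglesD[OF J(1)]
    I(3-11) J(3-11) P(3-11) Q(3-11)
  obtain g' h' where T': "(f, g', h') \<in> Dist K" using TR1_cone[of f] by auto
  note t' = DistD[OF T']
  have [simp]: "Dom K g' = Dom K g" using t'(4) by simp
  note [simp] = t'(2,3,5,6)
  obtain c1 where m1: "tri_mor K (f1, g1, h1) (f, g', h') i1 i2 c1"
    using TR3[OF T1 T', of i1 i2] I(12) by auto
  obtain c2 where m2: "tri_mor K (f2, g2, h2) (f, g', h') j1 j2 c2"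
    using TR3[OF T2 T', of j1 j2] J(12) by auto
  note C1 = tri_morD(9-14)[OF m1] and C2 = tri_morD(9-14)[OF m2]
  note [simp] = C1(1-3) C2(1-3)
  define c where "c = c1 \<cdot> p3 \<boxplus> c2 \<cdot> q3"
  have [simp]: "c \<in> Arr K" "Dom K c = Dom K h" "Cod K c = Dom K h'" by (simp_all add: c_def)
  have "c \<cdot> g = g' \<cdot> (i2 \<cdot> p2) \<boxplus> g' \<cdot> (j2 \<cdot> q2)"
    by (simp add: c_def P(13) Q(13) Comp_reduce[OF C1(5)] Comp_reduce[OF C2(5)])
  also have "\<dots> = g' \<cdot> (i2 \<cdot> p2 \<boxplus> j2 \<cdot> q2)" by simp
  also have "\<dots> = g'" by (simp add: biproductD(20)[OF B])
  finally have cg: "c \<cdot> g = g'" .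
  have "h' \<cdot> c = SA i1 \<cdot> (SA p1 \<cdot> h) \<boxplus> SA j1 \<cdot> (SA q1 \<cdot> h)"
    by (simp add: c_def P(14) Q(14) Comp_reduce[OF C1(6)[symmetric]] Comp_reduce[OF C2(6)[symmetric]])
  also have "\<dots> = h"
    by (rule biproduct_in[OF Susp.biproduct_OMap[OF A], symmetric]) simp_all
  finally have hc: "h' \<cdot> c = h" .
  have "tri_mor K (f, g, h) (f, g', h') (Idt K (Dom K f)) (Idt K (Dom K g)) c"
    by (rule tri_morI) (simp_all add: cg hc)
  then show ?thesis
    by (rule Dist_of_hom_exact[OF hom_exact_sum[OF Dist_hom_exact[OF T1] Dist_hom_exact[OF T2]
        mi mj mp mq A B D] T'])
qed

text \<open>The vanishing third arrow gives a section \<open>s\<close> of \<open>g\<close>, and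
  \<open>1 - s g\<close> factors through the monic arrow \<open>f\<close>, which yields the
  retraction.\<close>

lemma Dist_split:
  assumes T: "(f, g, h) \<in> Dist K" and h: "h = Zro K (Dom K h) (SO (Dom K f))"
  shows "direct_sum K (Dom K h) (Dom K f) (Dom K g)" "direct_sum K (Dom K f) (Dom K h) (Dom K g)"
proof -
  note [simp] = DistD[OF T]
  have "h \<cdot> Idt K (Dom K h) = Zro K (Dom K (Idt K (Dom K h))) (SO (Dom K f))" using h by simp
  then obtain s where s: "s \<in> Arr K" "Dom K s = Dom K h" "Cod K s = Dom K g" "g \<cdot> s = Idt K (Dom K h)"
    using Dist_exact2[OF T, of "Idt K (Dom K h)"] by auto
  note [simp] = s
  have "g \<cdot> (Idt K (Dom K g) \<boxplus> Neg K (s \<cdot> g)) =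
      Zro K (Dom K (Idt K (Dom K g) \<boxplus> Neg K (s \<cdot> g))) (Dom K h)"
    by (simp add: Comp_reduce[OF s(4)])
  then obtain r where r: "r \<in> Arr K" "Dom K r = Dom K g" "Cod K r = Dom K f"
    "f \<cdot> r = Idt K (Dom K g) \<boxplus> Neg K (s \<cdot> g)"
    using Dist_exact1[OF T, of "Idt K (Dom K g) \<boxplus> Neg K (s \<cdot> g)"] by auto
  note [simp] = r(1-3)
  have mono: "u = Zro K (Dom K u) (Dom K f)"
    if "u \<in> Arr K" "Cod K u = Dom K f" "f \<cdot> u = Zro K (Dom K u) (Dom K g)" for u
    using Dist_zero_imp_mono[OF T h that] .
  have gf: "g \<cdot> f = Zro K (Dom K f) (Dom K h)" using Dist_comp_zero1[OF T] .
  have "r \<cdot> f \<boxplus> Neg K (Idt K (Dom K f)) = Zro K (Dom K f) (Dom K f)"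
    using mono[of "r \<cdot> f \<boxplus> Neg K (Idt K (Dom K f))"] by (simp add: Comp_reduce[OF r(4)] gf)
  then have rf: "r \<cdot> f = Idt K (Dom K f)" by (rule Sub_eq_Zro[rotated 4]) simp_all
  have rs: "r \<cdot> s = Zro K (Dom K h) (Dom K f)"
    using mono[of "r \<cdot> s"] by (simp add: Comp_reduce[OF r(4)])
  have "is_biproduct K (Dom K h) (Dom K f) (Dom K g) s f g r"
    unfolding is_biproduct_def by (simp add: rf rs gf r(4) Add_left_comm[of "s \<cdot> g"])
  then show "direct_sum K (Dom K h) (Dom K f) (Dom K g)" "direct_sum K (Dom K f) (Dom K h) (Dom K g)"
    using biproduct_swap unfolding direct_sum_def by blast+
qed

end

section \<open>A criterion for triangulated categories\<close>

text \<open>Here rotation is assumed in one direction only, and the octahedral axiom only for one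
  representative \<open>(F, G)\<close>, up to isomorphisms \<open>b\<close> and \<open>c\<close>,
  of a composable pair, with triangles of one's choice. Exactness of the Hom sequences makes up
  for both.\<close>

locale triangulation_criterion = suspended_category C for C :: "('o, 'm, 'x) tricat_scheme" (structure) +
  assumes Susp_equiv: "is_equivalence C C (Susp C)"
    and Dist_subset: "Dist C \<subseteq> triangles C"
    and Dist_iso: "\<lbrakk>T \<in> Dist C; tri_isomorphic C T T'\<rbrakk> \<Longrightarrow> T' \<in> Dist C"
    and Dist_id: "\<lbrakk>X \<in> Obj C; zero_object C Z\<rbrakk>
      \<Longrightarrow> (Idt C X, Zro C X Z, Zro C Z (SO X)) \<in> Dist C"
    and Dist_cone: "f \<in> Arr C \<Longrightarrow> \<exists>g h. (f, g, h) \<in> Dist C"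
    and Dist_rot: "(f, g, h) \<in> Dist C \<Longrightarrow> (g, h, Neg C (SA f)) \<in> Dist C"
    and Dist_fill: "\<lbrakk>(f, g, h) \<in> Dist C; (f', g', h') \<in> Dist C;
        a \<in> Hom C (Dom C f) (Dom C f'); b \<in> Hom C (Dom C g) (Dom C g'); b \<cdot> f = f' \<cdot> a\<rbrakk>
      \<Longrightarrow> \<exists>c. tri_mor C (f, g, h) (f', g', h') a b c"
    and Dist_exact: "T \<in> Dist C \<Longrightarrow> hom_exact C T"
    and Dist_octahedron: "\<lbrakk>f \<in> Arr C; g \<in> Arr C; Cod C f = Dom C g\<rbrakk>
      \<Longrightarrow> \<exists>b c F F' F'' G G' G'' H' H'' u v. is_iso C b \<and> is_iso C c \<and> Dom C b = Cod C f \<and>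
            Dom C c = Cod C g \<and> F = b \<cdot> f \<and> G \<in> Arr C \<and> Dom C G = Cod C b \<and> Cod C G = Cod C c \<and>
            G \<cdot> b = c \<cdot> g \<and> (F, F', F'') \<in> Dist C \<and> (G, G', G'') \<in> Dist C \<and>
            (G \<cdot> F, H', H'') \<in> Dist C \<and> (u, v, SA F' \<cdot> G'') \<in> Dist C \<and>
            u \<in> Hom C (Dom C F'') (Dom C H'') \<and> v \<in> Hom C (Dom C H'') (Dom C G'') \<and>
            u \<cdot> F' = H' \<cdot> G \<and> H'' \<cdot> u = F'' \<and> v \<cdot> H' = G' \<and> G'' \<cdot> v = SA F \<cdot> H''"
begin

lemma Dist_typing:
  assumes "(f, g, h) \<in> Dist C"
  shows "f \<in> Arr C" "g \<in> Arr C" "h \<in> Arr C" "Cod C f = Dom C g" "Cod C g = Dom C h"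
    "Cod C h = SO (Dom C f)"
  using trianglesD[of f g h C] assms Dist_subset by blast+

lemma Dist_fill_iso:
  assumes T: "(f, g, h) \<in> Dist C" and T': "(f', g', h') \<in> Dist C"
    and a: "is_iso C a" "Dom C a = Dom C f" "Cod C a = Dom C f'"
    and b: "is_iso C b" "Dom C b = Dom C g" "Cod C b = Dom C g'" and ab: "b \<cdot> f = f' \<cdot> a"
  obtains c where "tri_mor C (f, g, h) (f', g', h') a b c" "is_iso C c"
proof -
  have "a \<in> Hom C (Dom C f) (Dom C f')" "b \<in> Hom C (Dom C g) (Dom C g')" using a b by simp_all
  then obtain c where c: "tri_mor C (f, g, h) (f', g', h') a b c"
    using Dist_fill[OF T T' _ _ ab] by blast
  have "is_iso C c" by (rule five_lemma[OF Dist_exact[OF T] Dist_exact[OF T'] c a(1) b(1)])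
  with c that show ?thesis by blast
qed

lemma susp_faithful:
  "\<lbrakk>f \<in> Arr C; g \<in> Arr C; Dom C f = Dom C g; Cod C f = Cod C g; SA f = SA g\<rbrakk> \<Longrightarrow> f = g"
  by (rule is_equivalenceD(1)[OF Susp_equiv])

lemma susp_iso:
  assumes u: "is_iso C u" "Dom C u = SO X" "Cod C u = SO Y" and X: "X \<in> Obj C" "Y \<in> Obj C"
  obtains f where "is_iso C f" "Dom C f = X" "Cod C f = Y" "SA f = u"
proof -
  obtain u' where u': "u' \<in> Arr C" "Dom C u' = SO Y" "Cod C u' = SO X"
    "u' \<cdot> u = Idt C (SO X)" "u \<cdot> u' = Idt C (SO Y)"
    using u by (metis is_isoE)
  obtain f where f: "f \<in> Arr C" "Dom C f = X" "Cod C f = Y" "SA f = u"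
    using is_equivalenceD(2)[OF Susp_equiv, of X Y u] u X by auto
  obtain g where g: "g \<in> Arr C" "Dom C g = Y" "Cod C g = X" "SA g = u'"
    using is_equivalenceD(2)[OF Susp_equiv, of Y X u'] u' X by auto
  have 1: "g \<cdot> f = Idt C X" by (rule susp_faithful) (use X u' g f in simp_all)
  have 2: "f \<cdot> g = Idt C Y" by (rule susp_faithful) (use X u' g f in simp_all)
  have "is_iso C f" by (rule is_isoI[of f g]) (use f g 1 2 in simp_all)
  then show ?thesis using that f by blast
qed

text \<open>The triple rotation of the given candidate is compared with that of a distinguished
  triangle on the same first arrow. The comparison is the suspension of an isomorphism between the
  two.\<close>

lemma Dist_rot_back:
  assumes T: "(g, h, Neg C (SA f)) \<in> Dist C" and t: "(f, g, h) \<in> triangles C"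
  shows "(f, g, h) \<in> Dist C"
proof -
  note [simp] = trianglesD[OF t]
  obtain g1 h1 where T1: "(f, g1, h1) \<in> Dist C" using Dist_cone by force
  note t1 = Dist_typing[OF T1]
  note [simp] = t1(2,3) t1(4)[symmetric] t1(5,6)
  have R: "(Neg C (SA f), Neg C (SA g), Neg C (SA h)) \<in> Dist C"
    using Dist_rot[OF Dist_rot[OF T]] .
  have R1: "(Neg C (SA f), Neg C (SA g1), Neg C (SA h1)) \<in> Dist C"
    using Dist_rot[OF Dist_rot[OF Dist_rot[OF T1]]] .
  obtain c where m: "tri_mor C (Neg C (SA f), Neg C (SA g), Neg C (SA h))
      (Neg C (SA f), Neg C (SA g1), Neg C (SA h1)) (Idt C (SO (Dom C f))) (Idt C (SO (Dom C g))) c"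
    and c: "is_iso C c"
    by (rule Dist_fill_iso[OF R R1, of "Idt C (SO (Dom C f))" "Idt C (SO (Dom C g))"]) simp_all
  note M = tri_morD[OF m]
  have cd: "Dom C c = SO (Dom C h)" "Cod C c = SO (Dom C h1)" using M by simp_all
  obtain d where d: "is_iso C d" "Dom C d = Dom C h" "Cod C d = Dom C h1" "SA d = c"
    using susp_iso[OF c cd] by auto
  note [simp] = d(1-3)
  have 1: "d \<cdot> g = g1"
    by (rule susp_faithful) (use M(13) d(4) cd c in \<open>simp_all add: Neg_eq_iff\<close>)
  have 2: "h = h1 \<cdot> d"
    by (rule susp_faithful) (use M(14) d(4) cd c in \<open>simp_all add: Neg_eq_iff\<close>)
  have "tri_mor C (f, g, h) (f, g1, h1) (Idt C (Dom C f)) (Idt C (Dom C g)) d"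
    using t T1 Dist_subset 1 2[symmetric] by (auto simp: tri_mor.simps)
  then have "tri_isomorphic C (f, g, h) (f, g1, h1)"
    unfolding tri_isomorphic_def using d(1) by (metis trianglesD(1,2)[OF t] Dom_Obj is_iso_Idt)
  then show ?thesis using T1 Dist_iso tri_isomorphic_sym by blast
qed

text \<open>By fill-in and the five lemma the three given triangles are isomorphic to those of the
  representative \<open>(F, G)\<close>, and its octahedron is carried over along these
  isomorphisms.\<close>

lemma Dist_TR4:
  assumes 1: "(f, f', f'') \<in> Dist C" and 2: "(g, g', g'') \<in> Dist C" and fg: "Cod C f = Dom C g"
    and 3: "(g \<cdot> f, h', h'') \<in> Dist C"
  shows "\<exists>u v. (u, v, SA f' \<cdot> g'') \<in> Dist C \<and> u \<cdot> f' = h' \<cdot> g \<and> h'' \<cdot> u = f'' \<and>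
            v \<cdot> h' = g' \<and> g'' \<cdot> v = SA f \<cdot> h''"
proof -
  note t1 = Dist_typing[OF 1] and t2 = Dist_typing[OF 2]
  obtain b c F F' F'' G G' G'' H' H'' u v where
    b: "is_iso C b" "Dom C b = Cod C f" and c: "is_iso C c" "Dom C c = Cod C g" and F: "F = b \<cdot> f"
    and G: "G \<in> Arr C" "Dom C G = Cod C b" "Cod C G = Cod C c" "G \<cdot> b = c \<cdot> g"
    and 4: "(F, F', F'') \<in> Dist C" and 5: "(G, G', G'') \<in> Dist C" and 6: "(G \<cdot> F, H', H'') \<in> Dist C"
    and uv: "(u, v, SA F' \<cdot> G'') \<in> Dist C" "u \<in> Hom C (Dom C F'') (Dom C H'')"
      "v \<in> Hom C (Dom C H'') (Dom C G'')" "u \<cdot> F' = H' \<cdot> G" "H'' \<cdot> u = F''" "v \<cdot> H' = G'"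
      "G'' \<cdot> v = SA F \<cdot> H''"
    using Dist_octahedron[OF t1(1) t2(1) fg] by metis
  have [simp]: "b \<in> Arr C" "c \<in> Arr C" using b c by simp_all
  note [simp] = t1(1-3) t1(4)[symmetric] t1(5,6) t2(1,2,3) t2(4)[symmetric] t2(5,6) fg[symmetric] b(2) c(2) G(1-3)
  have [simp]: "F \<in> Arr C" "Dom C F = Dom C f" "Cod C F = Cod C b" by (simp_all add: F)
  note t4 = Dist_typing[OF 4] and t5 = Dist_typing[OF 5]
  note [simp] = t4(2,3) t4(4)[symmetric, simplified] t4(5,6) t5(2,3) t5(4)[symmetric, simplified] t5(5,6)
  note t3 = Dist_typing[OF 3] and t6 = Dist_typing[OF 6]
  note [simp] = t3(2,3) t3(4)[symmetric, simplified] t3(5) t3(6)[simplified]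
  note [simp] = t6(2,3) t6(4)[symmetric, simplified] t6(5) t6(6)[simplified]
  note uv' = uv(2,3)[simplified]
  have uvs[simp]: "u \<in> Arr C" "Dom C u = Dom C F''" "Cod C u = Dom C H''"
    "v \<in> Arr C" "Dom C v = Dom C H''" "Cod C v = Dom C G''" using uv' by simp_all
  obtain c1 where m1: "tri_mor C (f, f', f'') (F, F', F'') (Idt C (Dom C f)) b c1" and c1: "is_iso C c1"
    by (rule Dist_fill_iso[OF 1 4, of "Idt C (Dom C f)" b]) (simp_all add: F b(1))
  obtain c2 where m2: "tri_mor C (g, g', g'') (G, G', G'') b c c2" and c2: "is_iso C c2"
    by (rule Dist_fill_iso[OF 2 5, of b c]) (simp_all add: G(4) b(1) c(1))
  have GF: "c \<cdot> (g \<cdot> f) = G \<cdot> F" unfolding F by (simp add: Comp_reduce[OF G(4)])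
  obtain c3 where m3: "tri_mor C (g \<cdot> f, h', h'') (G \<cdot> F, H', H'') (Idt C (Dom C f)) c c3"
    and c3: "is_iso C c3"
    by (rule Dist_fill_iso[OF 3 6, of "Idt C (Dom C f)" c]) (simp_all add: GF c(1))
  note M1 = tri_morD(9-14)[OF m1, simplified] and M2 = tri_morD(9-14)[OF m2, simplified]
    and M3 = tri_morD(9-14)[OF m3, simplified]
  note [simp] = M1(1-3) M2(1-3) M3(1-3)
  obtain b' where b': "b' \<in> Arr C" "Dom C b' = Cod C b" "Cod C b' = Cod C f"
    "b' \<cdot> b = Idt C (Cod C f)" "b \<cdot> b' = Idt C (Cod C b)" "is_iso C b'"
    using is_isoE[OF b(1)] b(2) by metis
  obtain d2 where d2: "d2 \<in> Arr C" "Dom C d2 = Dom C G''" "Cod C d2 = Dom C g''"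
    "d2 \<cdot> c2 = Idt C (Dom C g'')" "c2 \<cdot> d2 = Idt C (Dom C G'')" "is_iso C d2"
    using is_isoE[OF c2] M2(2,3) by metis
  obtain d3 where d3: "d3 \<in> Arr C" "Dom C d3 = Dom C H''" "Cod C d3 = Dom C h''"
    "d3 \<cdot> c3 = Idt C (Dom C h'')" "c3 \<cdot> d3 = Idt C (Dom C H'')" "is_iso C d3"
    using is_isoE[OF c3] M3(2,3) by metis
  note [simp] = b'(1-5) d2(1-5) d3(1-5)
  \<comment> \<open>The arrows of the octahedron on \<open>F\<close> and \<open>G\<close>, conjugated by the isomorphisms of triangles.\<close>
  define u1 where "u1 = d3 \<cdot> (u \<cdot> c1)"
  define v1 where "v1 = d2 \<cdot> (v \<cdot> c3)"
  have [simp]: "u1 \<in> Arr C" "Dom C u1 = Dom C f''" "Cod C u1 = Dom C h''"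
    "v1 \<in> Arr C" "Dom C v1 = Dom C h''" "Cod C v1 = Dom C g''"
    by (simp_all add: u1_def v1_def)
  have third: "SA c1 \<cdot> (SA f' \<cdot> g'') = SA F' \<cdot> (G'' \<cdot> c2)"
  proof -
    have "SA c1 \<cdot> SA f' = SA F' \<cdot> SA b" using M1(5) by (simp flip: Susp.AMap_Comp)
    from Comp_reduce[OF this] show ?thesis using M2(6) by simp
  qed
  have cu: "c3 \<cdot> u1 = u \<cdot> c1" "c2 \<cdot> v1 = v \<cdot> c3"
    by (simp_all add: u1_def v1_def Comp_reduce[OF d3(5)] Comp_reduce[OF d2(5)])
  have tt: "(u1, v1, SA f' \<cdot> g'') \<in> triangles C" by (rule trianglesI) simp_all
  have "tri_mor C (u1, v1, SA f' \<cdot> g'') (u, v, SA F' \<cdot> G'') c1 c3 c2"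
    using tt uv(1) Dist_subset cu third by (auto simp: tri_mor.simps)
  then have "tri_isomorphic C (u1, v1, SA f' \<cdot> g'') (u, v, SA F' \<cdot> G'')"
    unfolding tri_isomorphic_def using c1 c2 c3 by blast
  then have D: "(u1, v1, SA f' \<cdot> g'') \<in> Dist C"
    using uv(1) Dist_iso tri_isomorphic_sym by blast
  have e1: "u1 \<cdot> f' = h' \<cdot> g"
  proof (rule iso_cancel_left[OF c3])
    show "c3 \<cdot> (u1 \<cdot> f') = c3 \<cdot> (h' \<cdot> g)"
      by (simp add: Comp_reduce[OF cu(1)] Comp_reduce[OF M3(5)] M1(5) Comp_reduce[OF uv(4)] G(4))
  qed simp_all
  have e2: "h'' \<cdot> u1 = f''"
  proof -
    have "h'' \<cdot> u1 = H'' \<cdot> (c3 \<cdot> u1)" by (simp add: Comp_reduce[OF M3(6)[symmetric]])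
    also have "\<dots> = f''" by (simp add: cu Comp_reduce[OF uv(5)] flip: M1(6))
    finally show ?thesis .
  qed
  have e3: "v1 \<cdot> h' = g'"
  proof (rule iso_cancel_left[OF c2])
    show "c2 \<cdot> (v1 \<cdot> h') = c2 \<cdot> g'"
      by (simp add: Comp_reduce[OF cu(2)] M3(5) M2(5) Comp_reduce[OF uv(6)])
  qed simp_all
  have e4: "g'' \<cdot> v1 = SA f \<cdot> h''"
  proof (rule iso_cancel_left[OF Susp.AMap_iso[OF b(1)]])
    have "SA b \<cdot> (g'' \<cdot> v1) = G'' \<cdot> (c2 \<cdot> v1)" by (simp add: Comp_reduce[OF M2(6)])
    also have "\<dots> = SA F \<cdot> h''" by (simp add: cu Comp_reduce[OF uv(7)] flip: M3(6))
    also have "\<dots> = SA b \<cdot> (SA f \<cdot> h'')" by (simp add: F)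
    finally show "SA b \<cdot> (g'' \<cdot> v1) = SA b \<cdot> (SA f \<cdot> h'')" .
  qed simp_all
  show ?thesis using D e1 e2 e3 e4 by blast
qed

theorem triangulated: "triangulated_category C"
proof unfold_locales
  show "is_additive_functor C C (Susp C)" by (rule suspension_additive)
  show "is_equivalence C C (Susp C)" by (rule Susp_equiv)
  show "Dist C \<subseteq> triangles C" by (rule Dist_subset)
  show "\<And>f g h. (f, g, h) \<in> triangles C
      \<Longrightarrow> (f, g, h) \<in> Dist C \<longleftrightarrow> (g, h, Neg C (SA f)) \<in> Dist C"
    using Dist_rot Dist_rot_back by blast
qed (blast intro: Dist_iso Dist_id Dist_cone Dist_fill Dist_TR4)+

end

section \<open>Additive quotients\<close>

text \<open>A quotient by an additive congruence, seen from the quotient map: the structure of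
  \<open>Q\<close> is the image of that of \<open>C\<close>, so all additive axioms are
  inherited.\<close>

locale additive_image = C: additive_category C for C :: "('o, 'm, 'x) addcat_scheme" +
  fixes Q :: "('o, 'k, 'y) addcat_scheme" and p :: "'m \<Rightarrow> 'k"
  assumes Obj_im: "Obj Q = Obj C" and Arr_im: "Arr Q = p ` Arr C"
    and Dom_im [simp]: "f \<in> Arr C \<Longrightarrow> Dom Q (p f) = Dom C f"
    and Cod_im [simp]: "f \<in> Arr C \<Longrightarrow> Cod Q (p f) = Cod C f"
    and Idt_im: "X \<in> Obj C \<Longrightarrow> Idt Q X = p (Idt C X)"
    and Comp_im: "\<lbrakk>f \<in> Arr C; g \<in> Arr C; Cod C f = Dom C g\<rbrakk>
      \<Longrightarrow> p g \<cdot>\<^bsub>Q\<^esub> p f = p (g \<cdot>\<^bsub>C\<^esub> f)"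
    and Add_im: "\<lbrakk>f \<in> Arr C; g \<in> Arr C; Dom C f = Dom C g; Cod C f = Cod C g\<rbrakk>
      \<Longrightarrow> p f \<boxplus>\<^bsub>Q\<^esub> p g = p (f \<boxplus>\<^bsub>C\<^esub> g)"
    and Zro_im: "\<lbrakk>X \<in> Obj C; Y \<in> Obj C\<rbrakk> \<Longrightarrow> Zro Q X Y = p (Zro C X Y)"
begin

lemma im_Arr [simp]: "f \<in> Arr C \<Longrightarrow> p f \<in> Arr Q"
  by (simp add: Arr_im)

lemma im_lift:
  assumes "u \<in> Arr Q"
  obtains f where "f \<in> Arr C" "u = p f" "Dom C f = Dom Q u" "Cod C f = Cod Q u"
  using assms Arr_im by auto

lemma im_preadditive: "preadditive_category Q"
proof (intro preadditive_category.intro category.intro preadditive_category_axioms.intro)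
  fix f assume "f \<in> Arr Q" then show "Dom Q f \<in> Obj Q" "Cod Q f \<in> Obj Q"
    by (auto elim!: im_lift simp: Obj_im)
next
  fix X assume "X \<in> Obj Q" then show "Idt Q X \<in> Hom Q X X" by (simp add: Obj_im Idt_im)
next
  fix f g X Y Z assume "f \<in> Hom Q X Y" "g \<in> Hom Q Y Z"
  then show "g \<cdot>\<^bsub>Q\<^esub> f \<in> Hom Q X Z" by (auto elim!: im_lift simp: Comp_im)
next
  fix f X Y assume "f \<in> Hom Q X Y"
  then show "f \<cdot>\<^bsub>Q\<^esub> Idt Q X = f" "Idt Q Y \<cdot>\<^bsub>Q\<^esub> f = f"
    by (auto elim!: im_lift simp: Comp_im Idt_im)
next
  fix f g h X Y Z W assume "f \<in> Hom Q X Y" "g \<in> Hom Q Y Z" "h \<in> Hom Q Z W"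
  then show "h \<cdot>\<^bsub>Q\<^esub> g \<cdot>\<^bsub>Q\<^esub> f = h \<cdot>\<^bsub>Q\<^esub> (g \<cdot>\<^bsub>Q\<^esub> f)"
    by (auto elim!: im_lift simp: Comp_im)
next
  fix X Y assume XY: "X \<in> Obj Q" "Y \<in> Obj Q"
  show "comm_group (Hom_group Q X Y)"
  proof (rule comm_groupI)
    note XY' = XY[unfolded Obj_im]
    note G = Hom_group_def
    have lift: "\<exists>k. k \<in> Arr C \<and> f = p k \<and> Dom C k = X \<and> Cod C k = Y"
      if "f \<in> carrier (Hom_group Q X Y)" for f
      using that by (auto elim!: im_lift simp: G)
    show "\<one>\<^bsub>Hom_group Q X Y\<^esub> \<in> carrier (Hom_group Q X Y)"
      using XY' by (simp add: G Zro_im)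
    fix f assume "f \<in> carrier (Hom_group Q X Y)"
    then obtain a where a: "f = p a" and [simp]: "a \<in> Arr C" "Dom C a = X" "Cod C a = Y"
      using lift by metis
    show "\<one>\<^bsub>Hom_group Q X Y\<^esub> \<otimes>\<^bsub>Hom_group Q X Y\<^esub> f = f"
      using XY' by (simp add: G Add_im a Zro_im)
    show "\<exists>g\<in>carrier (Hom_group Q X Y). g \<otimes>\<^bsub>Hom_group Q X Y\<^esub> f = \<one>\<^bsub>Hom_group Q X Y\<^esub>"
      by (rule bexI[of _ "p (Neg C a)"]) (use XY' in \<open>simp_all add: G Add_im Zro_im a\<close>)
    fix g assume "g \<in> carrier (Hom_group Q X Y)"
    then obtain b where b: "g = p b" and [simp]: "b \<in> Arr C" "Dom C b = X" "Cod C b = Y"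
      using lift by metis
    show "f \<otimes>\<^bsub>Hom_group Q X Y\<^esub> g \<in> carrier (Hom_group Q X Y)"
      by (simp add: G Add_im a b)
    show "f \<otimes>\<^bsub>Hom_group Q X Y\<^esub> g = g \<otimes>\<^bsub>Hom_group Q X Y\<^esub> f"
      by (simp add: G Add_im a b C.Add_comm)
    fix h assume "h \<in> carrier (Hom_group Q X Y)"
    then obtain c where c: "h = p c" and [simp]: "c \<in> Arr C" "Dom C c = X" "Cod C c = Y"
      using lift by metis
    show "f \<otimes>\<^bsub>Hom_group Q X Y\<^esub> g \<otimes>\<^bsub>Hom_group Q X Y\<^esub> h =
      f \<otimes>\<^bsub>Hom_group Q X Y\<^esub> (g \<otimes>\<^bsub>Hom_group Q X Y\<^esub> h)"
      by (simp add: G Add_im a b c)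
  qed
next
  fix f f' g X Y Z assume "f \<in> Hom Q X Y" "f' \<in> Hom Q X Y" "g \<in> Hom Q Y Z"
  then show "g \<cdot>\<^bsub>Q\<^esub> (f \<boxplus>\<^bsub>Q\<^esub> f') = g \<cdot>\<^bsub>Q\<^esub> f \<boxplus>\<^bsub>Q\<^esub> g \<cdot>\<^bsub>Q\<^esub> f'"
    by (auto elim!: im_lift simp: Comp_im Add_im)
next
  fix f g g' X Y Z assume "f \<in> Hom Q X Y" "g \<in> Hom Q Y Z" "g' \<in> Hom Q Y Z"
  then show "(g \<boxplus>\<^bsub>Q\<^esub> g') \<cdot>\<^bsub>Q\<^esub> f = g \<cdot>\<^bsub>Q\<^esub> f \<boxplus>\<^bsub>Q\<^esub> g' \<cdot>\<^bsub>Q\<^esub> f"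
    by (auto elim!: im_lift simp: Comp_im Add_im)
qed

lemma im_biproduct:
  assumes "is_biproduct C X Y S i j q r"
  shows "is_biproduct Q X Y S (p i) (p j) (p q) (p r)"
  using C.biproductD[OF assms] unfolding is_biproduct_def
  by (simp add: Obj_im Comp_im Idt_im Zro_im Add_im)

lemma im_additive: "additive_category Q"
proof -
  interpret Q: preadditive_category Q by (rule im_preadditive)
  show ?thesis
  proof unfold_locales
    obtain Z where "zero_object C Z" using C.zero_object_exists by blast
    then have "zero_object Q Z"
      unfolding C.zero_object_iff Q.zero_object_iff by (simp add: Obj_im Idt_im Zro_im)
    then show "\<exists>Z. zero_object Q Z" by blast
    show "\<exists>S. direct_sum Q X Y S" if "X \<in> Obj Q" "Y \<in> Obj Q" for X Y
      using C.direct_sum_exists[of X Y] that im_biproduct unfolding Obj_im direct_sum_def by metis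
  qed
qed

end

locale additive_ideal_quotient = additive_category C for C :: "('o, 'm, 'x) addcat_scheme" (structure) +
  fixes P :: "'o set"
  assumes P_Obj: "P \<subseteq> Obj C" and P_nonempty: "P \<noteq> {}"
    and P_sum: "\<lbrakk>A \<in> P; B \<in> P; direct_sum C A B S\<rbrakk> \<Longrightarrow> S \<in> P"
begin

lemma factoringI:
  "\<lbrakk>a \<in> Arr C; b \<in> Arr C; Cod C a = Dom C b; Dom C b \<in> P\<rbrakk> \<Longrightarrow> b \<cdot> a \<in> factoring C P"
  unfolding factoring_def
  by (simp, rule bexI[of _ "Dom C b"], rule bexI[of _ a], rule bexI[of _ b]) simp_all

lemma factoringE:
  assumes "f \<in> factoring C P"
  obtains a b where "a \<in> Arr C" "b \<in> Arr C" "Dom C a = Dom C f" "Cod C a = Dom C b" "Cod C b = Cod C f"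
    "Dom C b \<in> P" "f = b \<cdot> a"
  using assms unfolding factoring_def by auto

lemma factoring_Arr: "f \<in> factoring C P \<Longrightarrow> f \<in> Arr C"
  by (simp add: factoring_def)

lemma factoring_Zro [simp]:
  assumes "X \<in> Obj C" "Y \<in> Obj C" shows "Zro C X Y \<in> factoring C P"
proof -
  obtain Z where Z: "Z \<in> P" "Z \<in> Obj C" using P_nonempty P_Obj by blast
  have "Zro C Z Y \<cdot> Zro C X Z \<in> factoring C P" by (rule factoringI) (use assms Z in simp_all)
  then show ?thesis using assms Z by simp
qed

lemma factoring_Comp_left:
  assumes "f \<in> factoring C P" "g \<in> Arr C" "Cod C f = Dom C g" shows "g \<cdot> f \<in> factoring C P"
proof -
  obtain a b where ab: "a \<in> Arr C" "b \<in> Arr C" "Dom C a = Dom C f" "Cod C a = Dom C b"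
    "Cod C b = Cod C f" "Dom C b \<in> P" "f = b \<cdot> a" using assms(1) by (rule factoringE)
  have "(g \<cdot> b) \<cdot> a \<in> factoring C P" by (rule factoringI) (use ab(1-6) assms(2,3) in simp_all)
  then have "g \<cdot> (b \<cdot> a) \<in> factoring C P" using ab(1-5) assms(2,3) by simp
  then show ?thesis by (simp only: ab(7))
qed

lemma factoring_Comp_right:
  assumes "f \<in> factoring C P" "g \<in> Arr C" "Cod C g = Dom C f" shows "f \<cdot> g \<in> factoring C P"
proof -
  obtain a b where ab: "a \<in> Arr C" "b \<in> Arr C" "Dom C a = Dom C f" "Cod C a = Dom C b"
    "Cod C b = Cod C f" "Dom C b \<in> P" "f = b \<cdot> a" using assms(1) by (rule factoringE)
  have "b \<cdot> (a \<cdot> g) \<in> factoring C P" by (rule factoringI) (use ab(1-6) assms(2,3) in simp_all)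
  then have "(b \<cdot> a) \<cdot> g \<in> factoring C P" using ab(1-5) assms(2,3) by simp
  then show ?thesis by (simp only: ab(7))
qed

lemma factoring_Neg: "f \<in> factoring C P \<Longrightarrow> Neg C f \<in> factoring C P"
  using factoring_Comp_left[of f "Neg C (Idt C (Cod C f))"] factoring_Arr[of f] by simp

text \<open>Two arrows factoring through \<open>A\<close> and \<open>B\<close> have a sum that
  factors through \<open>A \<oplus> B\<close>; this is where the closure of \<open>P\<close> under
  direct sums enters.\<close>

lemma factoring_Add:
  assumes f: "f \<in> factoring C P" "f' \<in> factoring C P" and d: "Dom C f = Dom C f'" "Cod C f = Cod C f'"
  shows "f \<boxplus> f' \<in> factoring C P"
proof -
  obtain a b where ab: "a \<in> Arr C" "b \<in> Arr C" "Dom C a = Dom C f'" "Cod C a = Dom C b"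
    "Cod C b = Cod C f'" "Dom C b \<in> P" "f = b \<cdot> a" by (rule factoringE[OF f(1), unfolded d])
  obtain a' b' where ab': "a' \<in> Arr C" "b' \<in> Arr C" "Dom C a' = Dom C f'" "Cod C a' = Dom C b'"
    "Cod C b' = Cod C f'" "Dom C b' \<in> P" "f' = b' \<cdot> a'" by (rule factoringE[OF f(2)])
  obtain S i j p q where S: "is_biproduct C (Dom C b) (Dom C b') S i j p q"
    using direct_sum_exists[of "Dom C b" "Dom C b'"] ab(2) ab'(2) unfolding direct_sum_def by auto
  note [simp] = biproductD[OF S] ab(1-5) ab'(1-5) factoring_Arr[OF f(1)] factoring_Arr[OF f(2)]
  have "S \<in> P" using P_sum[OF ab(6) ab'(6)] S unfolding direct_sum_def by blast
  then have "(b \<cdot> p \<boxplus> b' \<cdot> q) \<cdot> (i \<cdot> a \<boxplus> j \<cdot> a') \<in> factoring C P"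
    by (intro factoringI) simp_all
  also have "(b \<cdot> p \<boxplus> b' \<cdot> q) \<cdot> (i \<cdot> a \<boxplus> j \<cdot> a') = f \<boxplus> f'"
    unfolding ab(7) ab'(7) by simp
  finally show ?thesis .
qed

lemma quot_rel_iff: "(f, g) \<in> quot_rel C P \<longleftrightarrow> f \<in> Arr C \<and> g \<in> Arr C \<and> Dom C f = Dom C g \<and>
    Cod C f = Cod C g \<and> f \<boxplus> Neg C g \<in> factoring C P"
  by (simp add: quot_rel_def)

lemma quot_rel_equiv: "equiv (Arr C) (quot_rel C P)"
proof (rule equivI)
  show "quot_rel C P \<subseteq> Arr C \<times> Arr C" by (auto simp: quot_rel_iff)
  show "refl_on (Arr C) (quot_rel C P)" by (auto simp: refl_on_def quot_rel_iff)
  show "sym (quot_rel C P)"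
  proof (rule symI)
    fix f g assume "(f, g) \<in> quot_rel C P"
    then show "(g, f) \<in> quot_rel C P"
      using factoring_Neg[of "f \<boxplus> Neg C g"] by (auto simp: quot_rel_iff Add_comm)
  qed
  show "trans (quot_rel C P)"
  proof (rule transI)
    fix f g h assume a: "(f, g) \<in> quot_rel C P" "(g, h) \<in> quot_rel C P"
    then have "(f \<boxplus> Neg C g) \<boxplus> (g \<boxplus> Neg C h) \<in> factoring C P"
      by - (rule factoring_Add, simp_all add: quot_rel_iff)
    then show "(f, h) \<in> quot_rel C P" using a by (simp add: quot_rel_iff)
  qed
qed

lemma quot_map_eq_iff:
  "\<lbrakk>f \<in> Arr C; g \<in> Arr C\<rbrakk> \<Longrightarrow> quot_map C P f = quot_map C P g \<longleftrightarrow>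
     Dom C f = Dom C g \<and> Cod C f = Cod C g \<and> f \<boxplus> Neg C g \<in> factoring C P"
  unfolding quot_map_def using eq_equiv_class_iff[OF quot_rel_equiv] by (auto simp: quot_rel_iff)

lemma quot_map_self: "f \<in> Arr C \<Longrightarrow> f \<in> quot_map C P f"
  unfolding quot_map_def by (simp add: quot_rel_iff)

lemma quot_map_mem: "f \<in> Arr C \<Longrightarrow> g \<in> quot_map C P f \<longleftrightarrow> g \<in> Arr C \<and> quot_map C P g = quot_map C P f"
  using quot_map_eq_iff quot_map_self unfolding quot_map_def
  by (metis (no_types, lifting) Image_singleton_iff equiv_class_eq quot_rel_equiv quot_rel_iff)

lemma quot_map_Comp:
  assumes "f \<in> Arr C" "g \<in> Arr C" "f' \<in> Arr C" "g' \<in> Arr C" "Cod C f = Dom C g"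
    "quot_map C P f = quot_map C P f'" "quot_map C P g = quot_map C P g'"
  shows "quot_map C P (g \<cdot> f) = quot_map C P (g' \<cdot> f')"
proof -
  have d[simp]: "Dom C f = Dom C f'" "Cod C f = Cod C f'" "Dom C g = Dom C g'" "Cod C g = Cod C g'"
    "Cod C f' = Dom C g'"
    and 1: "f \<boxplus> Neg C f' \<in> factoring C P" and 2: "g \<boxplus> Neg C g' \<in> factoring C P"
    using assms by (auto simp: quot_map_eq_iff)
  have "g \<cdot> (f \<boxplus> Neg C f') \<in> factoring C P" "(g \<boxplus> Neg C g') \<cdot> f' \<in> factoring C P"
    using factoring_Comp_left[OF 1, of g] factoring_Comp_right[OF 2, of f'] assms(1-4) by simp_all
  then have "g \<cdot> (f \<boxplus> Neg C f') \<boxplus> (g \<boxplus> Neg C g') \<cdot> f' \<in> factoring C P"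
    by (rule factoring_Add) (use assms(1-4) in simp_all)
  then have "g \<cdot> f \<boxplus> Neg C (g' \<cdot> f') \<in> factoring C P" using assms(1-4) by simp
  then show ?thesis using assms(1-4) by (simp add: quot_map_eq_iff)
qed

lemma quot_map_Add:
  assumes "f \<in> Arr C" "g \<in> Arr C" "f' \<in> Arr C" "g' \<in> Arr C" "Dom C f = Dom C g" "Cod C f = Cod C g"
    "quot_map C P f = quot_map C P f'" "quot_map C P g = quot_map C P g'"
  shows "quot_map C P (f \<boxplus> g) = quot_map C P (f' \<boxplus> g')"
proof -
  have d[simp]: "Dom C f = Dom C g'" "Cod C f = Cod C g'" "Dom C g = Dom C g'" "Cod C g = Cod C g'"
    "Cod C f' = Cod C g'" "Dom C f' = Dom C g'"
    and 1: "f \<boxplus> Neg C f' \<in> factoring C P" and 2: "g \<boxplus> Neg C g' \<in> factoring C P"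
    using assms by (auto simp: quot_map_eq_iff)
  have "(f \<boxplus> Neg C f') \<boxplus> (g \<boxplus> Neg C g') \<in> factoring C P"
    by (rule factoring_Add[OF 1 2]) (use assms(1-4) in simp_all)
  then have "(f \<boxplus> g) \<boxplus> Neg C (f' \<boxplus> g') \<in> factoring C P"
    using assms(1-4) by (simp add: Add_left_comm[of "Neg C f'" g])
  then show ?thesis using assms(1-4) by (simp add: quot_map_eq_iff)
qed

lemma quot_cat_simps:
  shows "Obj (quot_cat C P) = Obj C" "Arr (quot_cat C P) = quot_map C P ` Arr C"
    "\<And>f. f \<in> Arr C \<Longrightarrow> Dom (quot_cat C P) (quot_map C P f) = Dom C f"
    "\<And>f. f \<in> Arr C \<Longrightarrow> Cod (quot_cat C P) (quot_map C P f) = Cod C f"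
    "\<And>X. Idt (quot_cat C P) X = quot_map C P (Idt C X)"
    "\<And>f g. \<lbrakk>f \<in> Arr C; g \<in> Arr C; Cod C f = Dom C g\<rbrakk>
      \<Longrightarrow> quot_map C P g \<cdot>\<^bsub>quot_cat C P\<^esub> quot_map C P f = quot_map C P (g \<cdot> f)"
    "\<And>f g. \<lbrakk>f \<in> Arr C; g \<in> Arr C; Dom C f = Dom C g; Cod C f = Cod C g\<rbrakk>
      \<Longrightarrow> quot_map C P f \<boxplus>\<^bsub>quot_cat C P\<^esub> quot_map C P g = quot_map C P (f \<boxplus> g)"
    "\<And>X Y. Zro (quot_cat C P) X Y = quot_map C P (Zro C X Y)"
proof -
  show "Arr (quot_cat C P) = quot_map C P ` Arr C"
    by (auto simp: quot_cat_def quotient_def quot_map_def)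
  show "Dom (quot_cat C P) (quot_map C P f) = Dom C f" if f: "f \<in> Arr C" for f
  proof -
    have "Dom C ` quot_map C P f = {Dom C f}"
      using f quot_map_self[OF f] by (auto simp: quot_map_mem[OF f] quot_map_eq_iff)
    then show ?thesis by (simp add: quot_cat_def)
  qed
  show "Cod (quot_cat C P) (quot_map C P f) = Cod C f" if f: "f \<in> Arr C" for f
  proof -
    have "Cod C ` quot_map C P f = {Cod C f}"
      using f quot_map_self[OF f] by (auto simp: quot_map_mem[OF f] quot_map_eq_iff)
    then show ?thesis by (simp add: quot_cat_def)
  qed
  show "quot_map C P g \<cdot>\<^bsub>quot_cat C P\<^esub> quot_map C P f = quot_map C P (g \<cdot> f)"
    if fg: "f \<in> Arr C" "g \<in> Arr C" "Cod C f = Dom C g" for f g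
  proof -
    have "quot_map C P (g' \<cdot> f') = quot_map C P (g \<cdot> f)"
      if "f' \<in> quot_map C P f" "g' \<in> quot_map C P g" for f' g'
      using quot_map_Comp[of f g f' g'] fg that by (simp add: quot_map_mem)
    then have "(\<Union>g'\<in>quot_map C P g. \<Union>f'\<in>quot_map C P f. quot_map C P (g' \<cdot> f')) = quot_map C P (g \<cdot> f)"
      using quot_map_self fg by blast
    then show ?thesis by (simp add: quot_cat_def)
  qed
  show "quot_map C P f \<boxplus>\<^bsub>quot_cat C P\<^esub> quot_map C P g = quot_map C P (f \<boxplus> g)"
    if fg: "f \<in> Arr C" "g \<in> Arr C" "Dom C f = Dom C g" "Cod C f = Cod C g" for f g
  proof -
    have "quot_map C P (f' \<boxplus> g') = quot_map C P (f \<boxplus> g)"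
      if "f' \<in> quot_map C P f" "g' \<in> quot_map C P g" for f' g'
      using quot_map_Add[of f g f' g'] fg that by (simp add: quot_map_mem)
    then have "(\<Union>f'\<in>quot_map C P f. \<Union>g'\<in>quot_map C P g. quot_map C P (f' \<boxplus> g')) = quot_map C P (f \<boxplus> g)"
      using quot_map_self fg by blast
    then show ?thesis by (simp add: quot_cat_def)
  qed
qed (simp_all add: quot_cat_def)

end

lemma image_eq_iff_surj: "f ` A \<subseteq> B \<Longrightarrow> f ` A = B \<longleftrightarrow> (\<forall>b \<in> B. \<exists>a \<in> A. f a = b)"
  by (auto simp: image_iff eq_commute)

section \<open>Ideals of phantom morphisms\<close>

context triangulated_category
begin

lemma Hom_from_hom:
  assumes "f \<in> Arr K" "P \<in> Obj K"
  shows "(\<lambda>u. f \<cdot> u) \<in> hom (Hom_group K P (Dom K f)) (Hom_group K P (Cod K f))"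
  using assms by (auto simp: hom_def Hom_group_def)

lemma Hom_to_hom:
  assumes "f \<in> Arr K" "I \<in> Obj K"
  shows "(\<lambda>u. u \<cdot> f) \<in> hom (Hom_group K (Cod K f) I) (Hom_group K (Dom K f) I)"
  using assms by (auto simp: hom_def Hom_group_def)

text \<open>For a triangle, exactness in the middle always holds, so that only the two ends
  matter.\<close>

lemma short_exact_criterion:
  assumes groups: "group A" "group B" "group C" and hom: "g \<in> hom B A" "f \<in> hom C B"
    and exact: "kernel B A g = f ` carrier C"
  shows "short_exact_sequence A B C g f \<longleftrightarrow> kernel C B f = {\<one>\<^bsub>C\<^esub>} \<and> g ` carrier B = carrier A"
proof -
  interpret f: group_hom C B f
    using groups hom by (simp add: group_hom_def group_hom_axioms_def)
  have gh: "group_hom C B f" "group_hom B A g"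
    using groups hom by (simp_all add: group_hom_def group_hom_axioms_def)
  have "inj_on f (carrier C) \<longleftrightarrow> kernel C B f = {\<one>\<^bsub>C\<^esub>}"
    by (rule f.inj_iff_trivial_ker)
  then show ?thesis
    unfolding short_exact_sequence_iff using groups hom exact gh by (auto simp: epi_def mon_def)
qed

lemma short_exact_from:
  assumes T: "(f, g, h) \<in> Dist K" and P: "P \<in> Obj K"
  shows "short_exact_sequence (Hom_group K P (Dom K h)) (Hom_group K P (Dom K g))
      (Hom_group K P (Dom K f)) (\<lambda>u. g \<cdot> u) (\<lambda>u. f \<cdot> u) \<longleftrightarrow>
    (\<forall>u \<in> Hom K P (Dom K f). f \<cdot> u = Zro K P (Dom K g) \<longrightarrow> u = Zro K P (Dom K f)) \<and>
    (\<forall>u \<in> Hom K P (Dom K h). \<exists>x \<in> Hom K P (Dom K g). g \<cdot> x = u)"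
proof -
  note [simp] = DistD[OF T] P
  have gr: "\<And>X. X \<in> Obj K \<Longrightarrow> group (Hom_group K P X)"
    using Hom_comm_group comm_group_def P by blast
  have ex: "kernel (Hom_group K P (Dom K g)) (Hom_group K P (Dom K h)) (\<lambda>u. g \<cdot> u)
      = (\<lambda>u. f \<cdot> u) ` carrier (Hom_group K P (Dom K f))"
  proof (intro equalityI subsetI)
    fix u assume "u \<in> kernel (Hom_group K P (Dom K g)) (Hom_group K P (Dom K h)) (\<lambda>u. g \<cdot> u)"
    then have u: "u \<in> Arr K" "Dom K u = P" "Cod K u = Dom K g" "g \<cdot> u = Zro K (Dom K u) (Dom K h)"
      by (auto simp: kernel_def Hom_group_def)
    obtain x where "x \<in> Arr K" "Dom K x = Dom K u" "Cod K x = Dom K f" "f \<cdot> x = u"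
      using Dist_exact1[OF T u(1,3,4)] .
    then show "u \<in> (\<lambda>u. f \<cdot> u) ` carrier (Hom_group K P (Dom K f))"
      using u by (auto simp: Hom_group_def)
  next
    fix u assume "u \<in> (\<lambda>u. f \<cdot> u) ` carrier (Hom_group K P (Dom K f))"
    then show "u \<in> kernel (Hom_group K P (Dom K g)) (Hom_group K P (Dom K h)) (\<lambda>u. g \<cdot> u)"
      by (auto simp: kernel_def Hom_group_def Comp_reduce[OF Dist_comp_zero1[OF T]])
  qed
  have 0: "Zro K P (Dom K f) \<in> Hom K P (Dom K f)" "f \<cdot> Zro K P (Dom K f) = Zro K P (Dom K g)" by simp_all
  have k: "kernel (Hom_group K P (Dom K f)) (Hom_group K P (Dom K g)) (\<lambda>u. f \<cdot> u) = {\<one>\<^bsub>Hom_group K P (Dom K f)\<^esub>}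
      \<longleftrightarrow> (\<forall>u \<in> Hom K P (Dom K f). f \<cdot> u = Zro K P (Dom K g) \<longrightarrow> u = Zro K P (Dom K f))"
    unfolding kernel_def Hom_group_def monoid.simps partial_object.simps using 0 by blast
  have s: "(\<lambda>u. g \<cdot> u) ` carrier (Hom_group K P (Dom K g)) = carrier (Hom_group K P (Dom K h)) \<longleftrightarrow>
    (\<forall>u \<in> Hom K P (Dom K h). \<exists>x \<in> Hom K P (Dom K g). g \<cdot> x = u)"
  proof -
    have "(\<lambda>u. g \<cdot> u) ` Hom K P (Dom K g) \<subseteq> Hom K P (Dom K h)" by auto
    from image_eq_iff_surj[OF this] show ?thesis by (simp only: Hom_group_def partial_object.simps)
  qed
  show ?thesis
    using short_exact_criterion[OF gr gr gr _ _ ex] Hom_from_hom[of f P] Hom_from_hom[of g P] k s by simp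
qed

lemma short_exact_to:
  assumes T: "(f, g, h) \<in> Dist K" and I: "I \<in> Obj K"
  shows "short_exact_sequence (Hom_group K (Dom K f) I) (Hom_group K (Dom K g) I)
      (Hom_group K (Dom K h) I) (\<lambda>u. u \<cdot> f) (\<lambda>u. u \<cdot> g) \<longleftrightarrow>
    (\<forall>u \<in> Hom K (Dom K h) I. u \<cdot> g = Zro K (Dom K g) I \<longrightarrow> u = Zro K (Dom K h) I) \<and>
    (\<forall>u \<in> Hom K (Dom K f) I. \<exists>x \<in> Hom K (Dom K g) I. x \<cdot> f = u)"
proof -
  note [simp] = DistD[OF T] I
  have gr: "\<And>X. X \<in> Obj K \<Longrightarrow> group (Hom_group K X I)"
    using Hom_comm_group comm_group_def I by blast
  have ex: "kernel (Hom_group K (Dom K g) I) (Hom_group K (Dom K f) I) (\<lambda>u. u \<cdot> f)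
      = (\<lambda>u. u \<cdot> g) ` carrier (Hom_group K (Dom K h) I)"
  proof (intro equalityI subsetI)
    fix u assume "u \<in> kernel (Hom_group K (Dom K g) I) (Hom_group K (Dom K f) I) (\<lambda>u. u \<cdot> f)"
    then have u: "u \<in> Arr K" "Cod K u = I" "Dom K u = Dom K g" "u \<cdot> f = Zro K (Dom K f) (Cod K u)"
      by (auto simp: kernel_def Hom_group_def)
    obtain x where "x \<in> Arr K" "Dom K x = Dom K h" "Cod K x = Cod K u" "x \<cdot> g = u"
      using Dist_coexact2[OF T u(1,3,4)] .
    then show "u \<in> (\<lambda>u. u \<cdot> g) ` carrier (Hom_group K (Dom K h) I)"
      using u by (auto simp: Hom_group_def)
  next
    fix u assume "u \<in> (\<lambda>u. u \<cdot> g) ` carrier (Hom_group K (Dom K h) I)"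
    then show "u \<in> kernel (Hom_group K (Dom K g) I) (Hom_group K (Dom K f) I) (\<lambda>u. u \<cdot> f)"
      by (auto simp: kernel_def Hom_group_def Dist_comp_zero1[OF T])
  qed
  have 0: "Zro K (Dom K h) I \<in> Hom K (Dom K h) I" "Zro K (Dom K h) I \<cdot> g = Zro K (Dom K g) I" by simp_all
  have k: "kernel (Hom_group K (Dom K h) I) (Hom_group K (Dom K g) I) (\<lambda>u. u \<cdot> g) = {\<one>\<^bsub>Hom_group K (Dom K h) I\<^esub>}
      \<longleftrightarrow> (\<forall>u \<in> Hom K (Dom K h) I. u \<cdot> g = Zro K (Dom K g) I \<longrightarrow> u = Zro K (Dom K h) I)"
    unfolding kernel_def Hom_group_def monoid.simps partial_object.simps using 0 by blast
  have s: "(\<lambda>u. u \<cdot> f) ` carrier (Hom_group K (Dom K g) I) = carrier (Hom_group K (Dom K f) I) \<longleftrightarrow>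
    (\<forall>u \<in> Hom K (Dom K f) I. \<exists>x \<in> Hom K (Dom K g) I. x \<cdot> f = u)"
  proof -
    have "(\<lambda>u. u \<cdot> f) ` Hom K (Dom K g) I \<subseteq> Hom K (Dom K f) I" by auto
    from image_eq_iff_surj[OF this] show ?thesis by (simp only: Hom_group_def partial_object.simps)
  qed
  show ?thesis
    using short_exact_criterion[OF gr gr gr _ _ ex] Hom_to_hom[of f I] Hom_to_hom[of g I] k s by simp
qed

lemma desuspend_object:
  assumes "Y \<in> Obj K"
  obtains X s s' where "X \<in> Obj K" "s \<in> Arr K" "Dom K s = SO X" "Cod K s = Y"
    "s' \<in> Arr K" "Dom K s' = Y" "Cod K s' = SO X" "s \<cdot> s' = Idt K Y" "s' \<cdot> s = Idt K (SO X)"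
proof -
  obtain X s where X: "X \<in> Obj K" and s: "is_iso K s" "Dom K s = SO X" "Cod K s = Y"
    using is_equivalenceD(3)[OF Susp_equivalence assms] unfolding isomorphic_def by auto
  from s(1) obtain s' where "s' \<in> Arr K" "Dom K s' = Y" "Cod K s' = SO X" "s \<cdot> s' = Idt K Y"
    "s' \<cdot> s = Idt K (SO X)" using s by (metis is_isoE)
  from that[OF X is_iso_Arr[OF s(1)] s(2,3) this] show ?thesis .
qed

text \<open>The domain is replaced by an isomorphic suspension; the suspension is full.\<close>

lemma desuspend:
  assumes h: "h \<in> Arr K" "Cod K h = SO X" "X \<in> Obj K"
  obtains Z s s' k where "Z \<in> Obj K" "s \<in> Arr K" "Dom K s = SO Z" "Cod K s = Dom K h"
    "s' \<in> Arr K" "Dom K s' = Dom K h" "Cod K s' = SO Z" "s \<cdot> s' = Idt K (Dom K h)"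
    "s' \<cdot> s = Idt K (SO Z)"
    "k \<in> Arr K" "Dom K k = Z" "Cod K k = X" "SA k = h \<cdot> s"
proof -
  obtain Z s s' where s: "Z \<in> Obj K" "s \<in> Arr K" "Dom K s = SO Z" "Cod K s = Dom K h"
    "s' \<in> Arr K" "Dom K s' = Dom K h" "Cod K s' = SO Z" "s \<cdot> s' = Idt K (Dom K h)"
    "s' \<cdot> s = Idt K (SO Z)"
    using h by (metis desuspend_object Dom_Obj)
  obtain k where "k \<in> Arr K" "Dom K k = Z" "Cod K k = X" "SA k = h \<cdot> s"
    by (rule susp_surj[of "h \<cdot> s" Z X]) (use s h in simp_all)
  with s that show ?thesis by blast
qed

end

text \<open>The closure properties of the kernel of an exact functor that the theory of
  projectives and injectives relies on.\<close>

locale phantom_ideal = triangulated_category K for K :: "('o, 'm, 'x) tricat_scheme" (structure) +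
  fixes N :: "'m set"
  assumes N_Arr: "N \<subseteq> Arr K"
    and N_left: "\<lbrakk>h \<in> N; a \<in> Arr K; Dom K a = Cod K h\<rbrakk> \<Longrightarrow> a \<cdot> h \<in> N"
    and N_right: "\<lbrakk>h \<in> N; b \<in> Arr K; Cod K b = Dom K h\<rbrakk> \<Longrightarrow> h \<cdot> b \<in> N"
    and N_Zro: "\<lbrakk>X \<in> Obj K; Y \<in> Obj K\<rbrakk> \<Longrightarrow> Zro K X Y \<in> N"
    and N_Susp: "f \<in> Arr K \<Longrightarrow> AMap (Susp K) f \<in> N \<longleftrightarrow> f \<in> N"
begin

definition phantom_triangles :: "'m triangle set" where
  "phantom_triangles = {(f, g, h) \<in> Dist K. h \<in> N}"

lemma phantom_triangles_iff: "(f, g, h) \<in> phantom_triangles \<longleftrightarrow> (f, g, h) \<in> Dist K \<and> h \<in> N"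
  by (simp add: phantom_triangles_def)

lemma N_in_Arr: "h \<in> N \<Longrightarrow> h \<in> Arr K" using N_Arr by blast

text \<open>If \<open>P\<close> is projective, \<open>h\<close> is, up to an isomorphism of its
  codomain, the third arrow of a triangle, and arrows out of \<open>P\<close> lift along the
  second. Conversely, surjectivity on the right is exactness; for injectivity on the left, an
  arrow killed by \<open>f\<close> has a suspension that factors through \<open>h\<close>, and
  desuspending \<open>h\<close> brings the hypothesis to bear.\<close>

lemma projectives_iff:
  "P \<in> projectives K phantom_triangles \<longleftrightarrow> P \<in> Obj K \<and>
     (\<forall>h \<in> N. \<forall>u \<in> Hom K P (Dom K h). h \<cdot> u = Zro K P (Cod K h))"
proof (intro iffI conjI ballI)
  assume P: "P \<in> projectives K phantom_triangles"
  then show Po: "P \<in> Obj K" by (simp add: projectives_def)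
  fix h u assume h: "h \<in> N" and u: "u \<in> Hom K P (Dom K h)"
  have [simp]: "h \<in> Arr K" using h N_Arr by blast
  obtain X s s' where s: "X \<in> Obj K" "s \<in> Arr K" "Dom K s = SO X" "Cod K s = Cod K h"
    "s' \<in> Arr K" "Dom K s' = Cod K h" "Cod K s' = SO X" "s \<cdot> s' = Idt K (Cod K h)"
    by (metis desuspend_object Cod_Obj \<open>h \<in> Arr K\<close>)
  obtain f g where T: "(f, g, s' \<cdot> h) \<in> Dist K" "Dom K f = X"
    by (rule Dist_cocone[of "s' \<cdot> h" X]) (use s in simp_all)
  have "(f, g, s' \<cdot> h) \<in> phantom_triangles" using T s h N_left by (simp add: phantom_triangles_iff)
  then have "\<forall>u \<in> Hom K P (Dom K (s' \<cdot> h)). \<exists>x \<in> Hom K P (Dom K g). g \<cdot> x = u"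
    using P short_exact_from[OF T(1) Po] unfolding projectives_def by blast
  moreover have "u \<in> Hom K P (Dom K (s' \<cdot> h))" using u s by simp
  ultimately obtain x where "x \<in> Hom K P (Dom K g)" and xu: "g \<cdot> x = u" by blast
  then have x: "x \<in> Arr K" "Dom K x = P" "Cod K x = Dom K g" "g \<cdot> x = u" by simp_all
  have [simp]: "g \<in> Arr K" "Cod K g = Dom K h" using DistD[OF T(1)] s by simp_all
  have z: "(s' \<cdot> h) \<cdot> g = Zro K (Dom K g) (SO X)" using Dist_comp_zero2[OF T(1)] T(2) by simp
  have "h \<cdot> u = s \<cdot> (((s' \<cdot> h) \<cdot> g) \<cdot> x)" using s x(1-3) u by (simp add: Comp_reduce[OF s(8)] x(4))
  then show "h \<cdot> u = Zro K P (Cod K h)" unfolding z using x s Po by simp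
next
  assume P: "P \<in> Obj K \<and> (\<forall>h \<in> N. \<forall>u \<in> Hom K P (Dom K h). h \<cdot> u = Zro K P (Cod K h))"
  then have [simp]: "P \<in> Obj K" by simp
  have "short_exact_sequence (Hom_group K P (Dom K h)) (Hom_group K P (Dom K g))
      (Hom_group K P (Dom K f)) (\<lambda>u. g \<cdot> u) (\<lambda>u. f \<cdot> u)"
    if E: "(f, g, h) \<in> phantom_triangles" for f g h
  proof -
    have T: "(f, g, h) \<in> Dist K" and h: "h \<in> N" using E by (simp_all add: phantom_triangles_iff)
    note [simp] = DistD[OF T]
    have "u = Zro K P (Dom K f)" if u: "u \<in> Hom K P (Dom K f)" "f \<cdot> u = Zro K P (Dom K g)" for u
    proof -
      have [simp]: "u \<in> Arr K" "Dom K u = P" "Cod K u = Dom K f" using u by auto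
      have "SA f \<cdot> SA u = Zro K (Dom K (SA u)) (SO (Dom K g))"
        using u(2) by (simp flip: Susp.AMap_Comp)
      then obtain x where x: "x \<in> Arr K" "Dom K x = SO P" "Cod K x = Dom K h" "h \<cdot> x = SA u"
        using Dist_exact3[OF T, of "SA u"] by auto
      obtain Z s s' k where s: "Z \<in> Obj K" "s \<in> Arr K" "Dom K s = SO Z" "Cod K s = Dom K h"
        "s' \<in> Arr K" "Dom K s' = Dom K h" "Cod K s' = SO Z" "s \<cdot> s' = Idt K (Dom K h)"
        "s' \<cdot> s = Idt K (SO Z)"
        "k \<in> Arr K" "Dom K k = Z" "Cod K k = Dom K f" "SA k = h \<cdot> s"
        by (rule desuspend[of h "Dom K f"]) simp_all
      note [simp] = s(1-12) x(1-3)
      obtain y where y: "y \<in> Arr K" "Dom K y = P" "Cod K y = Z" "SA y = s' \<cdot> x"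
        by (rule susp_surj[of "s' \<cdot> x" P Z]) simp_all
      have "SA k \<in> N" unfolding s(13) by (rule N_right) (use h in simp_all)
      then have "k \<in> N" using N_Susp s(10) by blast
      moreover have "y \<in> Hom K P (Dom K k)" using y by simp
      ultimately have "k \<cdot> y = Zro K P (Cod K k)" using P by blast
      then have ky: "k \<cdot> y = Zro K P (Dom K f)" by simp
      have "SA u = (h \<cdot> s) \<cdot> (s' \<cdot> x)" by (simp add: Comp_reduce[OF s(8)] x(4))
      also have "\<dots> = SA (k \<cdot> y)" using y by (simp add: s(13)[symmetric] y(4)[symmetric] del: Comp_assoc')
      finally have "SA u = SA (Zro K P (Dom K f))" unfolding ky .
      then show ?thesis by - (rule susp_inj, simp_all)
    qed
    moreover have "\<exists>x \<in> Hom K P (Dom K g). g \<cdot> x = u" if u: "u \<in> Hom K P (Dom K h)" for u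
    proof -
      have "h \<cdot> u = Zro K P (Cod K h)" using P h u by blast
      then have "h \<cdot> u = Zro K (Dom K u) (SO (Dom K f))" using u by simp
      then obtain x where "x \<in> Arr K" "Dom K x = Dom K u" "Cod K x = Dom K g" "g \<cdot> x = u"
        using Dist_exact2[OF T, of u] u by auto
      then have "x \<in> Hom K P (Dom K g)" "g \<cdot> x = u" using u by simp_all
      then show ?thesis by blast
    qed
    ultimately show ?thesis using short_exact_from[OF T, of P] by simp
  qed
  then show "P \<in> projectives K phantom_triangles" by (auto simp: projectives_def)
qed

text \<open>Since \<open>N\<close> is stable under desuspension, \<open>h\<close> may be taken to
  be a suspension. By \<open>Dist_extend\<close> the conclusion says that \<open>u\<close> extends
  along the first arrow of a phantom triangle with last arrow \<open>h\<close>.\<close>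

lemma susp_kills:
  assumes h: "h \<in> N" and u: "u \<in> Arr K" "SO (Dom K u) = Cod K h"
    and I: "\<And>k x. \<lbrakk>k \<in> N; x \<in> Hom K (Cod K k) (Cod K u)\<rbrakk> \<Longrightarrow> x \<cdot> k = Zro K (Dom K k) (Cod K u)"
  shows "SA u \<cdot> h = Zro K (Dom K h) (SO (Cod K u))"
proof -
  have [simp]: "h \<in> Arr K" using h N_Arr by blast
  obtain Z s s' k where s: "Z \<in> Obj K" "s \<in> Arr K" "Dom K s = SO Z" "Cod K s = Dom K h"
    "s' \<in> Arr K" "Dom K s' = Dom K h" "Cod K s' = SO Z" "s \<cdot> s' = Idt K (Dom K h)"
    "s' \<cdot> s = Idt K (SO Z)"
    "k \<in> Arr K" "Dom K k = Z" "Cod K k = Dom K u" "SA k = h \<cdot> s"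
    by (rule desuspend[of h "Dom K u"]) (use u in simp_all)
  note [simp] = s(1-12) u(1) u(2)[symmetric]
  have "SA k \<in> N" unfolding s(13) by (rule N_right) (use h in simp_all)
  then have "k \<in> N" using N_Susp s(10) by blast
  then have uk: "u \<cdot> k = Zro K Z (Cod K u)" using I[of k u] by simp
  have "SA u \<cdot> h = (SA u \<cdot> (h \<cdot> s)) \<cdot> s'" by simp
  also have "\<dots> = SA (u \<cdot> k) \<cdot> s'" by (simp add: s(13)[symmetric] del: Comp_assoc')
  finally show ?thesis unfolding uk by simp
qed

lemma injectives_iff:
  "I \<in> injectives K phantom_triangles \<longleftrightarrow> I \<in> Obj K \<and>
     (\<forall>h \<in> N. \<forall>u \<in> Hom K (Cod K h) I. u \<cdot> h = Zro K (Dom K h) I)"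
proof (intro iffI conjI ballI)
  assume I: "I \<in> injectives K phantom_triangles"
  then show Io: "I \<in> Obj K" by (simp add: injectives_def)
  fix h u assume h: "h \<in> N" and u: "u \<in> Hom K (Cod K h) I"
  have [simp]: "h \<in> Arr K" using h N_Arr by blast
  obtain X s s' where s: "X \<in> Obj K" "s \<in> Arr K" "Dom K s = SO X" "Cod K s = Cod K h"
    "s' \<in> Arr K" "Dom K s' = Cod K h" "Cod K s' = SO X" "s \<cdot> s' = Idt K (Cod K h)"
    by (metis desuspend_object Cod_Obj \<open>h \<in> Arr K\<close>)
  obtain f g where T: "(f, g, s' \<cdot> h) \<in> Dist K" "Dom K f = X"
    by (rule Dist_cocone[of "s' \<cdot> h" X]) (use s in simp_all)
  have "(f, g, s' \<cdot> h) \<in> phantom_triangles" using T s h N_left by (simp add: phantom_triangles_iff)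
  then have i: "\<forall>x \<in> Hom K (Dom K (s' \<cdot> h)) I. x \<cdot> g = Zro K (Dom K g) I \<longrightarrow>
      x = Zro K (Dom K (s' \<cdot> h)) I"
    using I short_exact_to[OF T(1) Io] unfolding injectives_def by blast
  have [simp]: "g \<in> Arr K" "Cod K g = Dom K h" using DistD[OF T(1)] s by simp_all
  have z: "(s' \<cdot> h) \<cdot> g = Zro K (Dom K g) (SO X)" using Dist_comp_zero2[OF T(1)] T(2) by simp
  have "(u \<cdot> h) \<cdot> g = (u \<cdot> s) \<cdot> ((s' \<cdot> h) \<cdot> g)" using s u by (simp add: Comp_reduce[OF s(8)])
  also have "\<dots> = Zro K (Dom K g) I" unfolding z using s u by simp
  finally have z': "(u \<cdot> h) \<cdot> g = Zro K (Dom K g) I" .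
  have "u \<cdot> h \<in> Hom K (Dom K (s' \<cdot> h)) I" using u s by simp
  then have "u \<cdot> h = Zro K (Dom K (s' \<cdot> h)) I" using i z' by blast
  then show "u \<cdot> h = Zro K (Dom K h) I" using s by simp
next
  assume I: "I \<in> Obj K \<and> (\<forall>h \<in> N. \<forall>u \<in> Hom K (Cod K h) I. u \<cdot> h = Zro K (Dom K h) I)"
  then have [simp]: "I \<in> Obj K" by simp
  have "short_exact_sequence (Hom_group K (Dom K f) I) (Hom_group K (Dom K g) I)
      (Hom_group K (Dom K h) I) (\<lambda>u. u \<cdot> f) (\<lambda>u. u \<cdot> g)"
    if E: "(f, g, h) \<in> phantom_triangles" for f g h
  proof -
    have T: "(f, g, h) \<in> Dist K" and h: "h \<in> N" using E by (simp_all add: phantom_triangles_iff)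
    note [simp] = DistD[OF T]
    have "u = Zro K (Dom K h) I" if u: "u \<in> Hom K (Dom K h) I" "u \<cdot> g = Zro K (Dom K g) I" for u
    proof -
      obtain x where "x \<in> Arr K" "Dom K x = SO (Dom K f)" "Cod K x = Cod K u" "x \<cdot> h = u"
        using Dist_coexact3[OF T, of u] u by auto
      then have x: "x \<in> Hom K (Cod K h) I" "x \<cdot> h = u" using u by simp_all
      then show ?thesis using I h by blast
    qed
    moreover have "\<exists>x \<in> Hom K (Dom K g) I. x \<cdot> f = u" if u: "u \<in> Hom K (Dom K f) I" for u
    proof -
      have "SA u \<cdot> h = Zro K (Dom K h) (SO (Cod K u))"
      proof (rule susp_kills[OF h])
        fix k x assume "k \<in> N" "x \<in> Hom K (Cod K k) (Cod K u)"
        moreover have "Cod K u = I" using u by simp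
        ultimately show "x \<cdot> k = Zro K (Dom K k) (Cod K u)" using I by blast
      qed (use u in simp_all)
      then obtain x where "x \<in> Arr K" "Dom K x = Dom K g" "Cod K x = Cod K u" "x \<cdot> f = u"
        using Dist_extend[OF T, of u] u by auto
      then have "x \<in> Hom K (Dom K g) I" "x \<cdot> f = u" using u by simp_all
      then show ?thesis by blast
    qed
    ultimately show ?thesis using short_exact_to[OF T, of I] by simp
  qed
  then show "I \<in> injectives K phantom_triangles" by (auto simp: injectives_def)
qed

lemma projectives_sum:
  assumes AB: "A \<in> projectives K phantom_triangles" "B \<in> projectives K phantom_triangles"
    and S: "direct_sum K A B S"
  shows "S \<in> projectives K phantom_triangles"
proof -
  obtain i j p q where S: "is_biproduct K A B S i j p q" using S unfolding direct_sum_def by blast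
  note [simp] = biproductD[OF S]
  have "h \<cdot> u = Zro K S (Cod K h)" if h: "h \<in> N" and u: "u \<in> Hom K S (Dom K h)" for h u
  proof -
    have [simp]: "h \<in> Arr K" using h N_Arr by blast
    have [simp]: "u \<in> Arr K" "Dom K u = S" "Cod K u = Dom K h" using u by auto
    have "u \<cdot> i \<in> Hom K A (Dom K h)" "u \<cdot> j \<in> Hom K B (Dom K h)" by simp_all
    then have "h \<cdot> (u \<cdot> i) = Zro K A (Cod K h)" "h \<cdot> (u \<cdot> j) = Zro K B (Cod K h)"
      using AB h unfolding projectives_iff by blast+
    then show ?thesis using biproduct_out[OF S, of "h \<cdot> u"] by simp
  qed
  then show ?thesis unfolding projectives_iff by simp
qed

lemma projectives_summand:
  assumes S: "S \<in> projectives K phantom_triangles" "direct_sum K X Y S"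
  shows "X \<in> projectives K phantom_triangles"
proof -
  obtain i j p q where B: "is_biproduct K X Y S i j p q" using S unfolding direct_sum_def by blast
  note [simp] = biproductD[OF B]
  have "h \<cdot> u = Zro K X (Cod K h)" if h: "h \<in> N" and u: "u \<in> Hom K X (Dom K h)" for h u
  proof -
    have [simp]: "h \<in> Arr K" using h N_Arr by blast
    have [simp]: "u \<in> Arr K" "Dom K u = X" "Cod K u = Dom K h" using u by auto
    have "u \<cdot> p \<in> Hom K S (Dom K h)" by simp
    then have z: "h \<cdot> (u \<cdot> p) = Zro K S (Cod K h)"
      using S(1) h unfolding projectives_iff by blast
    have "h \<cdot> u = (h \<cdot> (u \<cdot> p)) \<cdot> i" by simp
    then show ?thesis unfolding z by simp
  qed
  then show ?thesis unfolding projectives_iff by simp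
qed

lemma injectives_sum:
  assumes AB: "A \<in> injectives K phantom_triangles" "B \<in> injectives K phantom_triangles"
    and S: "direct_sum K A B S"
  shows "S \<in> injectives K phantom_triangles"
proof -
  obtain i j p q where S: "is_biproduct K A B S i j p q" using S unfolding direct_sum_def by blast
  note [simp] = biproductD[OF S]
  have "u \<cdot> h = Zro K (Dom K h) S" if h: "h \<in> N" and u: "u \<in> Hom K (Cod K h) S" for h u
  proof -
    have [simp]: "h \<in> Arr K" using h N_Arr by blast
    have [simp]: "u \<in> Arr K" "Cod K u = S" "Dom K u = Cod K h" using u by auto
    have "p \<cdot> u \<in> Hom K (Cod K h) A" "q \<cdot> u \<in> Hom K (Cod K h) B" by simp_all
    then have "(p \<cdot> u) \<cdot> h = Zro K (Dom K h) A" "(q \<cdot> u) \<cdot> h = Zro K (Dom K h) B"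
      using AB h unfolding injectives_iff by blast+
    then show ?thesis using biproduct_in[OF S, of "u \<cdot> h"] by simp
  qed
  then show ?thesis unfolding injectives_iff by simp
qed

lemma injectives_summand:
  assumes S: "S \<in> injectives K phantom_triangles" "direct_sum K X Y S"
  shows "X \<in> injectives K phantom_triangles"
proof -
  obtain i j p q where B: "is_biproduct K X Y S i j p q" using S unfolding direct_sum_def by blast
  note [simp] = biproductD[OF B]
  have "u \<cdot> h = Zro K (Dom K h) X" if h: "h \<in> N" and u: "u \<in> Hom K (Cod K h) X" for h u
  proof -
    have [simp]: "h \<in> Arr K" using h N_Arr by blast
    have [simp]: "u \<in> Arr K" "Cod K u = X" "Dom K u = Cod K h" using u by auto
    have "i \<cdot> u \<in> Hom K (Cod K h) S" by simp
    then have z: "(i \<cdot> u) \<cdot> h = Zro K (Dom K h) S"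
      using S(1) h unfolding injectives_iff by blast
    have "u \<cdot> h = p \<cdot> ((i \<cdot> u) \<cdot> h)" by simp
    then show ?thesis unfolding z by simp
  qed
  then show ?thesis unfolding injectives_iff by simp
qed

lemma zero_projective_injective:
  assumes Z: "zero_object K Z"
  shows "Z \<in> projectives K phantom_triangles" "Z \<in> injectives K phantom_triangles"
proof -
  have [simp]: "Z \<in> Obj K" using Z by simp
  show "Z \<in> projectives K phantom_triangles"
    unfolding projectives_iff using zero_object_unique[OF Z] N_Arr by auto
  show "Z \<in> injectives K phantom_triangles"
    unfolding injectives_iff using zero_object_unique[OF Z] N_Arr by auto
qed

end

section \<open>The stable category of a Frobenius ideal\<close>

text \<open>Enough injectives are provided by the choice \<open>t\<close>.\<close>

locale frobenius_ideal = phantom_ideal K N for K :: "('o, 'm, 'x) tricat_scheme" (structure) and N +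
  fixes t :: "'o \<Rightarrow> 'm triangle"
  assumes enough_projectives: "Y \<in> Obj K \<Longrightarrow>
      \<exists>f g h. (f, g, h) \<in> phantom_triangles \<and> Dom K h = Y \<and> Dom K g \<in> projectives K phantom_triangles"
    and projective_injective: "projectives K phantom_triangles = injectives K phantom_triangles"
    and choice: "injective_choice K phantom_triangles t"
begin

abbreviation \<P> :: "'o set" where "\<P> \<equiv> projectives K phantom_triangles"
abbreviation q :: "'m \<Rightarrow> 'm set" where "q \<equiv> quot_map K \<P>"
abbreviation S :: "('o, 'm set) tricat" where "S \<equiv> stable_tricat K phantom_triangles t"

text \<open>The chosen triangle of \<open>X\<close> is \<open>X \<rightarrow> I \<rightarrow> X'
  \<rightarrow> \<Sigma>X\<close> with arrows \<open>\<iota>\<close>, \<open>\<nu>\<close>,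
  \<open>\<omega>\<close>; the objects \<open>I\<close> and \<open>X'\<close> are written as the
  domains of \<open>\<nu>\<close> and \<open>\<omega>\<close>.\<close>

definition \<iota> :: "'o \<Rightarrow> 'm" where "\<iota> X = fst (t X)"
definition \<nu> :: "'o \<Rightarrow> 'm" where "\<nu> X = fst (snd (t X))"
definition \<omega> :: "'o \<Rightarrow> 'm" where "\<omega> X = snd (snd (t X))"

lemma t_eq: "t X = (\<iota> X, \<nu> X, \<omega> X)"
  by (simp add: \<iota>_def \<nu>_def \<omega>_def)

lemma t_Dist: "X \<in> Obj K \<Longrightarrow> (\<iota> X, \<nu> X, \<omega> X) \<in> Dist K"
  using choice unfolding injective_choice_def by (auto simp: t_eq)

lemma t_simps [simp]:
  assumes "X \<in> Obj K"
  shows "\<iota> X \<in> Arr K" "\<nu> X \<in> Arr K" "\<omega> X \<in> Arr K" "Dom K (\<iota> X) = X"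
    "Cod K (\<iota> X) = Dom K (\<nu> X)" "Cod K (\<nu> X) = Dom K (\<omega> X)" "Cod K (\<omega> X) = SO X"
proof -
  show D: "Dom K (\<iota> X) = X" using choice assms unfolding injective_choice_def by (auto simp: t_eq)
  show "\<iota> X \<in> Arr K" "\<nu> X \<in> Arr K" "\<omega> X \<in> Arr K"
    "Cod K (\<iota> X) = Dom K (\<nu> X)" "Cod K (\<nu> X) = Dom K (\<omega> X)" "Cod K (\<omega> X) = SO X"
    using DistD[OF t_Dist[OF assms]] D by simp_all
qed

lemma \<nu>_Dom: "X \<in> Obj K \<Longrightarrow> Dom K (\<nu> X) \<in> \<P>"
  using choice unfolding injective_choice_def projective_injective by (auto simp: t_eq simp flip: t_simps(5))

text \<open>The choice only says that \<open>\<iota>\<close> starts some phantom triangle;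
  comparison with it shows that \<open>\<omega>\<close> is a phantom.\<close>

lemma \<omega>_N:
  assumes X: "X \<in> Obj K" shows "\<omega> X \<in> N"
proof -
  have "\<iota> X \<in> E_monos K phantom_triangles"
    using choice X unfolding injective_choice_def by (auto simp: t_eq)
  then obtain g h where T: "(\<iota> X, g, h) \<in> Dist K" and h: "h \<in> N"
    unfolding E_monos_def phantom_triangles_def by auto
  note [simp] = X DistD[OF T]
  have [simp]: "Dom K g = Dom K (\<nu> X)" using DistD(4)[OF T] t_simps(5)[OF X] by metis
  have [simp]: "Cod K h = SO X" by simp
  obtain c where c: "tri_mor K (\<iota> X, \<nu> X, \<omega> X) (\<iota> X, g, h) (Idt K X) (Idt K (Dom K (\<nu> X))) c"
    using TR3[OF t_Dist[OF X] T, of "Idt K X" "Idt K (Dom K (\<nu> X))"] by auto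
  have "\<omega> X = h \<cdot> c" using tri_morD(14)[OF c] by simp
  then show ?thesis using N_right[OF h] tri_morD[OF c] by simp
qed

lemma phantom_projective:
  assumes "h \<in> N" "u \<in> Arr K" "Cod K u = Dom K h" "Dom K u \<in> \<P>"
  shows "h \<cdot> u = Zro K (Dom K u) (Cod K h)"
proof -
  have "u \<in> Hom K (Dom K u) (Dom K h)" using assms by simp
  then show ?thesis using assms(1,4) unfolding projectives_iff by blast
qed

lemma injective_phantom_susp:
  assumes h: "h \<in> N" and u: "u \<in> Arr K" "Cod K h = SO (Dom K u)" "Cod K u \<in> \<P>"
  shows "SA u \<cdot> h = Zro K (Dom K h) (SO (Cod K u))"
  by (rule susp_kills[OF h u(1) u(2)[symmetric]])
    (use u(3)[unfolded projective_injective injectives_iff] in blast)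

sublocale Q: additive_ideal_quotient K \<P>
proof unfold_locales
  show "\<P> \<subseteq> Obj K" by (auto simp: projectives_def)
  show "\<P> \<noteq> {}" using zero_projective_injective zero_object_exists by blast
qed (rule projectives_sum)

lemma factoring_phantom:
  assumes d: "d \<in> factoring K \<P>" and h: "h \<in> N" "Cod K d = Dom K h"
  shows "h \<cdot> d = Zro K (Dom K d) (Cod K h)"
proof -
  obtain a b where ab: "a \<in> Arr K" "b \<in> Arr K" "Dom K a = Dom K d" "Cod K a = Dom K b"
    "Cod K b = Cod K d" "Dom K b \<in> \<P>" "d = b \<cdot> a" using d by (rule Q.factoringE)
  have [simp]: "h \<in> Arr K" using h N_Arr by blast
  have "h \<cdot> b = Zro K (Dom K b) (Cod K h)" by (rule phantom_projective) (use h ab(1-6) in simp_all)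
  then have "h \<cdot> (b \<cdot> a) = Zro K (Dom K b) (Cod K h) \<cdot> a"
    by (rule Comp_reduce) (use ab(1-5) h in simp_all)
  then show ?thesis using ab(1-4) by (simp add: ab(7)[symmetric])
qed

lemma factoring_phantom_susp:
  assumes d: "d \<in> factoring K \<P>" and h: "h \<in> N" "Cod K h = SO (Dom K d)"
  shows "SA d \<cdot> h = Zro K (Dom K h) (SO (Cod K d))"
proof -
  obtain a b where ab: "a \<in> Arr K" "b \<in> Arr K" "Dom K a = Dom K d" "Cod K a = Dom K b"
    "Cod K b = Cod K d" "Dom K b \<in> \<P>" "d = b \<cdot> a" using d by (rule Q.factoringE)
  have [simp]: "h \<in> Arr K" using h N_Arr by blast
  have "SA a \<cdot> h = Zro K (Dom K h) (SO (Cod K a))"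
    by (rule injective_phantom_susp) (use h ab(1-6) in simp_all)
  then have "SA b \<cdot> (SA a \<cdot> h) = SA b \<cdot> Zro K (Dom K h) (SO (Cod K a))" by simp
  moreover have "SA d = SA b \<cdot> SA a" using ab(1-4) by (simp add: ab(7))
  ultimately show ?thesis using ab(1-5) h(2) by simp
qed

lemma S_fields:
  "Obj S = Obj (quot_cat K \<P>)" "Arr S = Arr (quot_cat K \<P>)" "Dom S = Dom (quot_cat K \<P>)"
  "Cod S = Cod (quot_cat K \<P>)" "Idt S = Idt (quot_cat K \<P>)" "Comp S = Comp (quot_cat K \<P>)"
  "Add S = Add (quot_cat K \<P>)" "Zro S = Zro (quot_cat K \<P>)"
  "Susp S = stable_susp K phantom_triangles t"
  by (simp_all add: stable_tricat_def stable_suspcat_def suspcat.defs addcat.defs tricat.defs)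

lemma tri_isomorphic_S:
  "tri_isomorphic (stable_suspcat K phantom_triangles t) T T' = tri_isomorphic S T T'"
proof -
  have f: "Obj S = Obj (stable_suspcat K phantom_triangles t)" "Arr S = Arr (stable_suspcat K phantom_triangles t)"
    "Dom S = Dom (stable_suspcat K phantom_triangles t)" "Cod S = Cod (stable_suspcat K phantom_triangles t)"
    "Idt S = Idt (stable_suspcat K phantom_triangles t)" "Comp S = Comp (stable_suspcat K phantom_triangles t)"
    "Susp S = Susp (stable_suspcat K phantom_triangles t)"
    by (simp_all add: stable_tricat_def stable_suspcat_def suspcat.defs addcat.defs tricat.defs)
  have "tri_mor S T T' a b c = tri_mor (stable_suspcat K phantom_triangles t) T T' a b c" for a b c
    by (cases T; cases T') (simp only: tri_mor.simps triangles_def Hom_def f)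
  moreover have "is_iso S a = is_iso (stable_suspcat K phantom_triangles t) a" for a
    by (simp only: is_iso_def Hom_def f)
  ultimately show ?thesis by (simp only: tri_isomorphic_def)
qed

lemma Dist_S: "Dist S = {T. \<exists>T' \<in> standard_triangles K phantom_triangles t. tri_isomorphic S T T'}"
  unfolding tri_isomorphic_S[symmetric]
  by (simp add: stable_tricat_def stable_suspcat_def suspcat.defs addcat.defs tricat.defs)

sublocale I: additive_image K S q
  by unfold_locales (simp_all add: S_fields Q.quot_cat_simps)

sublocale S: additive_category S
  by (rule I.im_additive)

lemmas S_simps [simp] = I.Obj_im I.Comp_im I.Add_im I.Zro_im I.Idt_im

lemma Neg_im [simp]: "f \<in> Arr K \<Longrightarrow> Neg S (q f) = q (Neg K f)"
  using S.Neg_unique[of "q f" "q (Neg K f)"] by simp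

lemma q_eqI:
  assumes "f \<in> Arr K" "g \<in> Arr K" "Dom K f = Dom K g" "Cod K f = Cod K g"
    "f \<boxplus> Neg K g \<in> factoring K \<P>"
  shows "q f = q g"
  using assms by (simp add: Q.quot_map_eq_iff)

lemma q_eqD:
  assumes "q f = q g" "f \<in> Arr K" "g \<in> Arr K"
  shows "Dom K f = Dom K g" "Cod K f = Cod K g" "f \<boxplus> Neg K g \<in> factoring K \<P>"
  using assms by (simp_all add: Q.quot_map_eq_iff)

text \<open>The composite of a phantom with \<open>\<Sigma>\<iota>\<close> vanishes since
  \<open>I\<close> is injective.\<close>

lemma phantom_lift:
  assumes h: "h \<in> N" "Cod K h = SO X" "X \<in> Obj K"
  obtains d where "d \<in> Arr K" "Dom K d = Dom K h" "Cod K d = Dom K (\<omega> X)" "\<omega> X \<cdot> d = h"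
proof -
  have [simp]: "h \<in> Arr K" using h N_Arr by blast
  have "SA (\<iota> X) \<cdot> h = Zro K (Dom K h) (SO (Cod K (\<iota> X)))"
    by (rule injective_phantom_susp) (use h \<nu>_Dom in simp_all)
  then show ?thesis using Dist_exact3[OF t_Dist[OF h(3)], of h] h that by auto
qed

text \<open>An arrow into \<open>X'\<close> that factors through a projective is annihilated by
  the phantom \<open>\<omega>\<close>; one annihilated by \<open>\<omega>\<close> factors through
  \<open>\<nu>\<close>, hence through \<open>I\<close>. Together with the previous lemma, stable
  arrows into \<open>X'\<close> are the same as phantoms into \<open>\<Sigma>X\<close>.\<close>

lemma q_eq_iff:
  assumes a: "a \<in> Arr K" "Cod K a = Dom K (\<omega> X)" and b: "b \<in> Arr K" "Cod K b = Dom K (\<omega> X)"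
    and X: "X \<in> Obj K" and ab: "Dom K a = Dom K b"
  shows "q a = q b \<longleftrightarrow> \<omega> X \<cdot> a = \<omega> X \<cdot> b"
proof
  note [simp] = a b X ab
  assume "q a = q b"
  then have "a \<boxplus> Neg K b \<in> factoring K \<P>" by (rule q_eqD) simp_all
  then have "\<omega> X \<cdot> (a \<boxplus> Neg K b) = Zro K (Dom K (a \<boxplus> Neg K b)) (Cod K (\<omega> X))"
    by (rule factoring_phantom[OF _ \<omega>_N]) simp_all
  then have "\<omega> X \<cdot> a \<boxplus> Neg K (\<omega> X \<cdot> b) = Zro K (Dom K b) (SO X)" by simp
  then show "\<omega> X \<cdot> a = \<omega> X \<cdot> b" by (rule Sub_eq_Zro[rotated 4]) simp_all
next
  note [simp] = a b X ab
  assume "\<omega> X \<cdot> a = \<omega> X \<cdot> b"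
  then have "\<omega> X \<cdot> (a \<boxplus> Neg K b) = Zro K (Dom K (a \<boxplus> Neg K b)) (SO (Dom K (\<iota> X)))" by simp
  then obtain x where x: "x \<in> Arr K" "Dom K x = Dom K b" "Cod K x = Dom K (\<nu> X)" "\<nu> X \<cdot> x = a \<boxplus> Neg K b"
    using Dist_exact2[OF t_Dist[OF X], of "a \<boxplus> Neg K b"] by auto
  have "\<nu> X \<cdot> x \<in> factoring K \<P>" by (rule Q.factoringI) (use x(1-3) \<nu>_Dom in simp_all)
  then show "q a = q b" unfolding x(4) by (rule q_eqI[rotated 4]) simp_all
qed

definition shift_arr :: "'m \<Rightarrow> 'm" where
  "shift_arr f = (SOME d. d \<in> Arr K \<and> Dom K d = Dom K (\<omega> (Dom K f)) \<and>
     Cod K d = Dom K (\<omega> (Cod K f)) \<and> \<omega> (Cod K f) \<cdot> d = SA f \<cdot> \<omega> (Dom K f))"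

lemma shift_arr:
  assumes f: "f \<in> Arr K"
  shows "shift_arr f \<in> Arr K" "Dom K (shift_arr f) = Dom K (\<omega> (Dom K f))"
     "Cod K (shift_arr f) = Dom K (\<omega> (Cod K f))" "\<omega> (Cod K f) \<cdot> shift_arr f = SA f \<cdot> \<omega> (Dom K f)"
proof -
  have "SA f \<cdot> \<omega> (Dom K f) \<in> N" by (rule N_left[OF \<omega>_N]) (use f in simp_all)
  then obtain d where "d \<in> Arr K" "Dom K d = Dom K (SA f \<cdot> \<omega> (Dom K f))" "Cod K d = Dom K (\<omega> (Cod K f))"
    "\<omega> (Cod K f) \<cdot> d = SA f \<cdot> \<omega> (Dom K f)"
    by (rule phantom_lift[of _ "Cod K f"]) (use f in simp_all)
  then have "\<exists>d. d \<in> Arr K \<and> Dom K d = Dom K (\<omega> (Dom K f)) \<and>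
     Cod K d = Dom K (\<omega> (Cod K f)) \<and> \<omega> (Cod K f) \<cdot> d = SA f \<cdot> \<omega> (Dom K f)"
    using f by auto
  from someI_ex[OF this]
  show "shift_arr f \<in> Arr K" "Dom K (shift_arr f) = Dom K (\<omega> (Dom K f))"
     "Cod K (shift_arr f) = Dom K (\<omega> (Cod K f))" "\<omega> (Cod K f) \<cdot> shift_arr f = SA f \<cdot> \<omega> (Dom K f)"
    unfolding shift_arr_def by blast+
qed

lemmas shift_arr_simps [simp] = shift_arr(1-3)

lemma Susp_S_OMap [simp]: "X \<in> Obj K \<Longrightarrow> OMap (Susp S) X = Dom K (\<omega> X)"
  by (simp add: S_fields stable_susp_def t_eq)

text \<open>Any two candidates have the same composite with \<open>\<omega>\<close>, because two
  representatives of the same stable arrow differ by an arrow through an injective, whose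
  suspension annihilates \<open>\<omega>\<close>.\<close>

lemma Susp_S_AMap:
  assumes f: "f \<in> Arr K" and d: "d \<in> Arr K" "Dom K d = Dom K (\<omega> (Dom K f))"
    "Cod K d = Dom K (\<omega> (Cod K f))" "\<omega> (Cod K f) \<cdot> d = SA f \<cdot> \<omega> (Dom K f)"
  shows "AMap (Susp S) (q f) = q d"
proof -
  note [simp] = f d(1-3)
  have "(THE \<psi>. \<exists>f0 \<in> q f. \<exists>u f'. tri_mor K (t (Dom K f0)) (t (Cod K f0)) f0 u f' \<and> \<psi> = q f') = q d"
  proof (rule the_equality)
    have [simp]: "Dom K f \<in> Obj K" "Cod K f \<in> Obj K" by simp_all
    obtain u where "tri_mor K (\<iota> (Dom K f), \<nu> (Dom K f), \<omega> (Dom K f))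
        (\<iota> (Cod K f), \<nu> (Cod K f), \<omega> (Cod K f)) f u d"
      by (rule TR3_second[OF t_Dist[of "Dom K f"] t_Dist[of "Cod K f"] _ _ _ _ _ _ d(4)[symmetric]])
        simp_all
    then have "tri_mor K (t (Dom K f)) (t (Cod K f)) f u d" by (simp only: t_eq)
    then have "\<exists>u f'. tri_mor K (t (Dom K f)) (t (Cod K f)) f u f' \<and> q d = q f'" by blast
    then show "\<exists>f0 \<in> q f. \<exists>u f'. tri_mor K (t (Dom K f0)) (t (Cod K f0)) f0 u f' \<and> q d = q f'"
      by (rule bexI[OF _ Q.quot_map_self[OF f]])
  next
    fix \<psi> assume "\<exists>f0 \<in> q f. \<exists>u f'. tri_mor K (t (Dom K f0)) (t (Cod K f0)) f0 u f' \<and> \<psi> = q f'"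
    then show "\<psi> = q d"
    proof (elim bexE exE conjE)
    fix f0 u f' assume f0: "f0 \<in> q f" and m': "tri_mor K (t (Dom K f0)) (t (Cod K f0)) f0 u f'" and \<psi>: "\<psi> = q f'"
    have m: "tri_mor K (\<iota> (Dom K f0), \<nu> (Dom K f0), \<omega> (Dom K f0))
        (\<iota> (Cod K f0), \<nu> (Cod K f0), \<omega> (Cod K f0)) f0 u f'" using m' by (simp only: t_eq)
    have f0A: "f0 \<in> Arr K" and qf0: "q f0 = q f" using f0 unfolding Q.quot_map_mem[OF f] by blast+
    note [simp] = f0A q_eqD(1,2)[OF qf0 f0A f]
    note M = tri_morD(9-11,14)[OF m, simplified]
    note [simp] = M(1-3)
    have "f0 \<boxplus> Neg K f \<in> factoring K \<P>" using q_eqD[OF qf0] by simp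
    then have "SA (f0 \<boxplus> Neg K f) \<cdot> \<omega> (Dom K f) = Zro K (Dom K (\<omega> (Dom K f))) (SO (Cod K (f0 \<boxplus> Neg K f)))"
      by (rule factoring_phantom_susp[OF _ \<omega>_N]) simp_all
    then have "SA f0 \<cdot> \<omega> (Dom K f) \<boxplus> Neg K (SA f \<cdot> \<omega> (Dom K f)) = Zro K (Dom K (\<omega> (Dom K f))) (SO (Cod K f))"
      by simp
    then have "SA f0 \<cdot> \<omega> (Dom K f) = SA f \<cdot> \<omega> (Dom K f)"
      by (rule Sub_eq_Zro[rotated 4]) simp_all
    then have "\<omega> (Cod K f) \<cdot> f' = \<omega> (Cod K f) \<cdot> d" using M(4) d(4) by simp
    then show "\<psi> = q d" unfolding \<psi> by (subst q_eq_iff) simp_all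
    qed
  qed
  then show ?thesis by (simp add: S_fields stable_susp_def)
qed

lemma Susp_S_shift: "f \<in> Arr K \<Longrightarrow> AMap (Susp S) (q f) = q (shift_arr f)"
  by (rule Susp_S_AMap) (use shift_arr in simp_all)

lemma Susp_S_functor: "is_functor S S (Susp S)"
  unfolding is_functor_def
proof (intro conjI ballI impI)
  fix X assume "X \<in> Obj S"
  then have X: "X \<in> Obj K" by simp
  show "OMap (Susp S) X \<in> Obj S" using X by simp
  have "AMap (Susp S) (q (Idt K X)) = q (Idt K (Dom K (\<omega> X)))"
    by (rule Susp_S_AMap) (use X in simp_all)
  then show "AMap (Susp S) (Idt S X) = Idt S (OMap (Susp S) X)" using X by simp
next
  fix f assume "f \<in> Arr S"
  then obtain f0 where f0: "f0 \<in> Arr K" "f = q f0" by (rule I.im_lift)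
  then show "AMap (Susp S) f \<in> Hom S (OMap (Susp S) (Dom S f)) (OMap (Susp S) (Cod S f))"
    by (simp add: Susp_S_shift)
next
  fix f g assume f: "f \<in> Arr S" and g: "g \<in> Arr S" and fg: "Cod S f = Dom S g"
  obtain f0 where f0: "f0 \<in> Arr K" "f = q f0" using f by (rule I.im_lift)
  obtain g0 where g0: "g0 \<in> Arr K" "g = q g0" using g by (rule I.im_lift)
  have [simp]: "Cod K f0 = Dom K g0" using fg f0 g0 by simp
  note [simp] = f0(1) g0(1)
  have "\<omega> (Cod K g0) \<cdot> (shift_arr g0 \<cdot> shift_arr f0) = SA g0 \<cdot> (SA f0 \<cdot> \<omega> (Dom K f0))"
    using shift_arr(4)[of f0] Comp_reduce[OF shift_arr(4)[of g0]] by simp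
  then have "AMap (Susp S) (q (g0 \<cdot> f0)) = q (shift_arr g0 \<cdot> shift_arr f0)"
    by - (rule Susp_S_AMap, simp_all)
  then show "AMap (Susp S) (g \<cdot>\<^bsub>S\<^esub> f) = AMap (Susp S) g \<cdot>\<^bsub>S\<^esub> AMap (Susp S) f"
    by (simp add: f0(2) g0(2) Susp_S_shift)
qed (rule S.category_axioms)+

lemma Susp_S_additive: "is_additive_functor S S (Susp S)"
  unfolding is_additive_functor_def
proof (intro conjI ballI impI)
  fix f g assume f: "f \<in> Arr S" and g: "g \<in> Arr S" and fg: "Dom S f = Dom S g \<and> Cod S f = Cod S g"
  obtain f0 where f0: "f0 \<in> Arr K" "f = q f0" using f by (rule I.im_lift)
  obtain g0 where g0: "g0 \<in> Arr K" "g = q g0" using g by (rule I.im_lift)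
  have [simp]: "Dom K f0 = Dom K g0" "Cod K f0 = Cod K g0" using fg f0 g0 by simp_all
  note [simp] = f0(1) g0(1)
  have "\<omega> (Cod K g0) \<cdot> (shift_arr f0 \<boxplus> shift_arr g0) = SA (f0 \<boxplus> g0) \<cdot> \<omega> (Dom K g0)"
    using shift_arr(4)[of f0] shift_arr(4)[of g0] by simp
  then have "AMap (Susp S) (q (f0 \<boxplus> g0)) = q (shift_arr f0 \<boxplus> shift_arr g0)"
    by - (rule Susp_S_AMap, simp_all)
  then show "AMap (Susp S) (f \<boxplus>\<^bsub>S\<^esub> g) = AMap (Susp S) f \<boxplus>\<^bsub>S\<^esub> AMap (Susp S) g"
    by (simp add: f0(2) g0(2) Susp_S_shift)
qed (rule Susp_S_functor)

sublocale S: suspended_category S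
  by unfold_locales (rule Susp_S_additive)

text \<open>Faithful: if \<open>\<Sigma>f \<omega> = 0\<close> then \<open>f\<close> extends along
  \<open>\<iota>\<close>. Full: for \<open>u : X' \<rightarrow> Y'\<close> the phantom
  \<open>\<omega> u\<close> vanishes on the projective \<open>I\<close>, hence factors through
  \<open>\<omega>\<close> by an arrow of the form \<open>\<Sigma>f\<close>. Essentially
  surjective: for a phantom triangle \<open>X \<rightarrow> P \<rightarrow> Y \<rightarrow>
  \<Sigma>X\<close> with \<open>P\<close> projective, both \<open>Y\<close> and \<open>X'\<close>
  carry a phantom into \<open>\<Sigma>X\<close>, and each phantom factors through the
  other.\<close>

lemma Susp_S_equivalence: "is_equivalence S S (Susp S)"
proof (rule is_equivalence_criterion)
  show "is_functor S S (Susp S)" by (rule Susp_S_functor)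
next
  fix f g assume f: "f \<in> Arr S" and g: "g \<in> Arr S" and fg: "Dom S f = Dom S g" "Cod S f = Cod S g"
    and e: "AMap (Susp S) f = AMap (Susp S) g"
  obtain f0 where f0: "f0 \<in> Arr K" "f = q f0" using f by (rule I.im_lift)
  obtain g0 where g0: "g0 \<in> Arr K" "g = q g0" using g by (rule I.im_lift)
  have [simp]: "Dom K f0 = Dom K g0" "Cod K f0 = Cod K g0" using fg f0 g0 by simp_all
  note [simp] = f0(1) g0(1)
  have "q (shift_arr f0) = q (shift_arr g0)" using e by (simp add: f0(2) g0(2) Susp_S_shift)
  then have "\<omega> (Cod K g0) \<cdot> shift_arr f0 = \<omega> (Cod K g0) \<cdot> shift_arr g0"
    by (subst (asm) q_eq_iff) simp_all
  then have "SA (f0 \<boxplus> Neg K g0) \<cdot> \<omega> (Dom K g0) = Zro K (Dom K (\<omega> (Dom K g0))) (SO (Cod K g0))"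
    using shift_arr(4)[of f0] shift_arr(4)[of g0] by simp
  then obtain x where x: "x \<in> Arr K" "Dom K x = Dom K (\<nu> (Dom K g0))" "Cod K x = Cod K g0"
    "x \<cdot> \<iota> (Dom K g0) = f0 \<boxplus> Neg K g0"
    using Dist_extend[OF t_Dist, of "Dom K g0" "f0 \<boxplus> Neg K g0"] by auto
  have "x \<cdot> \<iota> (Dom K g0) \<in> factoring K \<P>"
    by (rule Q.factoringI) (use x(1-3) \<nu>_Dom in simp_all)
  then show "f = g" unfolding x(4) f0(2) g0(2) by (rule q_eqI[rotated 4]) simp_all
next
  fix X Y u assume "X \<in> Obj S" "Y \<in> Obj S" and u: "u \<in> Hom S (OMap (Susp S) X) (OMap (Susp S) Y)"
  then have [simp]: "X \<in> Obj K" "Y \<in> Obj K" by simp_all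
  obtain u0 where u0: "u0 \<in> Arr K" "u = q u0" "Dom K u0 = Dom K (\<omega> X)" "Cod K u0 = Dom K (\<omega> Y)"
    using u by (auto elim!: I.im_lift)
  note [simp] = u0(1,3,4)
  have "(\<omega> Y \<cdot> u0) \<cdot> \<nu> X = Zro K (Dom K (\<nu> X)) (Cod K (\<omega> Y \<cdot> u0))"
    using phantom_projective[OF \<omega>_N[of Y], of "u0 \<cdot> \<nu> X"] \<nu>_Dom by simp
  then obtain x where x: "x \<in> Arr K" "Dom K x = SO X" "Cod K x = SO Y" "x \<cdot> \<omega> X = \<omega> Y \<cdot> u0"
    using Dist_coexact3[OF t_Dist[of X], of "\<omega> Y \<cdot> u0"] by auto
  obtain f where f: "f \<in> Arr K" "Dom K f = X" "Cod K f = Y" "SA f = x"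
    using susp_surj[OF x(1-3)] by auto
  have "AMap (Susp S) (q f) = q u0" by (rule Susp_S_AMap) (use f x(4) in simp_all)
  then show "\<exists>f \<in> Hom S X Y. AMap (Susp S) f = u"
    using f u0(2) by - (rule bexI[of _ "q f"], simp_all)
next
  fix Y assume "Y \<in> Obj S"
  then have Y[simp]: "Y \<in> Obj K" by simp
  obtain f g h where T: "(f, g, h) \<in> Dist K" and h: "h \<in> N" "Dom K h = Y" and g: "Dom K g \<in> \<P>"
    using enough_projectives[OF Y] phantom_triangles_iff by blast
  note [simp] = DistD[OF T] h(2)
  define X where "X = Dom K f"
  have X[simp]: "X \<in> Obj K" "Dom K f = X" by (simp_all add: X_def)
  \<comment> \<open>The two factorisations of the phantoms through each other are stably inverse.\<close>
  obtain d where d: "d \<in> Arr K" "Dom K d = Y" "Cod K d = Dom K (\<omega> X)" "\<omega> X \<cdot> d = h"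
    by (rule phantom_lift[OF h(1), of X]) simp_all
  have "SA f \<cdot> \<omega> X = Zro K (Dom K (\<omega> X)) (SO (Cod K f))"
    by (rule injective_phantom_susp[OF \<omega>_N]) (use g in simp_all)
  then obtain e where e: "e \<in> Arr K" "Dom K e = Dom K (\<omega> X)" "Cod K e = Y" "h \<cdot> e = \<omega> X"
    using Dist_exact3[OF T, of "\<omega> X"] by auto
  note [simp] = d(1-3) e(1-3)
  have 1: "q (d \<cdot> e) = q (Idt K (Dom K (\<omega> X)))"
    by (subst q_eq_iff[of _ X]) (simp_all add: Comp_reduce[OF d(4)] e(4))
  have "h \<cdot> (e \<cdot> d \<boxplus> Neg K (Idt K Y)) = Zro K (Dom K (e \<cdot> d \<boxplus> Neg K (Idt K Y))) (SO (Dom K f))"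
    by (simp add: Comp_reduce[OF e(4)] d(4))
  then obtain x where x: "x \<in> Arr K" "Dom K x = Y" "Cod K x = Dom K g" "g \<cdot> x = e \<cdot> d \<boxplus> Neg K (Idt K Y)"
    using Dist_exact2[OF T, of "e \<cdot> d \<boxplus> Neg K (Idt K Y)"] by auto
  have "g \<cdot> x \<in> factoring K \<P>" by (rule Q.factoringI) (use x(1-3) g in simp_all)
  then have 2: "q (e \<cdot> d) = q (Idt K Y)" unfolding x(4) by (rule q_eqI[rotated 4]) simp_all
  have "is_iso S (q e)" by (rule S.is_isoI[of "q e" "q d"]) (use 1 2 in simp_all)
  then have "isomorphic S (OMap (Susp S) X) Y"
    unfolding isomorphic_def by - (rule bexI[of _ "q e"], simp_all)
  then show "\<exists>X \<in> Obj S. isomorphic S (OMap (Susp S) X) Y"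
    by - (rule bexI[of _ X], simp_all)
qed

end

section \<open>Triangles of the stable category\<close>

context frobenius_ideal
begin

text \<open>The minus sign is the one that makes the standard triangles of this form; without it
  the last arrow of every standard triangle would have to be negated.\<close>

inductive_set stable_triangles :: "'m set triangle set" where
  stable_triangleI: "\<lbrakk>(f, g, h) \<in> phantom_triangles; d \<in> Arr K; Dom K d = Dom K h;
      Cod K d = Dom K (\<omega> (Dom K f)); \<omega> (Dom K f) \<cdot> d = Neg K h\<rbrakk>
    \<Longrightarrow> (q f, q g, q d) \<in> stable_triangles"

lemma stable_triangleE:
  assumes "T \<in> stable_triangles"
  obtains f g h d where "T = (q f, q g, q d)" "(f, g, h) \<in> phantom_triangles"
    "d \<in> Arr K" "Dom K d = Dom K h" "Cod K d = Dom K (\<omega> (Dom K f))" "\<omega> (Dom K f) \<cdot> d = Neg K h"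
  using assms by (cases T) (auto elim!: stable_triangles.cases)

lemma N_Neg: "h \<in> N \<Longrightarrow> Neg K h \<in> N"
  using N_left[of h "Neg K (Idt K (Cod K h))"] N_in_Arr[of h] by simp

text \<open>At the last two places exactness is that of \<open>(f, g, h)\<close> itself, read
  through \<open>\<omega>\<close>. At the first place, an arrow \<open>g u\<close> through a
  projective is corrected: the projective lifts along \<open>g\<close>, and subtracting the lift
  from \<open>u\<close> gives an honest element of the kernel of \<open>g\<close>.\<close>

lemma stable_triangle_exact:
  assumes T: "T \<in> stable_triangles" shows "hom_exact S T"
proof -
  obtain f g h d where stable_triangleI: "T = (q f, q g, q d)" "(f, g, h) \<in> phantom_triangles"
    "d \<in> Arr K" "Dom K d = Dom K h" "Cod K d = Dom K (\<omega> (Dom K f))" "\<omega> (Dom K f) \<cdot> d = Neg K h"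
    using T by (rule stable_triangleE)
  have D: "(f, g, h) \<in> Dist K" and h: "h \<in> N"
    using stable_triangleI(2) by (simp_all add: phantom_triangles_iff)
  note dd = stable_triangleI(3-6)
  define X where "X = Dom K f"
  have fX: "Dom K f = X" by (simp add: X_def)
  note [simp] = DistD[OF D, unfolded fX] fX dd(1-3)[unfolded fX] shift_arr(1-3)[OF DistD(1)[OF D]]
  have X[simp]: "X \<in> Obj K" unfolding X_def by (rule Dom_Obj[OF DistD(1)[OF D]])
  have wd: "\<omega> X \<cdot> d = Neg K h" using dd(4) by simp
  have sh: "\<omega> (Dom K g) \<cdot> shift_arr f = SA f \<cdot> \<omega> X" using shift_arr(4)[of f] by simp
  show ?thesis
    unfolding stable_triangleI(1) hom_exact_def prod.case
  proof (intro conjI ballI impI)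
    show "(q f, q g, q d) \<in> triangles S" by (rule trianglesI) simp_all
    show "q g \<cdot>\<^bsub>S\<^esub> q f = Zro S (Dom S (q f)) (Dom S (q d))"
      using Dist_comp_zero1[OF D] by simp
    have "q (d \<cdot> g) = q (Zro K (Dom K g) (Dom K (\<omega> X)))"
      by (subst q_eq_iff[of _ X]) (simp_all add: Comp_reduce[OF wd] Dist_comp_zero2[OF D])
    then show "q d \<cdot>\<^bsub>S\<^esub> q g = Zro S (Dom S (q g)) (OMap (Susp S) (Dom S (q f)))"
      by simp
    have "q (shift_arr f \<cdot> d) = q (Zro K (Dom K h) (Dom K (\<omega> (Dom K g))))"
      by (subst q_eq_iff[of _ "Dom K g"])
        (simp_all add: Comp_reduce[OF sh] wd Dist_comp_zero3[OF D])
    then show "AMap (Susp S) (q f) \<cdot>\<^bsub>S\<^esub> q d = Zro S (Dom S (q d)) (OMap (Susp S) (Dom S (q g)))"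
      by (simp add: Susp_S_shift)
    fix u assume "u \<in> Arr S"
    then obtain u0 where u: "u0 \<in> Arr K" "u = q u0" by (rule I.im_lift)
    note [simp] = u(1)
    show "\<exists>x\<in>Hom S (Dom S u) (Dom S (q f)). q f \<cdot>\<^bsub>S\<^esub> x = u"
      if c: "Cod S u = Dom S (q g)" and z: "q g \<cdot>\<^bsub>S\<^esub> u = Zro S (Dom S u) (Dom S (q d))"
    proof -
      have [simp]: "Cod K u0 = Dom K g" using c u(2) by simp
      have "q (g \<cdot> u0) = q (Zro K (Dom K u0) (Dom K h))" using z by (simp add: u(2))
      from q_eqD(3)[OF this] have "g \<cdot> u0 \<in> factoring K \<P>" by simp
      then obtain a b where ab: "a \<in> Arr K" "b \<in> Arr K" "Dom K a = Dom K (g \<cdot> u0)" "Cod K a = Dom K b"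
        "Cod K b = Cod K (g \<cdot> u0)" "Dom K b \<in> \<P>" "g \<cdot> u0 = b \<cdot> a"
        by (rule Q.factoringE)
      have [simp]: "Dom K a = Dom K u0" "Cod K b = Dom K h" unfolding ab(3,5) by simp_all
      note [simp] = ab(1,2,4)
      have "h \<cdot> b = Zro K (Dom K b) (SO X)" using phantom_projective[OF h, of b] ab(6) by simp
      then obtain b' where b': "b' \<in> Arr K" "Dom K b' = Dom K b" "Cod K b' = Dom K g" "g \<cdot> b' = b"
        using Dist_exact2[OF D, of b] by auto
      note [simp] = b'(1-3)
      have "g \<cdot> (u0 \<boxplus> Neg K (b' \<cdot> a)) = Zro K (Dom K (u0 \<boxplus> Neg K (b' \<cdot> a))) (Dom K h)"
        by (simp add: Comp_reduce[OF b'(4)] ab(7))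
      then obtain x where x: "x \<in> Arr K" "Dom K x = Dom K u0" "Cod K x = X" "f \<cdot> x = u0 \<boxplus> Neg K (b' \<cdot> a)"
        using Dist_exact1[OF D, of "u0 \<boxplus> Neg K (b' \<cdot> a)"] by auto
      have ff: "b' \<cdot> a \<in> factoring K \<P>" by (rule Q.factoringI) (use ab(6) in simp_all)
      have "q (u0 \<boxplus> Neg K (b' \<cdot> a)) = q u0"
        by (rule q_eqI) (use Q.factoring_Neg[OF ff] in \<open>simp_all add: Add_comm[of u0]\<close>)
      then have "q (f \<cdot> x) = q u0" by (simp only: x(4))
      then show ?thesis using x(1-3) u(2) by - (rule bexI[of _ "q x"], simp_all)
    qed
    show "\<exists>x\<in>Hom S (Dom S u) (Dom S (q g)). q g \<cdot>\<^bsub>S\<^esub> x = u"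
      if c: "Cod S u = Dom S (q d)" and z: "q d \<cdot>\<^bsub>S\<^esub> u = Zro S (Dom S u) (OMap (Susp S) (Dom S (q f)))"
    proof -
      have [simp]: "Cod K u0 = Dom K h" using c u(2) by simp
      have "q (d \<cdot> u0) = q (Zro K (Dom K u0) (Dom K (\<omega> X)))" using z by (simp add: u(2))
      then have "\<omega> X \<cdot> (d \<cdot> u0) = Zro K (Dom K u0) (SO X)"
        by (subst (asm) q_eq_iff[of _ X]) simp_all
      then have "h \<cdot> u0 = Zro K (Dom K u0) (SO (Dom K f))"
        by (simp add: Comp_reduce[OF wd] Neg_eq_Zro)
      then obtain x where "x \<in> Arr K" "Dom K x = Dom K u0" "Cod K x = Dom K g" "g \<cdot> x = u0"
        using Dist_exact2[OF D, of u0] by auto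
      then show ?thesis using u(2) by - (rule bexI[of _ "q x"], simp_all)
    qed
    show "\<exists>x\<in>Hom S (Dom S u) (Dom S (q d)). q d \<cdot>\<^bsub>S\<^esub> x = u"
      if c: "Cod S u = OMap (Susp S) (Dom S (q f))"
        and z: "AMap (Susp S) (q f) \<cdot>\<^bsub>S\<^esub> u = Zro S (Dom S u) (OMap (Susp S) (Dom S (q g)))"
    proof -
      have [simp]: "Cod K u0 = Dom K (\<omega> X)" using c u(2) by simp
      have "q (shift_arr f \<cdot> u0) = q (Zro K (Dom K u0) (Dom K (\<omega> (Dom K g))))"
        using z by (simp add: u(2) Susp_S_shift)
      then have "\<omega> (Dom K g) \<cdot> (shift_arr f \<cdot> u0) = Zro K (Dom K u0) (SO (Dom K g))"
        by (subst (asm) q_eq_iff[of _ "Dom K g"]) simp_all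
      then have "SA f \<cdot> (\<omega> X \<cdot> u0) = Zro K (Dom K (\<omega> X \<cdot> u0)) (SO (Dom K g))"
        by (simp add: Comp_reduce[OF sh])
      then obtain y where y: "y \<in> Arr K" "Dom K y = Dom K u0" "Cod K y = Dom K h" "h \<cdot> y = \<omega> X \<cdot> u0"
        using Dist_exact3[OF D, of "\<omega> X \<cdot> u0"] by auto
      note [simp] = y(1-3)
      have "q (d \<cdot> Neg K y) = q u0"
        by (subst q_eq_iff[of _ X]) (simp_all add: Comp_reduce[OF wd] y(4))
      then show ?thesis using u(2) by - (rule bexI[of _ "q (Neg K y)"], simp_all)
    qed
  qed
qed

text \<open>A square that commutes stably is made to commute in \<open>K\<close>: the defect
  \<open>b f - f' a\<close> factors through an injective, its first factor extends along
  \<open>f\<close>, and subtracting the extension from \<open>b\<close> does not change the stable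
  class. The fill-in of \<open>K\<close> is then compatible with the last arrows because both
  composites agree after \<open>\<omega>\<close>.\<close>

lemma stable_triangle_fill:
  assumes T: "(f, g, h) \<in> stable_triangles" and T': "(f', g', h') \<in> stable_triangles"
    and a: "a \<in> Hom S (Dom S f) (Dom S f')" and b: "b \<in> Hom S (Dom S g) (Dom S g')"
    and ab: "b \<cdot>\<^bsub>S\<^esub> f = f' \<cdot>\<^bsub>S\<^esub> a"
  shows "\<exists>c. tri_mor S (f, g, h) (f', g', h') a b c"
  using T
proof cases
  case 1: (stable_triangleI f0 g0 h0 d0)
  show ?thesis using T'
  proof cases
    case 2: (stable_triangleI f1 g1 h1 d1)
    have D: "(f0, g0, h0) \<in> Dist K" and h0: "h0 \<in> N"
      using 1(4) by (simp_all add: phantom_triangles_iff)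
    have D': "(f1, g1, h1) \<in> Dist K" and h1: "h1 \<in> N"
      using 2(4) by (simp_all add: phantom_triangles_iff)
    note [simp] = DistD[OF D] DistD[OF D'] 1(5-7) 2(5-7)
    obtain a0 where a0: "a0 \<in> Arr K" "a = q a0" "Dom K a0 = Dom K f0" "Cod K a0 = Dom K f1"
      using a 1(1) 2(1) by (auto elim!: I.im_lift)
    obtain b0 where b0: "b0 \<in> Arr K" "b = q b0" "Dom K b0 = Dom K g0" "Cod K b0 = Dom K g1"
      using b 1(2) 2(2) by (auto elim!: I.im_lift)
    note [simp] = a0(1,3,4) b0(1,3,4)
    have "q (b0 \<cdot> f0) = q (f1 \<cdot> a0)" using ab by (simp add: a0(2) b0(2) 1(1) 2(1))
    from q_eqD(3)[OF this] have "b0 \<cdot> f0 \<boxplus> Neg K (f1 \<cdot> a0) \<in> factoring K \<P>" by simp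
    then obtain r s where rs: "r \<in> Arr K" "s \<in> Arr K"
      "Dom K r = Dom K (b0 \<cdot> f0 \<boxplus> Neg K (f1 \<cdot> a0))" "Cod K r = Dom K s"
      "Cod K s = Cod K (b0 \<cdot> f0 \<boxplus> Neg K (f1 \<cdot> a0))" "Dom K s \<in> \<P>"
      "b0 \<cdot> f0 \<boxplus> Neg K (f1 \<cdot> a0) = s \<cdot> r"
      by (rule Q.factoringE)
    have [simp]: "Dom K r = Dom K f0" "Cod K s = Dom K g1" unfolding rs(3,5) by simp_all
    note [simp] = rs(1,2,4)
    have "SA r \<cdot> h0 = Zro K (Dom K h0) (SO (Cod K r))"
      by (rule injective_phantom_susp[OF h0]) (use rs(6) in simp_all)
    then obtain r' where r': "r' \<in> Arr K" "Dom K r' = Dom K g0" "Cod K r' = Dom K s" "r' \<cdot> f0 = r"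
      using Dist_extend[OF D, of r] by auto
    note [simp] = r'(1-3)
    \<comment> \<open>The corrected representative of \<open>b\<close>.\<close>
  define b1 where "b1 = b0 \<boxplus> Neg K (s \<cdot> r')"
    have [simp]: "b1 \<in> Arr K" "Dom K b1 = Dom K g0" "Cod K b1 = Dom K g1" by (simp_all add: b1_def)
    have strict: "b1 \<cdot> f0 = f1 \<cdot> a0"
    proof -
      have "b1 \<cdot> f0 = b0 \<cdot> f0 \<boxplus> Neg K (s \<cdot> r)" by (simp add: b1_def r'(4))
      also have "\<dots> = f1 \<cdot> a0" by (simp add: rs(7)[symmetric])
      finally show ?thesis .
    qed
    have ff: "s \<cdot> r' \<in> factoring K \<P>" by (rule Q.factoringI) (use rs(6) in simp_all)
    have qb: "q b1 = q b0"
      unfolding b1_def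
      by (rule q_eqI) (use Q.factoring_Neg[OF ff] in \<open>simp_all add: Add_comm[of b0]\<close>)
    obtain c where c: "tri_mor K (f0, g0, h0) (f1, g1, h1) a0 b1 c"
      using TR3[OF D D', of a0 b1] strict by auto
    note C = tri_morD[OF c]
    note [simp] = C(9-11)
    have sh: "\<omega> (Dom K f1) \<cdot> shift_arr a0 = SA a0 \<cdot> \<omega> (Dom K f0)" using shift_arr(4)[of a0] by simp
    have third: "q (shift_arr a0 \<cdot> d0) = q (d1 \<cdot> c)"
      by (subst q_eq_iff[of _ "Dom K f1"])
        (simp_all add: Comp_reduce[OF sh] 1(8) Comp_reduce[OF 2(8)] C(14))
    have "tri_mor S (q f0, q g0, q d0) (q f1, q g1, q d1) (q a0) (q b1) (q c)"
      by (rule S.tri_morI) (simp_all add: strict C(13) third Susp_S_shift)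
    then show ?thesis unfolding 1(1-3) 2(1-3) a0(2) b0(2) qb by blast
  qed
qed

lemma stable_triangle_iso:
  assumes T: "(f, g, h) \<in> stable_triangles" and T': "(f', g', h') \<in> stable_triangles"
    and a: "is_iso S a" "Dom S a = Dom S f" "Cod S a = Dom S f'"
    and b: "is_iso S b" "Dom S b = Dom S g" "Cod S b = Dom S g'"
    and ab: "b \<cdot>\<^bsub>S\<^esub> f = f' \<cdot>\<^bsub>S\<^esub> a"
  shows "tri_isomorphic S (f, g, h) (f', g', h')"
proof -
  have "a \<in> Hom S (Dom S f) (Dom S f')" "b \<in> Hom S (Dom S g) (Dom S g')" using a b by simp_all
  then obtain c where c: "tri_mor S (f, g, h) (f', g', h') a b c"
    using stable_triangle_fill[OF T T' _ _ ab] by blast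
  have "is_iso S c"
    by (rule S.five_lemma[OF stable_triangle_exact[OF T] stable_triangle_exact[OF T'] c a(1) b(1)])
  then show ?thesis using c a(1) b(1) by (rule S.tri_isomorphicI[rotated -1])
qed

lemma Susp_S_Neg_Idt: "X \<in> Obj K \<Longrightarrow> AMap (Susp S) (q (Neg K (Idt K X))) = q (Neg K (Idt K (Dom K (\<omega> X))))"
  by (rule Susp_S_AMap) simp_all

lemma is_iso_q:
  assumes "is_iso K f" shows "is_iso S (q f)"
proof -
  obtain g where g: "f \<in> Arr K" "g \<in> Arr K" "Dom K g = Cod K f" "Cod K g = Dom K f"
    "g \<cdot> f = Idt K (Dom K f)" "f \<cdot> g = Idt K (Cod K f)"
    using is_isoE[OF assms] by metis
  show ?thesis by (rule S.is_isoI[of _ "q g"]) (use g in simp_all)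
qed

lemma is_iso_q_Neg: "X \<in> Obj K \<Longrightarrow> is_iso S (q (Neg K (Idt K X)))"
  using S.is_iso_Neg[OF S.is_iso_Idt, of X] by simp

text \<open>Stably the summand \<open>A\<close> is zero.\<close>

lemma is_iso_inclusion:
  assumes B: "is_biproduct K A Y T i j p r" and A: "A \<in> \<P>"
  shows "is_iso S (q j)" "is_iso S (q r)"
proof -
  note [simp] = biproductD[OF B]
  have ip: "i \<cdot> p \<in> factoring K \<P>" by (rule Q.factoringI) (use A in simp_all)
  have "j \<cdot> r \<boxplus> Neg K (i \<cdot> p \<boxplus> j \<cdot> r) = Neg K (i \<cdot> p)"
    by (subst Neg_Add, simp_all del: biproductD(20)[OF B] add: Add_left_comm[of "j \<cdot> r"])
  then have "j \<cdot> r \<boxplus> Neg K (Idt K T) = Neg K (i \<cdot> p)" by simp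
  then have "q (j \<cdot> r) = q (Idt K T)"
    using Q.factoring_Neg[OF ip] by - (rule q_eqI, simp_all)
  then show "is_iso S (q j)" "is_iso S (q r)"
    using S.is_isoI[of "q j" "q r"] S.is_isoI[of "q r" "q j"] by simp_all
qed

text \<open>In a homotopy pushout of \<open>\<iota>\<close> and \<open>f\<close>, the triangle on
  \<open>X \<rightarrow> I \<oplus> Y\<close> has a phantom as its last arrow, and stably \<open>I
  \<oplus> Y\<close> is \<open>Y\<close>. With first arrow \<open>(\<iota>, -f)\<close>, the
  isomorphism to \<open>(f, g, u)\<close> is \<open>-1\<close> on \<open>X\<close> and the
  identity on the third vertex, which is where the sign in the definition of the stable triangles
  comes from.\<close>

lemma pushout_square:
  assumes f: "f \<in> Arr K"
    and B: "is_biproduct K (Dom K (\<nu> (Dom K f))) (Cod K f) T i j p r"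
    and k: "k \<in> Arr K" "Dom K k = Dom K (\<nu> (Dom K f))"
    and g: "g \<in> Arr K" "Dom K g = Cod K f" "Cod K g = Cod K k"
    and D: "(i \<cdot> \<iota> (Dom K f) \<boxplus> Neg K (j \<cdot> f), k \<cdot> p \<boxplus> g \<cdot> r, e) \<in> Dist K"
  obtains u T' where "u \<in> Arr K" "Dom K u = Cod K k" "Cod K u = Dom K (\<omega> (Dom K f))"
    "u \<cdot> k = \<nu> (Dom K f)" "u \<cdot> g = Zro K (Cod K f) (Dom K (\<omega> (Dom K f)))"
    "(g, u, SA f \<cdot> \<omega> (Dom K f)) \<in> Dist K" "T' \<in> stable_triangles"
    "tri_isomorphic S T' (q f, q g, q u)"
proof -
  define X where "X = Dom K f"
  have fX: "Dom K f = X" by (simp add: X_def)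
  have X[simp]: "X \<in> Obj K" using f by (simp add: X_def)
  note [simp] = f fX biproductD[OF B, unfolded fX] k[unfolded fX] g
  note D = D[unfolded fX]
  have B': "is_biproduct K (Cod K (\<iota> X)) (Cod K f) T i j p r" using B by simp
  obtain u where u: "u \<in> Arr K" "Dom K u = Cod K k" "Cod K u = Dom K (\<omega> X)" "u \<cdot> k = \<nu> X"
    "u \<cdot> g = Zro K (Cod K f) (Dom K (\<omega> X))" "\<omega> X \<cdot> u = e" "(g, u, SA f \<cdot> \<omega> X) \<in> Dist K"
    by (rule homotopy_pushout_cone[OF t_Dist[OF X] f _ B' _ _ _ _ _ D]) simp_all
  note [simp] = u(1-3)
  have "e \<in> N" unfolding u(6)[symmetric] by (rule N_right[OF \<omega>_N]) simp_all
  then have E: "(i \<cdot> \<iota> X \<boxplus> Neg K (j \<cdot> f), k \<cdot> p \<boxplus> g \<cdot> r, e) \<in> phantom_triangles"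
    using D by (simp add: phantom_triangles_iff)
  have [simp]: "e \<in> Arr K" "Dom K e = Cod K k" "Cod K e = SO X" by (simp_all add: u(6)[symmetric])
  have st: "(q (i \<cdot> \<iota> X \<boxplus> Neg K (j \<cdot> f)), q (k \<cdot> p \<boxplus> g \<cdot> r), q (Neg K u)) \<in> stable_triangles"
    by (rule stable_triangleI[OF E]) (simp_all add: u(6))
  have kp: "k \<cdot> p \<in> factoring K \<P>"
    by (rule Q.factoringI) (use \<nu>_Dom in simp_all)
  have isor: "is_iso S (q r)" by (rule is_iso_inclusion(2)[OF B]) (use \<nu>_Dom in simp)
  \<comment> \<open>Stably the arrow out of \<open>I \<oplus> Y\<close> only sees \<open>Y\<close>.\<close>
  have sec: "q (k \<cdot> p \<boxplus> g \<cdot> r) = q (g \<cdot> r)"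
    by (rule q_eqI) (use kp in simp_all)
  have "tri_mor S (q (i \<cdot> \<iota> X \<boxplus> Neg K (j \<cdot> f)), q (k \<cdot> p \<boxplus> g \<cdot> r), q (Neg K u)) (q f, q g, q u)
    (q (Neg K (Idt K X))) (q r) (q (Idt K (Cod K k)))"
    unfolding sec by (rule S.tri_morI) (simp_all add: Susp_S_Neg_Idt)
  then have "tri_isomorphic S (q (i \<cdot> \<iota> X \<boxplus> Neg K (j \<cdot> f)), q (k \<cdot> p \<boxplus> g \<cdot> r), q (Neg K u)) (q f, q g, q u)"
    by (rule S.tri_isomorphicI) (use isor is_iso_q_Neg S.is_iso_Idt[of "Cod K k"] in simp_all)
  then show ?thesis by (rule that[unfolded fX, OF u(1-5,7) st])
qed

text \<open>A standard triangle is given by some arrow \<open>h\<close> compatible with the chosen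
  triangle, and this need not be the arrow \<open>u\<close> of the octahedron, for which
  \<open>\<omega> u\<close> is known. But both complete \<open>g\<close> to a triangle with the
  same last arrow, so there is an automorphism \<open>\<theta>\<close> of the pushout with
  \<open>\<theta> g = g\<close> and \<open>u \<theta> = h\<close>.\<close>

lemma standard_imp_stable:
  assumes "T \<in> standard_triangles K phantom_triangles t"
  obtains T' where "T' \<in> stable_triangles" "tri_isomorphic S T T'"
proof -
  obtain f g h i v w k e where T: "T = (q f, q g, q h)" and f: "f \<in> Arr K"
    and tf: "t (Dom K f) = (i, v, w)"
    and hc: "htpy_cartesian K i f k g" and gh: "(g, h, e) \<in> Dist K"
    and m: "tri_mor K (i, v, w) (g, h, e) f k (Idt K (Cod K v))"
    using assms unfolding standard_triangles_def by blast
  have ivw: "i = \<iota> (Dom K f)" "v = \<nu> (Dom K f)" "w = \<omega> (Dom K f)"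
    using tf t_eq[of "Dom K f"] by simp_all
  note hc = hc[unfolded ivw] and m = m[unfolded ivw]
  define X where "X = Dom K f"
  have fX: "Dom K f = X" by (simp add: X_def)
  have X[simp]: "X \<in> Obj K" using f by (simp add: X_def)
  note [simp] = f fX
  note hc = hc[unfolded fX] and m = m[unfolded fX]
  obtain B i j p r e0 where hc': "k \<in> Arr K" "g \<in> Arr K" "Cod K (\<iota> X) = Dom K k" "Cod K f = Dom K g"
      "Cod K k = Cod K g" "is_biproduct K (Cod K (\<iota> X)) (Cod K f) B i j p r"
     "(i \<cdot> \<iota> X \<boxplus> Neg K (j \<cdot> f), k \<cdot> p \<boxplus> g \<cdot> r, e0) \<in> Dist K"
    using hc unfolding htpy_cartesian_def by blast
  have kd: "Dom K k = Dom K (\<nu> X)" using hc'(3) by simp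
  obtain u T' where u: "u \<in> Arr K" "Dom K u = Cod K k" "Cod K u = Dom K (\<omega> X)" "u \<cdot> k = \<nu> X"
    "(g, u, SA f \<cdot> \<omega> X) \<in> Dist K" "T' \<in> stable_triangles" "tri_isomorphic S T' (q f, q g, q u)"
    by (rule pushout_square[OF f, unfolded fX, of B i j p r k g e0])
      (use hc' kd in simp_all)
  note M = tri_morD[OF m]
  note [simp] = DistD[OF gh] hc'(4) u(1-3)
  have [simp]: "Cod K k = Dom K h" using hc'(5) DistD(5)[OF gh] by simp
  have hd: "Cod K h = Dom K (\<omega> X)" "Dom K e = Dom K (\<omega> X)" using M(11) X by simp_all
  have e: "e = SA f \<cdot> \<omega> X" using M(14) hd(2) by simp
  note gh' = gh[unfolded e]
  note [simp] = hd
  obtain \<theta> where th: "tri_mor K (g, h, SA f \<cdot> \<omega> X) (g, u, SA f \<cdot> \<omega> X) (Idt K (Dom K g)) \<theta> (Idt K (Dom K (\<omega> X)))"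
    by (rule TR3_second[OF gh' u(5), of "Idt K (Dom K g)" "Idt K (Dom K (\<omega> X))"]) simp_all
  have ith: "is_iso K \<theta>"
    by (rule Dist_five_lemma(2)[OF gh' u(5) th]) simp_all
  note TH = tri_morD(6-8,12,13)[OF th]
  note [simp] = TH(1-3)
  have "Idt K (Dom K (\<omega> X)) \<cdot> h = h" by simp
  then have uth: "u \<cdot> \<theta> = h" using TH(5) by (simp only: Susp.AMap_Idt DistD(1,2)[OF gh])
  have thg: "\<theta> \<cdot> g = g" using TH(4) by simp
  have "is_iso S (q \<theta>)" by (rule is_iso_q[OF ith])
  moreover have "tri_mor S (q f, q g, q h) (q f, q g, q u) (q (Idt K X)) (q (Idt K (Dom K g))) (q \<theta>)"
    by (rule S.tri_morI) (use uth thg S.Susp.AMap_Idt[of X] in simp_all)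
  ultimately have "tri_isomorphic S T (q f, q g, q u)"
    unfolding T by - (rule S.tri_isomorphicI, assumption, use S.is_iso_Idt[of X] S.is_iso_Idt[of "Dom K g"] in simp_all)
  then have "tri_isomorphic S T T'" using S.tri_isomorphic_sym[OF u(7)] S.tri_isomorphic_trans by blast
  then show ?thesis using that u(6) by blast
qed

lemma standard_exists:
  assumes f: "f \<in> Arr K"
  obtains g u where "(q f, q g, q u) \<in> standard_triangles K phantom_triangles t"
proof -
  define X where "X = Dom K f"
  have fX: "Dom K f = X" by (simp add: X_def)
  have X[simp]: "X \<in> Obj K" using f by (simp add: X_def)
  note [simp] = f fX
  obtain B i j p r where B: "is_biproduct K (Dom K (\<nu> X)) (Cod K f) B i j p r"
    using direct_sum_exists[of "Dom K (\<nu> X)" "Cod K f"] unfolding direct_sum_def by auto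
  note [simp] = biproductD[OF B]
  define m where "m = i \<cdot> \<iota> X \<boxplus> Neg K (j \<cdot> f)"
  have m: "m \<in> Arr K" "Dom K m = X" "Cod K m = B" by (simp_all add: m_def)
  obtain n e where D: "(m, n, e) \<in> Dist K" using TR1_cone[OF m(1)] by blast
  have n[simp]: "n \<in> Arr K" "Dom K n = B" using DistD[OF D] m by simp_all
  \<comment> \<open>The components of the second arrow of a triangle on \<open>(\<iota>, -f)\<close>.\<close>
  define k where "k = n \<cdot> i"
  define g where "g = n \<cdot> j"
  have n_eq: "n = k \<cdot> p \<boxplus> g \<cdot> r" unfolding k_def g_def by (rule biproduct_out[OF B]) simp_all
  have kg: "k \<in> Arr K" "Dom K k = Dom K (\<nu> X)" "Cod K k = Cod K n"
    "g \<in> Arr K" "Dom K g = Cod K f" "Cod K g = Cod K n" by (simp_all add: k_def g_def)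
  note [simp] = kg
  have D': "(i \<cdot> \<iota> X \<boxplus> Neg K (j \<cdot> f), k \<cdot> p \<boxplus> g \<cdot> r, e) \<in> Dist K"
    using D unfolding n_eq[symmetric] m_def .
  obtain u where u: "u \<in> Arr K" "Dom K u = Cod K k" "Cod K u = Dom K (\<omega> X)" "u \<cdot> k = \<nu> X"
    "u \<cdot> g = Zro K (Cod K f) (Dom K (\<omega> X))" "(g, u, SA f \<cdot> \<omega> X) \<in> Dist K"
    by (rule pushout_square[OF f, unfolded fX, OF B _ _ _ _ _ D']) simp_all
  note [simp] = u(1-3)
  have hc: "htpy_cartesian K (\<iota> X) f k g"
    unfolding htpy_cartesian_def using B D' by simp blast
  have kig: "k \<cdot> \<iota> X = g \<cdot> f"
  proof -
    have "(k \<cdot> p \<boxplus> g \<cdot> r) \<cdot> (i \<cdot> \<iota> X \<boxplus> Neg K (j \<cdot> f)) = Zro K X (Dom K e)"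
      using Dist_comp_zero1[OF D'] by simp
    then have "k \<cdot> \<iota> X \<boxplus> Neg K (g \<cdot> f) = Zro K X (Cod K n)"
      using DistD(5)[OF D] by simp
    then show ?thesis by (rule Sub_eq_Zro[rotated 4]) simp_all
  qed
  have "tri_mor K (\<iota> X, \<nu> X, \<omega> X) (g, u, SA f \<cdot> \<omega> X) f k (Idt K (Cod K (\<nu> X)))"
    by (rule tri_morI) (simp_all add: kig u(4))
  then have "(q f, q g, q u) \<in> standard_triangles K phantom_triangles t"
    unfolding standard_triangles_def using f hc u(6) fX t_eq[of X] by blast
  then show ?thesis by (rule that)
qed

text \<open>A standard triangle on \<open>f\<close> is itself isomorphic to a stable triangle, and
  two stable triangles on isomorphic first arrows are isomorphic.\<close>

lemma stable_imp_Dist: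
  assumes T: "T \<in> stable_triangles" shows "T \<in> Dist S"
proof -
  obtain f g h d where 1: "T = (q f, q g, q d)" "(f, g, h) \<in> phantom_triangles"
    using T by (rule stable_triangleE)
  have D: "(f, g, h) \<in> Dist K" and h: "h \<in> N"
    using 1(2) by (simp_all add: phantom_triangles_iff)
  note [simp] = DistD[OF D]
  obtain g' u where st: "(q f, q g', q u) \<in> standard_triangles K phantom_triangles t"
    by (rule standard_exists[of f]) simp_all
  obtain T' where T': "T' \<in> stable_triangles" "tri_isomorphic S (q f, q g', q u) T'"
    using st by (rule standard_imp_stable)
  obtain f1 g1 h1 where T1: "T' = (f1, g1, h1)" by (metis prod_cases3)
  obtain a b c a' b' c' where m: "tri_mor S (q f, q g', q u) (f1, g1, h1) a b c" "is_iso S a" "is_iso S b"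
    using S.tri_isomorphicE[OF T'(2)[unfolded T1]] by metis
  note M = tri_morD[OF m(1)]
  have "Dom S (q g') = Dom S (q g)" using trianglesD(4)[OF M(1)] by simp
  then have "tri_isomorphic S T (f1, g1, h1)"
    unfolding 1(1)
    by - (rule stable_triangle_iso[OF T[unfolded 1(1)] T'(1)[unfolded T1] m(2) _ _ m(3)], use M in simp_all)
  then have "tri_isomorphic S T (q f, q g', q u)"
    using S.tri_isomorphic_sym[OF T'(2)[unfolded T1]] S.tri_isomorphic_trans by blast
  then show ?thesis unfolding Dist_S using st by blast
qed

lemma Dist_S_iff: "T \<in> Dist S \<longleftrightarrow> (\<exists>T' \<in> stable_triangles. tri_isomorphic S T T')"
proof
  assume "T \<in> Dist S"
  then obtain T1 where T1: "T1 \<in> standard_triangles K phantom_triangles t" "tri_isomorphic S T T1"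
    unfolding Dist_S by blast
  obtain T' where "T' \<in> stable_triangles" "tri_isomorphic S T1 T'"
    using T1(1) by (rule standard_imp_stable)
  then show "\<exists>T' \<in> stable_triangles. tri_isomorphic S T T'" using T1(2) S.tri_isomorphic_trans by blast
next
  assume "\<exists>T' \<in> stable_triangles. tri_isomorphic S T T'"
  then obtain T' where T': "T' \<in> stable_triangles" "tri_isomorphic S T T'" by blast
  from stable_imp_Dist[OF T'(1)] obtain T1
    where "T1 \<in> standard_triangles K phantom_triangles t" "tri_isomorphic S T' T1"
    unfolding Dist_S by blast
  then show "T \<in> Dist S" unfolding Dist_S using T'(2) S.tri_isomorphic_trans by blast
qed

lemma Dist_S_iso_closed: "T \<in> Dist S \<Longrightarrow> tri_isomorphic S T T' \<Longrightarrow> T' \<in> Dist S"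
  unfolding Dist_S using S.tri_isomorphic_sym S.tri_isomorphic_trans by blast

end

section \<open>The triangulated structure of the stable category\<close>

context frobenius_ideal
begin

lemma Dist_S_exact:
  assumes "T \<in> Dist S" shows "hom_exact S T"
proof -
  obtain T' where T': "T' \<in> stable_triangles" "tri_isomorphic S T T'" using assms Dist_S_iff by blast
  obtain f g h f' g' h' where e: "T = (f, g, h)" "T' = (f', g', h')" by (metis prod_cases3)
  show ?thesis
    using S.hom_exact_iso[OF stable_triangle_exact[OF T'(1), unfolded e] T'(2)[unfolded e]] unfolding e .
qed

text \<open>For a standard triangle on \<open>f\<close> with arrows \<open>g\<close> and
  \<open>h\<close>, the triple \<open>(g, h, \<Sigma>f \<omega>)\<close> is a phantom triangle.
  Its last stable arrow is minus the stable suspension of \<open>f\<close>, so that it is the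
  rotation of the given triangle.\<close>

lemma Dist_S_rotate:
  assumes "(f, g, h) \<in> Dist S" shows "(g, h, Neg S (AMap (Susp S) f)) \<in> Dist S"
proof -
  obtain T1 where T1: "T1 \<in> standard_triangles K phantom_triangles t" "tri_isomorphic S (f, g, h) T1"
    using assms unfolding Dist_S by blast
  obtain f1 g1 h1 i v w k e where T: "T1 = (q f1, q g1, q h1)" and f: "f1 \<in> Arr K"
    and tf: "t (Dom K f1) = (i, v, w)" and gh: "(g1, h1, e) \<in> Dist K"
    and m: "tri_mor K (i, v, w) (g1, h1, e) f1 k (Idt K (Cod K v))"
    using T1(1) unfolding standard_triangles_def by blast
  define X where "X = Dom K f1"
  have fX: "Dom K f1 = X" by (simp add: X_def)
  have X[simp]: "X \<in> Obj K" using f by (simp add: X_def)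
  note [simp] = f fX
  have ivw: "i = \<iota> X" "v = \<nu> X" "w = \<omega> X" using tf t_eq[of X] by simp_all
  note M = tri_morD(5,11,14)[OF m[unfolded ivw]]
  note [simp] = DistD[OF gh]
  have [simp]: "Dom K e = Dom K (\<omega> X)" "Cod K f1 = Dom K g1" using M(1,2) by simp_all
  have e: "e = SA f1 \<cdot> \<omega> X" using M(3) by simp
  have "e \<in> N" unfolding e by (rule N_left[OF \<omega>_N]) simp_all
  then have E: "(g1, h1, e) \<in> phantom_triangles" using gh by (simp add: phantom_triangles_iff)
  have sh: "shift_arr f1 \<in> Arr K" "Dom K (shift_arr f1) = Dom K (\<omega> X)"
    "Cod K (shift_arr f1) = Dom K (\<omega> (Dom K g1))" "\<omega> (Dom K g1) \<cdot> shift_arr f1 = SA f1 \<cdot> \<omega> X"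
    using shift_arr[OF f] by simp_all
  have "(q g1, q h1, q (Neg K (shift_arr f1))) \<in> stable_triangles"
    by (rule stable_triangleI[OF E]) (simp_all add: sh e[symmetric])
  then have D: "(q g1, q h1, Neg S (AMap (Susp S) (q f1))) \<in> Dist S"
    using stable_imp_Dist sh(1) by (simp add: Susp_S_shift)
  show ?thesis
    using Dist_S_iso_closed[OF D S.tri_isomorphic_sym[OF S.tri_isomorphic_rotate[OF T1(2)[unfolded T]]]] .
qed

lemma Dist_S_fill:
  assumes T: "(f, g, h) \<in> Dist S" and T': "(f', g', h') \<in> Dist S"
    and a: "a \<in> Hom S (Dom S f) (Dom S f')" and b: "b \<in> Hom S (Dom S g) (Dom S g')"
    and ab: "b \<cdot>\<^bsub>S\<^esub> f = f' \<cdot>\<^bsub>S\<^esub> a"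
  shows "\<exists>c. tri_mor S (f, g, h) (f', g', h') a b c"
proof -
  obtain f0 g0 h0 where T0: "(f0, g0, h0) \<in> stable_triangles" "tri_isomorphic S (f, g, h) (f0, g0, h0)"
    using T Dist_S_iff by (metis prod_cases3)
  obtain f1 g1 h1 where T1: "(f1, g1, h1) \<in> stable_triangles" "tri_isomorphic S (f', g', h') (f1, g1, h1)"
    using T' Dist_S_iff by (metis prod_cases3)
  show ?thesis
    by (rule S.fill_transport[OF T0(2) T1(2) stable_triangle_fill[OF T0(1) T1(1)] a b ab])
qed

lemma Dist_S_id:
  assumes X: "X \<in> Obj S" and Z: "zero_object S Z"
  shows "(Idt S X, Zro S X Z, Zro S Z (OMap (Susp S) X)) \<in> Dist S"
proof -
  have [simp]: "X \<in> Obj K" using X by simp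
  have [simp]: "Z \<in> Obj K" using S.zero_object_Obj[OF Z] by simp
  obtain Z0 where Z0: "zero_object K Z0" using zero_object_exists by blast
  have [simp]: "Z0 \<in> Obj K" using Z0 by simp
  have E: "(Idt K X, Zro K X Z0, Zro K Z0 (SO X)) \<in> phantom_triangles"
    using TR1_id[of X Z0] Z0 N_Zro by (simp add: phantom_triangles_iff)
  have D: "(q (Idt K X), q (Zro K X Z0), q (Zro K Z0 (Dom K (\<omega> X)))) \<in> Dist S"
    by (rule stable_imp_Dist, rule stable_triangleI[OF E]) simp_all
  have Z0S: "q (Idt K Z0) = q (Zro K Z0 Z0)" using Z0 unfolding zero_object_iff by simp
  have ZS: "q (Idt K Z) = q (Zro K Z Z)" using Z unfolding S.zero_object_iff by simp
  have iso: "is_iso S (q (Zro K Z0 Z))"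
    by (rule S.is_isoI[of _ "q (Zro K Z Z0)"]) (simp_all add: Z0S ZS)
  have "tri_mor S (q (Idt K X), q (Zro K X Z0), q (Zro K Z0 (Dom K (\<omega> X))))
    (Idt S X, Zro S X Z, Zro S Z (OMap (Susp S) X)) (q (Idt K X)) (q (Idt K X)) (q (Zro K Z0 Z))"
    by (rule S.tri_morI) (use S.Susp.AMap_Idt[of X] in simp_all)
  then have "tri_isomorphic S (q (Idt K X), q (Zro K X Z0), q (Zro K Z0 (Dom K (\<omega> X))))
    (Idt S X, Zro S X Z, Zro S Z (OMap (Susp S) X))"
    by (rule S.tri_isomorphicI) (use iso S.is_iso_Idt[of X] in simp_all)
  with D show ?thesis by (rule Dist_S_iso_closed)
qed

lemma Dist_S_cone:
  assumes "f \<in> Arr S" shows "\<exists>g h. (f, g, h) \<in> Dist S"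
proof -
  obtain f0 where f0: "f0 \<in> Arr K" "f = q f0" using assms by (rule I.im_lift)
  obtain g u where st: "(q f0, q g, q u) \<in> standard_triangles K phantom_triangles t"
    using f0(1) by (rule standard_exists)
  obtain T' where "T' \<in> stable_triangles" "tri_isomorphic S (q f0, q g, q u) T'"
    using st by (rule standard_imp_stable)
  then have "(q f0, q g, q u) \<in> Dist S" using Dist_S_iff by blast
  then show ?thesis unfolding f0(2) by blast
qed

text \<open>Comparison with the chosen triangle writes \<open>h\<close> as a composite with the
  phantom \<open>\<omega>\<close>. Since \<open>\<iota>\<close> factors through every arrow with
  phantom cone, this criterion is also compatible with composition.\<close>

lemma phantom_cone:
  assumes T: "(f, g, h) \<in> Dist K" and y: "y \<in> Arr K" "Dom K y = Dom K g"
    "Cod K y = Dom K (\<nu> (Dom K f))" "y \<cdot> f = \<iota> (Dom K f)"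
  shows "h \<in> N"
proof -
  note [simp] = DistD[OF T] y(1-3)
  obtain c where c: "tri_mor K (f, g, h) (\<iota> (Dom K f), \<nu> (Dom K f), \<omega> (Dom K f)) (Idt K (Dom K f)) y c"
    using TR3[OF T t_Dist, of "Dom K f" "Idt K (Dom K f)" y] y(4) by auto
  note C = tri_morD(9-11,14)[OF c]
  have "h = \<omega> (Dom K f) \<cdot> c" using C(4) by simp
  then show ?thesis using N_right[OF \<omega>_N, of "Dom K f" c] C(1-3) by simp
qed

lemma stable_lift_exists:
  assumes "h \<in> N" "Cod K h = SO X" "X \<in> Obj K"
  shows "\<exists>d. d \<in> Arr K \<and> Dom K d = Dom K h \<and> Cod K d = Dom K (\<omega> X) \<and> \<omega> X \<cdot> d = Neg K h"
  using phantom_lift[OF N_Neg[OF assms(1)] _ assms(3)] assms(2) N_in_Arr[OF assms(1)] Neg_simps by metis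

text \<open>The arrows \<open>f : X \<rightarrow> Y\<close> and \<open>g : Y \<rightarrow>
  Z\<close> are replaced by \<open>F = (\<iota>, f)\<close> into \<open>I \<oplus> Y\<close> and
  by \<open>G = (\<iota>, g)\<close> into \<open>I' \<oplus> Z\<close>, which are stably
  isomorphic to them. Now \<open>F\<close>, \<open>G\<close> and \<open>G F\<close> have phantom
  cones, and the octahedron of \<open>K\<close> on them becomes a stable one; its equations
  between last arrows are checked after composing with \<open>\<omega>\<close>.\<close>

lemma Dist_S_octahedron:
  assumes "f \<in> Arr S" "g \<in> Arr S" "Cod S f = Dom S g"
  shows "\<exists>b c F F' F'' G G' G'' H' H'' u v. is_iso S b \<and> is_iso S c \<and> Dom S b = Cod S f \<and>
            Dom S c = Cod S g \<and> F = b \<cdot>\<^bsub>S\<^esub> f \<and> G \<in> Arr S \<and> Dom S G = Cod S b \<and> Cod S G = Cod S c \<and>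
            G \<cdot>\<^bsub>S\<^esub> b = c \<cdot>\<^bsub>S\<^esub> g \<and> (F, F', F'') \<in> Dist S \<and> (G, G', G'') \<in> Dist S \<and>
            (G \<cdot>\<^bsub>S\<^esub> F, H', H'') \<in> Dist S \<and> (u, v, AMap (Susp S) F' \<cdot>\<^bsub>S\<^esub> G'') \<in> Dist S \<and>
            u \<in> Hom S (Dom S F'') (Dom S H'') \<and> v \<in> Hom S (Dom S H'') (Dom S G'') \<and>
            u \<cdot>\<^bsub>S\<^esub> F' = H' \<cdot>\<^bsub>S\<^esub> G \<and> H'' \<cdot>\<^bsub>S\<^esub> u = F'' \<and> v \<cdot>\<^bsub>S\<^esub> H' = G' \<and>
            G'' \<cdot>\<^bsub>S\<^esub> v = AMap (Susp S) F \<cdot>\<^bsub>S\<^esub> H''"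
proof -
  obtain f0 where f0: "f0 \<in> Arr K" "f = q f0" using assms(1) by (rule I.im_lift)
  obtain g0 where g0: "g0 \<in> Arr K" "g = q g0" using assms(2) by (rule I.im_lift)
  define X where "X = Dom K f0"
  have fX: "Dom K f0 = X" by (simp add: X_def)
  have X[simp]: "X \<in> Obj K" using f0 by (simp add: X_def)
  have [simp]: "Cod K f0 = Dom K g0" using assms(3) f0 g0 by simp
  note [simp] = f0(1) g0(1) fX
  obtain B i1 j1 p1 r1 where B1: "is_biproduct K (Dom K (\<nu> X)) (Dom K g0) B i1 j1 p1 r1"
    using direct_sum_exists[of "Dom K (\<nu> X)" "Dom K g0"] unfolding direct_sum_def by auto
  note [simp] = biproductD[OF B1]
  obtain D i2 j2 p2 r2 where B2: "is_biproduct K (Dom K (\<nu> B)) (Cod K g0) D i2 j2 p2 r2"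
    using direct_sum_exists[of "Dom K (\<nu> B)" "Cod K g0"] unfolding direct_sum_def by auto
  note [simp] = biproductD[OF B2]
  define F where "F = i1 \<cdot> \<iota> X \<boxplus> j1 \<cdot> f0"
  define G where "G = i2 \<cdot> \<iota> B \<boxplus> j2 \<cdot> (g0 \<cdot> r1)"
  have F[simp]: "F \<in> Arr K" "Dom K F = X" "Cod K F = B" by (simp_all add: F_def)
  have G[simp]: "G \<in> Arr K" "Dom K G = B" "Cod K G = D" by (simp_all add: G_def)
  have pF: "p1 \<cdot> F = \<iota> X" and pG: "p2 \<cdot> G = \<iota> B" by (simp_all add: F_def G_def)
  obtain F' F'' where TF: "(F, F', F'') \<in> Dist K" using TR1_cone[OF F(1)] by blast
  obtain G' G'' where TG: "(G, G', G'') \<in> Dist K" using TR1_cone[OF G(1)] by blast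
  have GF[simp]: "G \<cdot> F \<in> Arr K" by simp
  obtain H' H'' where TH: "(G \<cdot> F, H', H'') \<in> Dist K" using TR1_cone[OF GF] by blast
  have tF: "F' \<in> Arr K" "F'' \<in> Arr K" "Dom K F' = B" "Cod K F' = Dom K F''" "Cod K F'' = SO X"
    using DistD[OF TF] by simp_all
  have tG: "G' \<in> Arr K" "G'' \<in> Arr K" "Dom K G' = D" "Cod K G' = Dom K G''" "Cod K G'' = SO B"
    using DistD[OF TG] by simp_all
  have tH: "H' \<in> Arr K" "H'' \<in> Arr K" "Dom K H' = D" "Cod K H' = Dom K H''" "Cod K H'' = SO X"
    using DistD[OF TH] by simp_all
  note [simp] = tF tG tH
  have FN: "F'' \<in> N" by (rule phantom_cone[OF TF, of p1]) (simp_all add: pF)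
  have GN: "G'' \<in> N" by (rule phantom_cone[OF TG, of p2]) (simp_all add: pG)
  have "SA p1 \<cdot> \<omega> B = Zro K (Dom K (\<omega> B)) (SO (Cod K p1))"
    by (rule injective_phantom_susp[OF \<omega>_N]) (use \<nu>_Dom in simp_all)
  \<comment> \<open>The projection \<open>p1\<close> to an injective extends along \<open>\<iota>\<close>, which exhibits \<open>\<iota> X\<close> as a factor of \<open>G F\<close>.\<close>
  then obtain y where y: "y \<in> Arr K" "Dom K y = Dom K (\<nu> B)" "Cod K y = Dom K (\<nu> X)" "y \<cdot> \<iota> B = p1"
    using Dist_extend[OF t_Dist, of B p1] by auto
  note [simp] = y(1-3)
  have HN: "H'' \<in> N"
    by (rule phantom_cone[OF TH, of "y \<cdot> p2"])
      (simp_all add: Comp_reduce[OF pG] Comp_reduce[OF y(4)] pF)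
  obtain u v where uv: "(u, v, SA F' \<cdot> G'') \<in> Dist K" "u \<cdot> F' = H' \<cdot> G" "H'' \<cdot> u = F''"
    "v \<cdot> H' = G'" "G'' \<cdot> v = SA F \<cdot> H''" and uvt: "u \<in> Arr K" "v \<in> Arr K"
    "Dom K u = Dom K F''" "Cod K u = Dom K H''" "Dom K v = Dom K H''" "Cod K v = Dom K G''"
    by (rule octahedron[OF TF TG _ TH]) simp_all
  note [simp] = uvt
  obtain dF where dF: "dF \<in> Arr K" "Dom K dF = Dom K F''" "Cod K dF = Dom K (\<omega> X)" "\<omega> X \<cdot> dF = Neg K F''"
    using stable_lift_exists[OF FN, of X] by auto
  obtain dG where dG: "dG \<in> Arr K" "Dom K dG = Dom K G''" "Cod K dG = Dom K (\<omega> B)" "\<omega> B \<cdot> dG = Neg K G''"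
    using stable_lift_exists[OF GN, of B] by auto
  obtain dH where dH: "dH \<in> Arr K" "Dom K dH = Dom K H''" "Cod K dH = Dom K (\<omega> X)" "\<omega> X \<cdot> dH = Neg K H''"
    using stable_lift_exists[OF HN, of X] by auto
  note [simp] = dF(1-3) dG(1-3) dH(1-3)
  have "(q F, q F', q dF) \<in> stable_triangles"
    by (rule stable_triangleI[of F F' F'']) (use TF FN dF(4) in \<open>simp_all add: phantom_triangles_iff\<close>)
  then have DF: "(q F, q F', q dF) \<in> Dist S" by (rule stable_imp_Dist)
  have "(q G, q G', q dG) \<in> stable_triangles"
    by (rule stable_triangleI[of G G' G'']) (use TG GN dG(4) in \<open>simp_all add: phantom_triangles_iff\<close>)
  then have DG: "(q G, q G', q dG) \<in> Dist S" by (rule stable_imp_Dist)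
  have "(q (G \<cdot> F), q H', q dH) \<in> stable_triangles"
    by (rule stable_triangleI[of "G \<cdot> F" H' H'']) (use TH HN dH(4) in \<open>simp_all add: phantom_triangles_iff\<close>)
  then have DH: "(q (G \<cdot> F), q H', q dH) \<in> Dist S" by (rule stable_imp_Dist)
  have shF: "shift_arr F \<in> Arr K" "Dom K (shift_arr F) = Dom K (\<omega> X)" "Cod K (shift_arr F) = Dom K (\<omega> B)"
    "\<omega> B \<cdot> shift_arr F = SA F \<cdot> \<omega> X"
    using shift_arr[of F] by simp_all
  have shF': "shift_arr F' \<in> Arr K" "Dom K (shift_arr F') = Dom K (\<omega> B)"
    "Cod K (shift_arr F') = Dom K (\<omega> (Dom K F''))" "\<omega> (Dom K F'') \<cdot> shift_arr F' = SA F' \<cdot> \<omega> B"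
    using shift_arr[of F'] by simp_all
  note [simp] = shF(1-3) shF'(1-3)
  have "SA F' \<cdot> G'' \<in> N" by (rule N_left[OF GN]) simp_all
  then have E: "(u, v, SA F' \<cdot> G'') \<in> phantom_triangles" using uv(1) by (simp add: phantom_triangles_iff)
  have "(q u, q v, q (shift_arr F' \<cdot> dG)) \<in> stable_triangles"
    by (rule stable_triangleI[OF E]) (simp_all add: Comp_reduce[OF shF'(4)] dG(4))
  then have DU: "(q u, q v, AMap (Susp S) (q F') \<cdot>\<^bsub>S\<^esub> q dG) \<in> Dist S"
    using stable_imp_Dist by (simp add: Susp_S_shift)
  have e1: "q dH \<cdot>\<^bsub>S\<^esub> q u = q dF"
    by (simp, subst q_eq_iff[of _ X]) (simp_all add: Comp_reduce[OF dH(4)] dF(4) uv(3))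
  have e2: "q dG \<cdot>\<^bsub>S\<^esub> q v = AMap (Susp S) (q F) \<cdot>\<^bsub>S\<^esub> q dH"
    by (simp add: Susp_S_shift, subst q_eq_iff[of _ B])
      (simp_all add: Comp_reduce[OF dG(4)] Comp_reduce[OF shF(4)] dH(4) uv(5))
  have ij1: "is_iso S (q j1)" by (rule is_iso_inclusion(1)[OF B1]) (use \<nu>_Dom in simp)
  have ij2: "is_iso S (q j2)" by (rule is_iso_inclusion(1)[OF B2]) (use \<nu>_Dom in simp)
  have "i1 \<cdot> \<iota> X \<in> factoring K \<P>" by (rule Q.factoringI) (use \<nu>_Dom in simp_all)
  then have qF: "q F = q j1 \<cdot>\<^bsub>S\<^esub> q f0"
    unfolding F_def by simp (rule q_eqI, simp_all)
  have "i2 \<cdot> (\<iota> B \<cdot> j1) \<in> factoring K \<P>" by (rule Q.factoringI) (use \<nu>_Dom in simp_all)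
  then have qG: "q G \<cdot>\<^bsub>S\<^esub> q j1 = q j2 \<cdot>\<^bsub>S\<^esub> q g0"
    unfolding G_def by simp (rule q_eqI, simp_all)
  have DH': "(q G \<cdot>\<^bsub>S\<^esub> q F, q H', q dH) \<in> Dist S" using DH by simp
  have e3: "q u \<cdot>\<^bsub>S\<^esub> q F' = q H' \<cdot>\<^bsub>S\<^esub> q G" "q v \<cdot>\<^bsub>S\<^esub> q H' = q G'"
    by (simp_all add: uv(2,4))
  show ?thesis
    unfolding f0(2) g0(2)
    by (rule exI[of _ "q j1"], rule exI[of _ "q j2"], rule exI[of _ "q F"], rule exI[of _ "q F'"],
        rule exI[of _ "q dF"], rule exI[of _ "q G"], rule exI[of _ "q G'"], rule exI[of _ "q dG"],
        rule exI[of _ "q H'"], rule exI[of _ "q dH"], rule exI[of _ "q u"], rule exI[of _ "q v"],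
        intro conjI ij1 ij2 qF qG DF DG DH' DU e1 e2 e3) simp_all
qed

theorem stable_triangulated: "triangulated_category S"
proof -
  interpret C: triangulation_criterion S
  proof unfold_locales
    show "is_equivalence S S (Susp S)" by (rule Susp_S_equivalence)
    show "Dist S \<subseteq> triangles S" using Dist_S_iff S.tri_isomorphic_triangles by blast
    show "T' \<in> Dist S" if "T \<in> Dist S" "tri_isomorphic S T T'" for T T'
      using that by (rule Dist_S_iso_closed)
    show "(Idt S X, Zro S X Z, Zro S Z (S.SO X)) \<in> Dist S"
      if "X \<in> Obj S" "zero_object S Z" for X Z
      using that by (rule Dist_S_id)
    show "\<exists>g h. (f, g, h) \<in> Dist S" if "f \<in> Arr S" for f using that by (rule Dist_S_cone)
    show "(g, h, Neg S (S.SA f)) \<in> Dist S" if "(f, g, h) \<in> Dist S" for f g h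
      using that by (rule Dist_S_rotate)
    show "hom_exact S T" if "T \<in> Dist S" for T using that by (rule Dist_S_exact)
  qed (fact Dist_S_fill Dist_S_octahedron)+
  show ?thesis by (rule C.triangulated)
qed

end

section \<open>Monic and epic arrows in homotopy cartesian squares\<close>

context triangulated_category
begin

lemma htpy_cartesianE:
  assumes "htpy_cartesian K a b c d"
  obtains T i j p q e where "a \<in> Arr K" "b \<in> Arr K" "c \<in> Arr K" "d \<in> Arr K" "Dom K a = Dom K b"
    "Cod K a = Dom K c" "Cod K b = Dom K d" "Cod K c = Cod K d"
    "is_biproduct K (Dom K c) (Dom K d) T i j p q"
    "(i \<cdot> a \<boxplus> Neg K (j \<cdot> b), c \<cdot> p \<boxplus> d \<cdot> q, e) \<in> Dist K" "Dom K e = Cod K d"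
proof -
  obtain T i j p q e where t: "a \<in> Arr K" "b \<in> Arr K" "c \<in> Arr K" "d \<in> Arr K" "Dom K a = Dom K b"
    "Cod K a = Dom K c" "Cod K b = Dom K d" "Cod K c = Cod K d"
    and B: "is_biproduct K (Dom K c) (Dom K d) T i j p q"
    and D: "(i \<cdot> a \<boxplus> Neg K (j \<cdot> b), c \<cdot> p \<boxplus> d \<cdot> q, e) \<in> Dist K"
    using assms unfolding htpy_cartesian_def by auto
  have "Dom K e = Cod K d" using DistD(5)[OF D] t biproductD[OF B] by simp
  with t B D show ?thesis by (rule that)
qed

text \<open>If \<open>d u = 0\<close>, then \<open>(0, u)\<close> is annihilated by \<open>(c,
  d)\<close>, so it factors as \<open>(a, -b) w\<close>; now \<open>a w = 0\<close> forces
  \<open>w = 0\<close> and then \<open>u = 0\<close>.\<close>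

lemma monic_pushout:
  assumes H: "htpy_cartesian K a b c d" and m: "monic a" shows "monic d"
proof -
  obtain T i j p q e where t: "a \<in> Arr K" "b \<in> Arr K" "c \<in> Arr K" "d \<in> Arr K" "Dom K a = Dom K b"
    "Cod K a = Dom K c" "Cod K b = Dom K d" "Cod K c = Cod K d"
    and B: "is_biproduct K (Dom K c) (Dom K d) T i j p q"
    and D: "(i \<cdot> a \<boxplus> Neg K (j \<cdot> b), c \<cdot> p \<boxplus> d \<cdot> q, e) \<in> Dist K" and e: "Dom K e = Cod K d"
    using H by (rule htpy_cartesianE)
  note [simp] = t biproductD[OF B] e
  show ?thesis
    unfolding monic_def
  proof (intro conjI ballI impI)
    fix u assume u: "u \<in> Arr K" "Cod K u = Dom K d" "d \<cdot> u = Zro K (Dom K u) (Cod K d)"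
    note [simp] = u(1,2)
    have "(c \<cdot> p \<boxplus> d \<cdot> q) \<cdot> (j \<cdot> u) = Zro K (Dom K (j \<cdot> u)) (Dom K e)"
      using u(3) by simp
    then obtain w where w: "w \<in> Arr K" "Dom K w = Dom K u" "Cod K w = Dom K b"
      "(i \<cdot> a \<boxplus> Neg K (j \<cdot> b)) \<cdot> w = j \<cdot> u"
      using Dist_exact1[OF D, of "j \<cdot> u"] by auto
    note [simp] = w(1-3)
    have "a \<cdot> w = p \<cdot> ((i \<cdot> a \<boxplus> Neg K (j \<cdot> b)) \<cdot> w)" by simp
    also have "\<dots> = Zro K (Dom K u) (Dom K c)" unfolding w(4) by simp
    finally have w0: "w = Zro K (Dom K u) (Dom K b)"
      using monicD[OF m, of w] by simp
    have "u = q \<cdot> ((i \<cdot> a \<boxplus> Neg K (j \<cdot> b)) \<cdot> w)" unfolding w(4) by simp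
    then show "u = Zro K (Dom K u) (Dom K d)" unfolding w0 by simp
  qed simp
qed

text \<open>Dual to the preceding argument, with \<open>(u, 0)\<close> as the annihilated arrow
  out of the direct sum.\<close>

lemma epic_pullback:
  assumes H: "htpy_cartesian K a b c d" and m: "epic d" shows "epic a"
proof -
  obtain T i j p q e where t: "a \<in> Arr K" "b \<in> Arr K" "c \<in> Arr K" "d \<in> Arr K" "Dom K a = Dom K b"
    "Cod K a = Dom K c" "Cod K b = Dom K d" "Cod K c = Cod K d"
    and B: "is_biproduct K (Dom K c) (Dom K d) T i j p q"
    and D: "(i \<cdot> a \<boxplus> Neg K (j \<cdot> b), c \<cdot> p \<boxplus> d \<cdot> q, e) \<in> Dist K" and e: "Dom K e = Cod K d"
    using H by (rule htpy_cartesianE)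
  note [simp] = t biproductD[OF B] e
  show ?thesis
    unfolding epic_def
  proof (intro conjI ballI impI)
    fix u assume u: "u \<in> Arr K" "Dom K u = Cod K a" "u \<cdot> a = Zro K (Dom K a) (Cod K u)"
    note [simp] = u(1) u(2)[simplified]
    have ua: "u \<cdot> a = Zro K (Dom K b) (Cod K u)" using u(3) by simp
    have "(u \<cdot> p) \<cdot> (i \<cdot> a \<boxplus> Neg K (j \<cdot> b))
        = Zro K (Dom K (i \<cdot> a \<boxplus> Neg K (j \<cdot> b))) (Cod K (u \<cdot> p))"
      by (simp add: ua)
    then obtain w where w: "w \<in> Arr K" "Dom K w = Cod K d" "Cod K w = Cod K u"
      "w \<cdot> (c \<cdot> p \<boxplus> d \<cdot> q) = u \<cdot> p"
      using Dist_coexact2[OF D, of "u \<cdot> p"] by auto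
    note [simp] = w(1-3)
    have "w \<cdot> d = (w \<cdot> (c \<cdot> p \<boxplus> d \<cdot> q)) \<cdot> j" by simp
    also have "\<dots> = Zro K (Dom K d) (Cod K u)" unfolding w(4) by simp
    finally have w0: "w = Zro K (Cod K d) (Cod K u)"
      using epicD[OF m, of w] by simp
    have "u = (w \<cdot> (c \<cdot> p \<boxplus> d \<cdot> q)) \<cdot> i" unfolding w(4) by simp
    then show "u = Zro K (Cod K a) (Cod K u)" unfolding w0 by simp
  qed simp
qed

lemma epic_saturated:
  assumes H: "htpy_cartesian K a b c d" and m: "epic c" "epic a" shows "epic d"
proof -
  obtain T i j p q e where t: "a \<in> Arr K" "b \<in> Arr K" "c \<in> Arr K" "d \<in> Arr K" "Dom K a = Dom K b"
    "Cod K a = Dom K c" "Cod K b = Dom K d" "Cod K c = Cod K d"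
    and B: "is_biproduct K (Dom K c) (Dom K d) T i j p q"
    and D: "(i \<cdot> a \<boxplus> Neg K (j \<cdot> b), c \<cdot> p \<boxplus> d \<cdot> q, e) \<in> Dist K" and e: "Dom K e = Cod K d"
    using H by (rule htpy_cartesianE)
  note [simp] = t biproductD[OF B] e
  have "c \<cdot> a \<boxplus> Neg K (d \<cdot> b) = Zro K (Dom K b) (Cod K d)"
    using Dist_comp_zero1[OF D] by simp
  then have comm: "c \<cdot> a = d \<cdot> b" by (rule Sub_eq_Zro[rotated 4]) simp_all
  show ?thesis
    unfolding epic_def
  proof (intro conjI ballI impI)
    fix u assume u: "u \<in> Arr K" "Dom K u = Cod K d" "u \<cdot> d = Zro K (Dom K d) (Cod K u)"
    note [simp] = u(1,2)
    have "(u \<cdot> c) \<cdot> a = (u \<cdot> d) \<cdot> b" by (simp add: comm)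
    also have "\<dots> = Zro K (Dom K b) (Cod K u)" unfolding u(3) by simp
    finally have "u \<cdot> c = Zro K (Dom K c) (Cod K u)"
      using epicD[OF m(2), of "u \<cdot> c"] by simp
    then show "u = Zro K (Cod K d) (Cod K u)"
      using epicD[OF m(1), of u] by simp
  qed simp
qed

end

section \<open>The triangles split by an exact functor\<close>

locale exact_functor_data = K: triangulated_category K + L: triangulated_category L + F: additive_functor K L F
  for K :: "('o, 'm, 'x) tricat_scheme" and L :: "('p, 'n, 'y) tricat_scheme"
    and F :: "('o, 'm, 'p, 'n) cfunctor" +
  fixes \<phi> :: "'o \<Rightarrow> 'n"
  assumes exact: "exact_functor K L F \<phi>"
begin

definition kernel_arrows :: "'m set" where
  "kernel_arrows = {h \<in> Arr K. AMap F h = Zro L (OMap F (Dom K h)) (OMap F (Cod K h))}"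

lemma \<phi>_iso: assumes "X \<in> Obj K"
  shows "\<phi> X \<in> Arr L" "Dom L (\<phi> X) = OMap F (K.SO X)" "Cod L (\<phi> X) = L.SO (OMap F X)" "is_iso L (\<phi> X)"
  using exact assms unfolding exact_functor_def nat_iso_def comp_functor_def by auto

lemma \<phi>_natural:
  "f \<in> Arr K \<Longrightarrow> \<phi> (Cod K f) \<cdot>\<^bsub>L\<^esub> AMap F (K.SA f) = L.SA (AMap F f) \<cdot>\<^bsub>L\<^esub> \<phi> (Dom K f)"
  using exact unfolding exact_functor_def nat_iso_def comp_functor_def by simp

lemma F_Dist: "(f, g, h) \<in> Dist K \<Longrightarrow> (AMap F f, AMap F g, \<phi> (Dom K f) \<cdot>\<^bsub>L\<^esub> AMap F h) \<in> Dist L"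
  using exact unfolding exact_functor_def by blast

text \<open>The isomorphism from \<open>F \<Sigma>\<close> to \<open>\<Sigma> F\<close> carries
  \<open>F (\<Sigma>f)\<close> to \<open>\<Sigma> (F f)\<close>, and the suspension of
  \<open>L\<close> is faithful.\<close>

lemma kernel_Susp:
  assumes f: "f \<in> Arr K" shows "K.SA f \<in> kernel_arrows \<longleftrightarrow> f \<in> kernel_arrows"
proof
  note [simp] = f \<phi>_iso[of "Dom K f"] \<phi>_iso[of "Cod K f"]
  assume "K.SA f \<in> kernel_arrows"
  then have z: "AMap F (K.SA f) = Zro L (OMap F (K.SO (Dom K f))) (OMap F (K.SO (Cod K f)))"
    by (simp add: kernel_arrows_def)
  have e: "L.SA (AMap F f) \<cdot>\<^bsub>L\<^esub> \<phi> (Dom K f) = Zro L (OMap F (K.SO (Dom K f))) (L.SO (OMap F (Cod K f)))"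
    unfolding \<phi>_natural[OF f, symmetric] z by simp
  obtain p where p: "p \<in> Arr L" "Dom L p = L.SO (OMap F (Dom K f))" "Cod L p = OMap F (K.SO (Dom K f))"
    "\<phi> (Dom K f) \<cdot>\<^bsub>L\<^esub> p = Idt L (L.SO (OMap F (Dom K f)))"
    using L.is_isoE[OF \<phi>_iso(4)[of "Dom K f"]] \<phi>_iso(2,3)[of "Dom K f"] f K.Dom_Obj by metis
  have "L.SA (AMap F f) = (L.SA (AMap F f) \<cdot>\<^bsub>L\<^esub> \<phi> (Dom K f)) \<cdot>\<^bsub>L\<^esub> p" using p by simp
  also have "\<dots> = Zro L (L.SO (OMap F (Dom K f))) (L.SO (OMap F (Cod K f)))" unfolding e using p by simp
  finally have "AMap F f = Zro L (OMap F (Dom K f)) (OMap F (Cod K f))"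
    using L.susp_eq_Zro[of "AMap F f"] by simp
  then show "f \<in> kernel_arrows" by (simp add: kernel_arrows_def)
next
  note [simp] = f \<phi>_iso[of "Dom K f"] \<phi>_iso[of "Cod K f"]
  assume "f \<in> kernel_arrows"
  then have "L.SA (AMap F f) \<cdot>\<^bsub>L\<^esub> \<phi> (Dom K f) = Zro L (OMap F (K.SO (Dom K f))) (L.SO (OMap F (Cod K f)))"
    by (simp add: kernel_arrows_def)
  then have "\<phi> (Cod K f) \<cdot>\<^bsub>L\<^esub> AMap F (K.SA f) =
    \<phi> (Cod K f) \<cdot>\<^bsub>L\<^esub> Zro L (OMap F (K.SO (Dom K f))) (OMap F (K.SO (Cod K f)))"
    unfolding \<phi>_natural[OF f] by simp
  then have "AMap F (K.SA f) = Zro L (OMap F (K.SO (Dom K f))) (OMap F (K.SO (Cod K f)))"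
    by (rule L.iso_cancel_left[OF \<phi>_iso(4)[of "Cod K f"], rotated -1]) simp_all
  then show "K.SA f \<in> kernel_arrows" by (simp add: kernel_arrows_def)
qed

sublocale N: phantom_ideal K kernel_arrows
proof unfold_locales
  show "kernel_arrows \<subseteq> Arr K" by (auto simp: kernel_arrows_def)
  fix f assume "f \<in> Arr K"
  then show "K.SA f \<in> kernel_arrows \<longleftrightarrow> f \<in> kernel_arrows" by (rule kernel_Susp)
qed (simp_all add: kernel_arrows_def)

lemma split_triangles_eq: "split_triangles K L F = N.phantom_triangles"
  unfolding split_triangles_def N.phantom_triangles_def unfolding kernel_arrows_def
  by (auto dest: K.DistD(3))

lemma kernel_Add:
  "\<lbrakk>f \<in> kernel_arrows; g \<in> kernel_arrows; Dom K f = Dom K g; Cod K f = Cod K g\<rbrakk>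
    \<Longrightarrow> f \<boxplus>\<^bsub>K\<^esub> g \<in> kernel_arrows"
  by (simp add: kernel_arrows_def)

lemma \<phi>_comp_zero:
  assumes T: "(f, g, h) \<in> Dist K"
  shows "\<phi> (Dom K f) \<cdot>\<^bsub>L\<^esub> AMap F h = Zro L (OMap F (Dom K h)) (L.SO (OMap F (Dom K f))) \<longleftrightarrow>
    h \<in> kernel_arrows"
proof
  note [simp] = K.DistD[OF T] \<phi>_iso[of "Dom K f"]
  assume "\<phi> (Dom K f) \<cdot>\<^bsub>L\<^esub> AMap F h = Zro L (OMap F (Dom K h)) (L.SO (OMap F (Dom K f)))"
  then have "\<phi> (Dom K f) \<cdot>\<^bsub>L\<^esub> AMap F h = \<phi> (Dom K f) \<cdot>\<^bsub>L\<^esub> Zro L (OMap F (Dom K h)) (OMap F (K.SO (Dom K f)))"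
    by simp
  then have "AMap F h = Zro L (OMap F (Dom K h)) (OMap F (K.SO (Dom K f)))"
    by (rule L.iso_cancel_left[OF \<phi>_iso(4)[of "Dom K f"], rotated -1]) simp_all
  then show "h \<in> kernel_arrows" by (simp add: kernel_arrows_def)
next
  note [simp] = K.DistD[OF T] \<phi>_iso[of "Dom K f"]
  assume "h \<in> kernel_arrows"
  then show "\<phi> (Dom K f) \<cdot>\<^bsub>L\<^esub> AMap F h = Zro L (OMap F (Dom K h)) (L.SO (OMap F (Dom K f)))"
    by (simp add: kernel_arrows_def)
qed

text \<open>In a triangulated category the first arrow of a triangle is monic if and only if the
  third vanishes; this is applied to the image triangle in \<open>L\<close>.\<close>

lemma kernel_iff_monic:
  assumes T: "(f, g, h) \<in> Dist K" shows "h \<in> kernel_arrows \<longleftrightarrow> L.monic (AMap F f)"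
proof -
  note [simp] = K.DistD[OF T] \<phi>_iso[of "Dom K f"]
  have z: "h \<in> kernel_arrows \<longleftrightarrow> \<phi> (Dom K f) \<cdot>\<^bsub>L\<^esub> AMap F h
      = Zro L (Dom L (\<phi> (Dom K f) \<cdot>\<^bsub>L\<^esub> AMap F h)) (L.SO (Dom L (AMap F f)))"
    using \<phi>_comp_zero[OF T] by simp
  show ?thesis
  proof
    assume "h \<in> kernel_arrows"
    from L.Dist_zero_imp_mono[OF F_Dist[OF T] z[THEN iffD1, OF this]]
    show "L.monic (AMap F f)" by (simp add: L.monic_def)
  next
    assume m: "L.monic (AMap F f)"
    show "h \<in> kernel_arrows"
      unfolding z by (rule L.Dist_mono_imp_zero[OF F_Dist[OF T]]) (rule L.monicD[OF m], simp_all)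
  qed
qed

lemma kernel_iff_epic:
  assumes T: "(f, g, h) \<in> Dist K" shows "h \<in> kernel_arrows \<longleftrightarrow> L.epic (AMap F g)"
proof -
  note [simp] = K.DistD[OF T] \<phi>_iso[of "Dom K f"]
  have z: "h \<in> kernel_arrows \<longleftrightarrow> \<phi> (Dom K f) \<cdot>\<^bsub>L\<^esub> AMap F h
      = Zro L (Dom L (\<phi> (Dom K f) \<cdot>\<^bsub>L\<^esub> AMap F h)) (L.SO (Dom L (AMap F f)))"
    using \<phi>_comp_zero[OF T] by simp
  show ?thesis
  proof
    assume "h \<in> kernel_arrows"
    from L.Dist_zero_imp_epi[OF F_Dist[OF T] z[THEN iffD1, OF this]]
    show "L.epic (AMap F g)" by (simp add: L.epic_def)
  next
    assume m: "L.epic (AMap F g)"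
    show "h \<in> kernel_arrows"
      unfolding z
    proof (rule L.Dist_epi_imp_zero[OF F_Dist[OF T]])
      fix u assume "u \<in> Arr L" "Dom L u = Dom L (\<phi> (Dom K f) \<cdot>\<^bsub>L\<^esub> AMap F h)"
        "u \<cdot>\<^bsub>L\<^esub> AMap F g = Zro L (Dom L (AMap F g)) (Cod L u)"
      then show "u = Zro L (Dom L (\<phi> (Dom K f) \<cdot>\<^bsub>L\<^esub> AMap F h)) (Cod L u)"
        using L.epicD[OF m, of u] by simp
    qed
  qed
qed

lemma E_monos_iff: "f \<in> E_monos K N.phantom_triangles \<longleftrightarrow> f \<in> Arr K \<and> L.monic (AMap F f)"
proof
  assume "f \<in> E_monos K N.phantom_triangles"
  then obtain g h where "(f, g, h) \<in> Dist K" "h \<in> kernel_arrows"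
    unfolding E_monos_def N.phantom_triangles_def by blast
  then show "f \<in> Arr K \<and> L.monic (AMap F f)" using kernel_iff_monic K.DistD(1) by blast
next
  assume f: "f \<in> Arr K \<and> L.monic (AMap F f)"
  obtain g h where "(f, g, h) \<in> Dist K" using K.TR1_cone f by blast
  then show "f \<in> E_monos K N.phantom_triangles"
    unfolding E_monos_def N.phantom_triangles_def using f kernel_iff_monic by blast
qed

lemma E_epis_iff: "g \<in> E_epis K N.phantom_triangles \<longleftrightarrow> g \<in> Arr K \<and> L.epic (AMap F g)"
proof
  assume "g \<in> E_epis K N.phantom_triangles"
  then obtain f h where "(f, g, h) \<in> Dist K" "h \<in> kernel_arrows"
    unfolding E_epis_def N.phantom_triangles_def by blast
  then show "g \<in> Arr K \<and> L.epic (AMap F g)" using kernel_iff_epic K.DistD(2) by blast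
next
  assume g: "g \<in> Arr K \<and> L.epic (AMap F g)"
  obtain f h where "(f, g, h) \<in> Dist K" using K.Dist_fiber g by blast
  then show "g \<in> E_epis K N.phantom_triangles"
    unfolding E_epis_def N.phantom_triangles_def using g kernel_iff_epic by blast
qed

lemma htpy_cartesian_image:
  assumes "htpy_cartesian K a b c d"
  shows "htpy_cartesian L (AMap F a) (AMap F b) (AMap F c) (AMap F d)"
proof -
  obtain T i j p q e where t: "a \<in> Arr K" "b \<in> Arr K" "c \<in> Arr K" "d \<in> Arr K" "Dom K a = Dom K b"
    "Cod K a = Dom K c" "Cod K b = Dom K d" "Cod K c = Cod K d"
    and B: "is_biproduct K (Dom K c) (Dom K d) T i j p q"
    and D: "(i \<cdot>\<^bsub>K\<^esub> a \<boxplus>\<^bsub>K\<^esub> Neg K (j \<cdot>\<^bsub>K\<^esub> b), c \<cdot>\<^bsub>K\<^esub> p \<boxplus>\<^bsub>K\<^esub> d \<cdot>\<^bsub>K\<^esub> q, e) \<in> Dist K"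
    using assms unfolding htpy_cartesian_def by auto
  note [simp] = t K.biproductD[OF B]
  have "(AMap F i \<cdot>\<^bsub>L\<^esub> AMap F a \<boxplus>\<^bsub>L\<^esub> Neg L (AMap F j \<cdot>\<^bsub>L\<^esub> AMap F b),
      AMap F c \<cdot>\<^bsub>L\<^esub> AMap F p \<boxplus>\<^bsub>L\<^esub> AMap F d \<cdot>\<^bsub>L\<^esub> AMap F q, \<phi> (Dom K b) \<cdot>\<^bsub>L\<^esub> AMap F e) \<in> Dist L"
    using F_Dist[OF D] by simp
  with F.biproduct_OMap[OF B] show ?thesis
    unfolding htpy_cartesian_def by simp blast
qed

lemma htpy_cartesian_Arr: "htpy_cartesian K a b c d \<Longrightarrow> a \<in> Arr K \<and> d \<in> Arr K"
  by (simp add: htpy_cartesian_def)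

lemma phantom_triangles_sum:
  assumes T1: "T1 \<in> N.phantom_triangles" and T2: "T2 \<in> N.phantom_triangles" and S: "tri_sum K T1 T2 T"
  shows "T \<in> N.phantom_triangles"
proof -
  obtain f1 g1 h1 f2 g2 h2 f g h where e: "T1 = (f1, g1, h1)" "T2 = (f2, g2, h2)" "T = (f, g, h)"
    by (metis prod_cases3)
  have D: "(f1, g1, h1) \<in> Dist K" "(f2, g2, h2) \<in> Dist K" and h: "h1 \<in> kernel_arrows" "h2 \<in> kernel_arrows"
    using T1 T2 unfolding e N.phantom_triangles_iff by blast+
  obtain i1 i2 i3 j1 j2 j3 p1 p2 p3 q1 q2 q3 where
    m: "tri_mor K (f1, g1, h1) (f, g, h) i1 i2 i3" "tri_mor K (f2, g2, h2) (f, g, h) j1 j2 j3"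
    "tri_mor K (f, g, h) (f1, g1, h1) p1 p2 p3" "tri_mor K (f, g, h) (f2, g2, h2) q1 q2 q3"
    and B: "is_biproduct K (Dom K f1) (Dom K f2) (Dom K f) i1 j1 p1 q1"
    "is_biproduct K (Dom K g1) (Dom K g2) (Dom K g) i2 j2 p2 q2"
    "is_biproduct K (Dom K h1) (Dom K h2) (Dom K h) i3 j3 p3 q3"
    using S unfolding e tri_sum.simps by (elim exE conjE)
  have DT: "(f, g, h) \<in> Dist K" by (rule K.Dist_sum[OF D m B])
  note M1 = tri_morD[OF m(1)] and M2 = tri_morD[OF m(2)] and P = tri_morD[OF m(3)] and Q = tri_morD[OF m(4)]
  note [simp] = trianglesD[OF M1(1)] trianglesD[OF M1(2)] trianglesD[OF M2(1)]
    M1(3-11) M2(3-11) P(3-11) Q(3-11)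
  have "h = K.SA i1 \<cdot>\<^bsub>K\<^esub> (K.SA p1 \<cdot>\<^bsub>K\<^esub> h) \<boxplus>\<^bsub>K\<^esub> K.SA j1 \<cdot>\<^bsub>K\<^esub> (K.SA q1 \<cdot>\<^bsub>K\<^esub> h)"
    by (rule K.biproduct_in[OF K.Susp.biproduct_OMap[OF B(1)]]) simp_all
  moreover have "K.SA i1 \<cdot>\<^bsub>K\<^esub> (K.SA p1 \<cdot>\<^bsub>K\<^esub> h) \<boxplus>\<^bsub>K\<^esub> K.SA j1 \<cdot>\<^bsub>K\<^esub> (K.SA q1 \<cdot>\<^bsub>K\<^esub> h) \<in> kernel_arrows"
    unfolding P(14) Q(14)
    by (rule kernel_Add) (simp_all add: N.N_left N.N_right h)
  ultimately have "h \<in> kernel_arrows" by simp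
  then show ?thesis unfolding e N.phantom_triangles_iff using DT by blast
qed

lemma phantom_triangles_retract:
  assumes T: "T \<in> N.phantom_triangles" and R: "tri_retract K T' T"
  shows "T' \<in> N.phantom_triangles"
proof -
  obtain f g h f' g' h' where e: "T = (f, g, h)" "T' = (f', g', h')" by (metis prod_cases3)
  have h: "h \<in> kernel_arrows" and D: "T \<in> Dist K" using T unfolding e N.phantom_triangles_iff by blast+
  obtain a b c a' b' c' where m: "tri_mor K (f', g', h') (f, g, h) a b c"
    and m': "tri_mor K (f, g, h) (f', g', h') a' b' c'"
    and r: "c' \<cdot>\<^bsub>K\<^esub> c = Idt K (Dom K h')"
    using R unfolding e by auto
  note M = tri_morD[OF m] and M' = tri_morD[OF m']
  note [simp] = trianglesD[OF M(1)] trianglesD[OF M(2)] M(3-11) M'(3-11)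
  have "h' = (h' \<cdot>\<^bsub>K\<^esub> c') \<cdot>\<^bsub>K\<^esub> c" by (simp add: r)
  also have "\<dots> = K.SA a' \<cdot>\<^bsub>K\<^esub> (h \<cdot>\<^bsub>K\<^esub> c)" unfolding M'(14)[symmetric] by simp
  also have "\<dots> \<in> kernel_arrows" by (simp add: N.N_left N.N_right h)
  finally have "h' \<in> kernel_arrows" .
  then show ?thesis using K.Dist_retract[OF D R] unfolding e N.phantom_triangles_iff by blast
qed

lemma phantom_triangles_iso:
  assumes T: "T \<in> N.phantom_triangles" and I: "tri_isomorphic K T T'"
  shows "T' \<in> N.phantom_triangles"
proof -
  obtain f g h f' g' h' where e: "T = (f, g, h)" "T' = (f', g', h')" by (metis prod_cases3)
  obtain a b c a' b' c' where "tri_mor K (f, g, h) (f', g', h') a b c" "tri_mor K (f', g', h') (f, g, h) a' b' c'"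
    "a \<cdot>\<^bsub>K\<^esub> a' = Idt K (Dom K f')" "b \<cdot>\<^bsub>K\<^esub> b' = Idt K (Dom K g')" "c \<cdot>\<^bsub>K\<^esub> c' = Idt K (Dom K h')"
    using K.tri_isomorphicE[OF I[unfolded e]] by metis
  then have "tri_retract K T' T" unfolding e tri_retract.simps by blast
  then show ?thesis by (rule phantom_triangles_retract[OF T])
qed

lemma phantom_triangles_proper: "proper_class K N.phantom_triangles"
  unfolding proper_class_def
proof (intro conjI allI impI)
  show "N.phantom_triangles \<subseteq> Dist K" by (auto simp: N.phantom_triangles_def)
  show "\<forall>(f, g, h) \<in> Dist K. (f, g, h) \<in> N.phantom_triangles \<longleftrightarrow>
        (Neg K (K.SA f), Neg K (K.SA g), Neg K (K.SA h)) \<in> N.phantom_triangles"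
  proof (clarify)
    fix f g h assume T: "(f, g, h) \<in> Dist K"
    note [simp] = K.DistD[OF T]
    have "Neg K (K.SA h) \<in> kernel_arrows \<longleftrightarrow> K.SA h \<in> kernel_arrows"
      by (simp add: kernel_arrows_def L.Neg_eq_Zro)
    then show "(f, g, h) \<in> N.phantom_triangles \<longleftrightarrow>
        (Neg K (K.SA f), Neg K (K.SA g), Neg K (K.SA h)) \<in> N.phantom_triangles"
      using T K.Dist_rotate[OF K.Dist_rotate[OF K.Dist_rotate[OF T]]] kernel_Susp[of h]
      by (simp add: N.phantom_triangles_iff)
  qed
  fix X Z assume XZ: "X \<in> Obj K \<and> zero_object K Z"
  then have [simp]: "X \<in> Obj K" "Z \<in> Obj K" by auto
  show "(Idt K X, Zro K X Z, Zro K Z (K.SO X)) \<in> N.phantom_triangles"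
    "(Zro K Z X, Idt K X, Zro K X (K.SO Z)) \<in> N.phantom_triangles"
    using K.TR1_id[of X Z] K.Dist_trivial2[of Z X] XZ N.N_Zro by (simp_all add: N.phantom_triangles_iff)
next
  fix a b c d
  assume H: "htpy_cartesian K a b c d \<and> a \<in> E_monos K N.phantom_triangles"
  then show "d \<in> E_monos K N.phantom_triangles"
    unfolding E_monos_iff using L.monic_pushout htpy_cartesian_image htpy_cartesian_Arr by blast
next
  fix a b c d
  assume H: "htpy_cartesian K a b c d \<and> d \<in> E_epis K N.phantom_triangles"
  then show "a \<in> E_epis K N.phantom_triangles"
    unfolding E_epis_iff using L.epic_pullback htpy_cartesian_image htpy_cartesian_Arr by blast
next
  fix a b c d
  assume H: "htpy_cartesian K a b c d \<and> c \<in> E_epis K N.phantom_triangles \<and> a \<in> E_epis K N.phantom_triangles"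
  then show "d \<in> E_epis K N.phantom_triangles"
    unfolding E_epis_iff using L.epic_saturated htpy_cartesian_image htpy_cartesian_Arr by blast
qed (use phantom_triangles_iso phantom_triangles_sum phantom_triangles_retract in blast)+

section \<open>Projectives and injectives from adjoints\<close>

abbreviation "proj_F \<equiv> projectives K N.phantom_triangles"
abbreviation "inj_F \<equiv> injectives K N.phantom_triangles"

text \<open>The adjunction bijection turns \<open>h u\<close> into a composite with \<open>F h =
  0\<close>, which is also what it makes of the zero arrow.\<close>

lemma left_adjoint_projective:
  assumes A: "adjoint L K V F" and X: "X \<in> Obj L"
  shows "OMap V X \<in> proj_F"
proof -
  obtain \<Phi> where V: "is_functor L K V"
    and bij: "\<And>X Y. \<lbrakk>X \<in> Obj L; Y \<in> Obj K\<rbrakk> \<Longrightarrow> bij_betw (\<Phi> X Y) (Hom K (OMap V X) Y) (Hom L X (OMap F Y))"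
    and post: "\<And>X b f. \<lbrakk>X \<in> Obj L; b \<in> Arr K; f \<in> Hom K (OMap V X) (Dom K b)\<rbrakk>
      \<Longrightarrow> \<Phi> X (Cod K b) (b \<cdot>\<^bsub>K\<^esub> f) = AMap F b \<cdot>\<^bsub>L\<^esub> \<Phi> X (Dom K b) f"
    using adjointE[OF A] by metis
  interpret V: cat_functor L K V using V by (rule cat_functorI)
  note [simp] = X
  have "h \<cdot>\<^bsub>K\<^esub> u = Zro K (OMap V X) (Cod K h)"
    if h: "h \<in> kernel_arrows" and u: "u \<in> Hom K (OMap V X) (Dom K h)" for h u
  proof -
    have [simp]: "h \<in> Arr K" using h by (simp add: kernel_arrows_def)
    note z = post[of X "Zro K (Dom K h) (Cod K h)" u] and hu = post[of X h u]
    have "\<Phi> X (Cod K h) (h \<cdot>\<^bsub>K\<^esub> u) = \<Phi> X (Cod K h) (Zro K (Dom K h) (Cod K h) \<cdot>\<^bsub>K\<^esub> u)"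
      using z hu u h by (simp add: kernel_arrows_def)
    moreover have "h \<cdot>\<^bsub>K\<^esub> u \<in> Hom K (OMap V X) (Cod K h)"
      "Zro K (Dom K h) (Cod K h) \<cdot>\<^bsub>K\<^esub> u \<in> Hom K (OMap V X) (Cod K h)" using u by simp_all
    ultimately have "h \<cdot>\<^bsub>K\<^esub> u = Zro K (Dom K h) (Cod K h) \<cdot>\<^bsub>K\<^esub> u"
      using bij[of X "Cod K h"] X K.Cod_Obj[of h] \<open>h \<in> Arr K\<close> unfolding bij_betw_def inj_on_def by blast
    then show ?thesis using u by simp
  qed
  then show ?thesis unfolding N.projectives_iff by simp
qed

lemma right_adjoint_injective:
  assumes A: "adjoint K L F U" and Y: "Y \<in> Obj L"
  shows "OMap U Y \<in> inj_F"
proof -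
  obtain \<Phi> where U: "is_functor L K U"
    and bij: "\<And>X Y. \<lbrakk>X \<in> Obj K; Y \<in> Obj L\<rbrakk> \<Longrightarrow> bij_betw (\<Phi> X Y) (Hom L (OMap F X) Y) (Hom K X (OMap U Y))"
    and pre: "\<And>Y a f. \<lbrakk>Y \<in> Obj L; a \<in> Arr K; f \<in> Hom L (OMap F (Cod K a)) Y\<rbrakk>
      \<Longrightarrow> \<Phi> (Dom K a) Y (f \<cdot>\<^bsub>L\<^esub> AMap F a) = \<Phi> (Cod K a) Y f \<cdot>\<^bsub>K\<^esub> a"
    using adjointE[OF A] by metis
  interpret U: cat_functor L K U using U by (rule cat_functorI)
  note [simp] = Y
  have "u \<cdot>\<^bsub>K\<^esub> h = Zro K (Dom K h) (OMap U Y)"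
    if h: "h \<in> kernel_arrows" and u: "u \<in> Hom K (Cod K h) (OMap U Y)" for h u
  proof -
    have hA[simp]: "h \<in> Arr K" using h by (simp add: kernel_arrows_def)
    have "u \<in> \<Phi> (Cod K h) Y ` Hom L (OMap F (Cod K h)) Y"
      using bij[of "Cod K h" Y] u by (simp add: bij_betw_def)
    then obtain v where v: "v \<in> Hom L (OMap F (Cod K h)) Y" and uv: "u = \<Phi> (Cod K h) Y v" by blast
    have "u \<cdot>\<^bsub>K\<^esub> h = \<Phi> (Dom K h) Y (v \<cdot>\<^bsub>L\<^esub> AMap F h)"
      unfolding uv using pre[of Y h v] v by simp
    also have "v \<cdot>\<^bsub>L\<^esub> AMap F h = v \<cdot>\<^bsub>L\<^esub> AMap F (Zro K (Dom K h) (Cod K h))"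
      using h by (simp add: kernel_arrows_def)
    also have "\<Phi> (Dom K h) Y \<dots> = u \<cdot>\<^bsub>K\<^esub> Zro K (Dom K h) (Cod K h)"
      unfolding uv using pre[of Y "Zro K (Dom K h) (Cod K h)" v] v by simp
    finally show ?thesis using u by simp
  qed
  then show ?thesis unfolding N.injectives_iff by simp
qed

text \<open>The counit becomes a split epimorphism under \<open>F\<close>, so its triangle is
  \<open>F\<close>-split.\<close>

lemma counit_triangle:
  assumes A: "adjoint L K V F" and X: "X \<in> Obj K"
  obtains f g h where "(f, g, h) \<in> N.phantom_triangles" "Dom K h = X" "Cod K g = X"
    "Dom K g = OMap V (OMap F X)"
proof -
  obtain g s where g: "g \<in> Hom K (OMap V (OMap F X)) X"
    "s \<in> Hom L (OMap F X) (OMap F (OMap V (OMap F X)))" "AMap F g \<cdot>\<^bsub>L\<^esub> s = Idt L (OMap F X)"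
    by (rule adjoint_counit[OF A X])
  have "g \<in> Arr K" using g by simp
  then obtain f h where T: "(f, g, h) \<in> Dist K" by (rule K.Dist_fiber)
  have "L.epic (AMap F g)" by (rule L.split_epic[of _ s]) (use g in simp_all)
  then have "(f, g, h) \<in> N.phantom_triangles" using T kernel_iff_epic N.phantom_triangles_iff by blast
  then show ?thesis using that K.DistD(5)[OF T] g by simp
qed

lemma unit_triangle:
  assumes A: "adjoint K L F U" and X: "X \<in> Obj K"
  obtains f g h where "(f, g, h) \<in> N.phantom_triangles" "Dom K f = X" "Cod K f = OMap U (OMap F X)"
proof -
  obtain f r where f: "f \<in> Hom K X (OMap U (OMap F X))"
    "r \<in> Hom L (OMap F (OMap U (OMap F X))) (OMap F X)" "r \<cdot>\<^bsub>L\<^esub> AMap F f = Idt L (OMap F X)"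
    by (rule adjoint_unit[OF A X])
  have "f \<in> Arr K" using f by simp
  then obtain g h where T: "(f, g, h) \<in> Dist K" using K.TR1_cone by blast
  have "L.monic (AMap F f)" by (rule L.split_monic[of _ r]) (use f in simp_all)
  then have "(f, g, h) \<in> N.phantom_triangles" using T kernel_iff_monic N.phantom_triangles_iff by blast
  then show ?thesis using that f by simp
qed

text \<open>For projective \<open>P\<close> the phantom in the triangle of the counit \<open>V F P
  \<rightarrow> P\<close> is annihilated by the identity of \<open>P\<close>, so the triangle
  splits and \<open>P\<close> is a summand of \<open>V F P\<close>.\<close>

lemma projectives_eq_add:
  assumes A: "adjoint L K V F"
  shows "proj_F = add_closure K (ess_image L K V)"
proof (intro equalityI subsetI)
  fix P assume P: "P \<in> proj_F"
  then have Po: "P \<in> Obj K" by (simp add: projectives_def)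
  obtain f g h where E: "(f, g, h) \<in> N.phantom_triangles" and d: "Dom K h = P" "Dom K g = OMap V (OMap F P)"
    using counit_triangle[OF A Po] by metis
  have T: "(f, g, h) \<in> Dist K" and h: "h \<in> kernel_arrows" using E N.phantom_triangles_iff by blast+
  note [simp] = K.DistD[OF T]
  have "Idt K P \<in> Hom K P (Dom K h)" using Po d by simp
  then have "h \<cdot>\<^bsub>K\<^esub> Idt K P = Zro K P (Cod K h)" using P h unfolding N.projectives_iff by blast
  then have "h = Zro K (Dom K h) (K.SO (Dom K f))" using d by simp
  then have ds: "direct_sum K P (Dom K f) (OMap V (OMap F P))" using K.Dist_split(1)[OF T] d by simp
  have V: "OMap V (OMap F P) \<in> Obj K" using K.Dom_Obj[of g] d by simp
  then have "isomorphic K (OMap V (OMap F P)) (OMap V (OMap F P))"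
    unfolding isomorphic_def by - (rule bexI[of _ "Idt K (OMap V (OMap F P))"], simp_all)
  then have "OMap V (OMap F P) \<in> ess_image L K V"
    unfolding ess_image_def using V F.OMap_Obj[OF Po] by blast
  then show "P \<in> add_closure K (ess_image L K V)" by (rule add_closure.summand[OF add_closure.base ds])
next
  fix P assume "P \<in> add_closure K (ess_image L K V)"
  then show "P \<in> proj_F"
  proof induction
    case (base X)
    then obtain B where B: "B \<in> Obj L" "isomorphic K X (OMap V B)" unfolding ess_image_def by blast
    obtain Z where "zero_object K Z" using K.zero_object_exists by blast
    then show ?case
      using K.isomorphic_direct_sum[OF B(2)] N.projectives_summand[OF left_adjoint_projective[OF A B(1)]] by blast
  next
    case (zero Z) then show ?case by (rule N.zero_projective_injective)
  next
    case (sum X Y S) then show ?case using N.projectives_sum by blast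
  next
    case (summand S X Y) then show ?case using N.projectives_summand by blast
  qed
qed

lemma injectives_eq_add:
  assumes A: "adjoint K L F U"
  shows "inj_F = add_closure K (ess_image L K U)"
proof (intro equalityI subsetI)
  fix P assume P: "P \<in> inj_F"
  then have Po: "P \<in> Obj K" by (simp add: injectives_def)
  obtain f g h where E: "(f, g, h) \<in> N.phantom_triangles" and d: "Dom K f = P" "Cod K f = OMap U (OMap F P)"
    using unit_triangle[OF A Po] by metis
  have T: "(f, g, h) \<in> Dist K" and h: "h \<in> kernel_arrows" using E N.phantom_triangles_iff by blast+
  note [simp] = K.DistD[OF T]
  have g: "Dom K g = OMap U (OMap F P)" using d(2) by simp
  have "K.SA (Idt K P) \<cdot>\<^bsub>K\<^esub> h = Zro K (Dom K h) (K.SO (Cod K (Idt K P)))"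
  proof (rule N.susp_kills[OF h])
    fix k x assume "k \<in> kernel_arrows" "x \<in> Hom K (Cod K k) (Cod K (Idt K P))"
    moreover have "Cod K (Idt K P) = P" using Po by simp
    ultimately show "x \<cdot>\<^bsub>K\<^esub> k = Zro K (Dom K k) (Cod K (Idt K P))"
      using P unfolding N.injectives_iff by metis
  qed (use Po d in simp_all)
  then have "h = Zro K (Dom K h) (K.SO (Dom K f))" using d Po by simp
  then have ds: "direct_sum K P (Dom K h) (OMap U (OMap F P))" using K.Dist_split(2)[OF T] d(1) g by simp
  have U: "OMap U (OMap F P) \<in> Obj K" using K.Dom_Obj[of g] g by simp
  then have "isomorphic K (OMap U (OMap F P)) (OMap U (OMap F P))"
    unfolding isomorphic_def by - (rule bexI[of _ "Idt K (OMap U (OMap F P))"], simp_all)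
  then have "OMap U (OMap F P) \<in> ess_image L K U"
    unfolding ess_image_def using U F.OMap_Obj[OF Po] by blast
  then show "P \<in> add_closure K (ess_image L K U)" by (rule add_closure.summand[OF add_closure.base ds])
next
  fix P assume "P \<in> add_closure K (ess_image L K U)"
  then show "P \<in> inj_F"
  proof induction
    case (base X)
    then obtain B where B: "B \<in> Obj L" "isomorphic K X (OMap U B)" unfolding ess_image_def by blast
    obtain Z where "zero_object K Z" using K.zero_object_exists by blast
    then show ?case
      using K.isomorphic_direct_sum[OF B(2)] N.injectives_summand[OF right_adjoint_injective[OF A B(1)]] by blast
  next
    case (zero Z) then show ?case by (rule N.zero_projective_injective)
  next
    case (sum X Y S) then show ?case using N.injectives_sum by blast
  next
    case (summand S X Y) then show ?case using N.injectives_summand by blast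
  qed
qed

end

text \<open>\<open>U A\<close> is isomorphic to \<open>V (W A)\<close>, and every object of
  \<open>L\<close> is isomorphic to some \<open>W B\<close>.\<close>

lemma ess_image_eq:
  assumes K: "category K" and V: "is_functor L K V" and W: "is_equivalence L L W"
    and VW: "nat_isomorphic L K (comp_functor V W) U"
  shows "ess_image L K U = ess_image L K V"
proof -
  interpret V: cat_functor L K V using V by (rule cat_functorI)
  have "is_functor L L W" using W by (simp add: is_equivalence_def)
  then interpret W: cat_functor L L W by (rule cat_functorI)
  have iso: "isomorphic K (OMap V (OMap W A)) (OMap U A)" if "A \<in> Obj L" for A
    using VW that unfolding nat_isomorphic_def nat_iso_def comp_functor_def isomorphic_def by auto
  show ?thesis
  proof (intro equalityI subsetI)
    fix X assume "X \<in> ess_image L K U"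
    then obtain A where A: "X \<in> Obj K" "A \<in> Obj L" "isomorphic K X (OMap U A)" unfolding ess_image_def by blast
    have "isomorphic K X (OMap V (OMap W A))"
      using A(3) V.D.isomorphic_sym[OF iso[OF A(2)]] by (rule V.D.isomorphic_trans)
    then show "X \<in> ess_image L K V" unfolding ess_image_def using A W.OMap_Obj by blast
  next
    fix X assume "X \<in> ess_image L K V"
    then obtain A where A: "X \<in> Obj K" "A \<in> Obj L" "isomorphic K X (OMap V A)" unfolding ess_image_def by blast
    obtain B where B: "B \<in> Obj L" "isomorphic L (OMap W B) A" using is_equivalenceD(3)[OF W A(2)] by blast
    have "isomorphic K X (OMap V (OMap W B))"
      using A(3) V.D.isomorphic_sym[OF V.isomorphic_OMap[OF B(2)]] by (rule V.D.isomorphic_trans)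
    then have "isomorphic K X (OMap U B)" using iso[OF B(1)] by (rule V.D.isomorphic_trans)
    then show "X \<in> ess_image L K U" unfolding ess_image_def using A(1) B(1) by blast
  qed
qed

theorem theorem4p23:
  fixes K :: "('o, 'm) tricat" and L :: "('p, 'n) tricat"
    and F :: "('o, 'm, 'p, 'n) cfunctor" and \<phi> :: "'o \<Rightarrow> 'n"
    and U V :: "('p, 'n, 'o, 'm) cfunctor" and W :: "('p, 'n, 'p, 'n) cfunctor"
  assumes "triangulated_category K" and "triangulated_category L"
    and "exact_functor K L F \<phi>"
    and "adjoint L K V F"
    and "adjoint K L F U"
    and "is_equivalence L L W"
    and "nat_isomorphic L K (comp_functor V W) U"
  shows "F_injectives K L F = F_projectives K L F \<and>
     F_projectives K L F = add_closure K (ess_image L K U) \<and>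
     add_closure K (ess_image L K U) = add_closure K (ess_image L K V) \<and>
     frobenius K (split_triangles K L F) \<and>
     (\<exists>t. injective_choice K (split_triangles K L F) t) \<and>
     (\<forall>t. injective_choice K (split_triangles K L F) t \<longrightarrow>
        triangulated_category (stable_tricat K (split_triangles K L F) t))"
proof -
  interpret K: triangulated_category K by (rule assms)
  interpret L: triangulated_category L by (rule assms)
  have "is_additive_functor K L F" using assms(3) by (simp add: exact_functor_def)
  then interpret F: additive_functor K L F
    by (rule additive_functorI) (rule K.preadditive_category_axioms L.preadditive_category_axioms)+
  interpret E: exact_functor_data K L F \<phi> by unfold_locales (rule assms(3))
  have V: "is_functor L K V" using assms(4) by (simp add: adjoint_def)
  have im: "ess_image L K U = ess_image L K V"
    by (rule ess_image_eq[OF K.category_axioms V assms(6,7)])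
  have p: "E.proj_F = add_closure K (ess_image L K V)" by (rule E.projectives_eq_add[OF assms(4)])
  have i: "E.inj_F = add_closure K (ess_image L K U)" by (rule E.injectives_eq_add[OF assms(5)])
  have pi: "E.proj_F = E.inj_F" using p i im by simp
  have enough_p: "\<exists>f g h. (f, g, h) \<in> E.N.phantom_triangles \<and> Dom K h = X \<and> Cod K g = X \<and> Dom K g \<in> E.proj_F"
    if X: "X \<in> Obj K" for X
  proof -
    obtain f g h where "(f, g, h) \<in> E.N.phantom_triangles" "Dom K h = X" "Cod K g = X"
      "Dom K g = OMap V (OMap F X)" by (rule E.counit_triangle[OF assms(4) X])
    moreover have "OMap V (OMap F X) \<in> E.proj_F"
      by (rule E.left_adjoint_projective[OF assms(4)]) (use X in simp)
    ultimately show ?thesis by metis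
  qed
  have enough_i: "\<exists>f g h. (f, g, h) \<in> E.N.phantom_triangles \<and> Dom K f = X \<and> Cod K f \<in> E.inj_F"
    if X: "X \<in> Obj K" for X
  proof -
    obtain f g h where "(f, g, h) \<in> E.N.phantom_triangles" "Dom K f = X"
      "Cod K f = OMap U (OMap F X)" by (rule E.unit_triangle[OF assms(5) X])
    moreover have "OMap U (OMap F X) \<in> E.inj_F"
      by (rule E.right_adjoint_injective[OF assms(5)]) (use X in simp)
    ultimately show ?thesis by metis
  qed
  have frob: "frobenius K E.N.phantom_triangles"
    unfolding frobenius_def
  proof (intro conjI ballI)
    fix X assume X: "X \<in> Obj K"
    show "\<exists>e \<in> E_epis K E.N.phantom_triangles. Dom K e \<in> E.proj_F \<and> Cod K e = X"
      using enough_p[OF X] unfolding E_epis_def by blast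
    show "\<exists>i \<in> E_monos K E.N.phantom_triangles. Dom K i = X \<and> Cod K i \<in> E.inj_F"
      using enough_i[OF X] unfolding E_monos_def by blast
  qed (rule E.phantom_triangles_proper pi)+
  have ch: "\<exists>t. injective_choice K E.N.phantom_triangles t"
  proof -
    have "\<exists>T. T \<in> Dist K \<and> (case T of (i, v, w) \<Rightarrow>
        Dom K i = X \<and> i \<in> E_monos K E.N.phantom_triangles \<and> Cod K i \<in> E.inj_F)"
      if X: "X \<in> Obj K" for X
    proof -
      obtain f g h where E: "(f, g, h) \<in> E.N.phantom_triangles" "Dom K f = X" "Cod K f \<in> E.inj_F"
        using enough_i[OF X] by blast
      then have "f \<in> E_monos K E.N.phantom_triangles" "(f, g, h) \<in> Dist K"
        unfolding E_monos_def E.N.phantom_triangles_iff by blast+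
      then show ?thesis using E(2,3) by - (rule exI[of _ "(f, g, h)"], simp)
    qed
    from bchoice[OF ballI[OF this]] show ?thesis unfolding injective_choice_def .
  qed
  have st: "triangulated_category (stable_tricat K E.N.phantom_triangles t)"
    if t: "injective_choice K E.N.phantom_triangles t" for t
  proof -
    interpret S: frobenius_ideal K E.kernel_arrows t
      by unfold_locales (use enough_p pi t in blast)+
    show ?thesis by (rule S.stable_triangulated)
  qed
  show ?thesis
    unfolding F_injectives_def F_projectives_def E.split_triangles_eq
    using p i pi im frob ch st by simp
qed

end
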